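(* Let $p$ be a prime, let $c>1$ be a constant and set $\alpha_n=\frac{c\log n}{n}$. Let $(A(n))_{n\ge 1}$ be a sequence of random matrices with $A(n)\in \mathrm{M}_n(\mathbb{F}_p)$ for every $n\ge 1$, and assume that $A(n)$ is $\alpha_n$-balanced for all sufficiently large $n$. Then for every nonnegative integer $k$, $$\lim_{n\to\infty}\mathbb{P}\left(\mathrm{cok}(A(n))\cong \mathbb{F}_p^k\right)=\lim_{n\to\infty}\mathbb{P}\left(\mathrm{rank}(A(n))=n-k\right)=p^{-k^2}\,\frac{\prod_{j=1}^{\infty}(1-p^{-j})}{\prod_{j=1}^{k}(1-p^{-j})^2}.$$
   Context: $\mathbb{F}_p$ is the field with $p$ elements and $\mathrm{M}_n(\mathbb{F}_p)$ is the set of $n\times n$ matrices over $\mathbb{F}_p$. For $A\in \mathrm{M}_n(\mathbb{F}_p)$, regarded as the linear map $\mathbb{F}_p^n\to\mathbb{F}_p^n$, $x\mapsto Ax$, the cokernel is $\mathrm{cok}(A):=\mathbb{F}_p^n/\mathrm{im}(A)$. For a real number $\alpha>0$, a random element $x$ of $\mathbb{F}_p$ is $\alpha$-balanced if $\mathbb{P}(x=u)\le 1-\alpha$ for every $u\in\mathbb{F}_p$. A random matrix in $\mathrm{M}_n(\mathbb{F}_p)$ is $\alpha$-balanced if its entries are independent and each entry is $\alpha$-balanced; the entries are not required to be identically distributed. *)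

theory Defs
  imports "HOL-Probability.Probability" "HOL-Algebra.QuotRing" "Jordan_Normal_Form.DL_Rank"
begin

section \<open>Balanced random elements and matrices\<close>

definition balanced :: "'w measure \<Rightarrow> real \<Rightarrow> ('w \<Rightarrow> 'a) \<Rightarrow> bool" where
  "balanced M \<alpha> x \<longleftrightarrow>
     x \<in> measurable M (count_space UNIV) \<and>
     (\<forall>u. measure M {\<omega> \<in> space M. x \<omega> = u} \<le> 1 - \<alpha>)"

definition balanced_mat :: "'w measure \<Rightarrow> nat \<Rightarrow> real \<Rightarrow> ('w \<Rightarrow> 'a mat) \<Rightarrow> bool" where
  "balanced_mat M n \<alpha> A \<longleftrightarrow>
     prob_space.indep_vars M (\<lambda>_. count_space UNIV)
       (\<lambda>ij \<omega>. A \<omega> $$ ij) ({..<n} \<times> {..<n}) \<and>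
     (\<forall>i<n. \<forall>j<n. balanced M \<alpha> (\<lambda>\<omega>. A \<omega> $$ (i, j)))"


section \<open>Cokernels\<close>

definition mat_image :: "'a :: field mat \<Rightarrow> 'a vec set" where
  "mat_image A = (\<lambda>x. A *\<^sub>v x) ` carrier_vec (dim_col A)"

text \<open>
  The quotient of the codomain of \<open>A\<close> by its image, with the cosets of the image as elements.  Scalar multiplication is written as a union over representatives, in the style
  of \<^const>\<open>rcoset_mult\<close>.  As in \<^const>\<open>module_vec\<close>, the multiplicative fields
  of the record are irrelevant.
\<close>

definition cokernel :: "'a :: field mat \<Rightarrow> ('a, 'a vec set) module" where
  "cokernel A =
     (let V = module_vec TYPE('a) (dim_row A); W = mat_image A in
      \<lparr>carrier = A_RCOSETS V W,
       mult = undefined,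
       one = undefined,
       zero = W,
       add = set_add V,
       smult = (\<lambda>r X. \<Union>x\<in>X. a_r_coset V W (r \<odot>\<^bsub>V\<^esub> x))\<rparr>)"

definition module_isomorphic ::
  "('r, 's) ring_scheme \<Rightarrow> ('r, 'a, 't) module_scheme \<Rightarrow> ('r, 'b, 'u) module_scheme \<Rightarrow> bool" where
  "module_isomorphic R M N \<longleftrightarrow>
     (\<exists>f \<in> module_hom R M N. bij_betw f (carrier M) (carrier N))"

lemma mat_image_abelian_subgroup:
  fixes A :: "'a :: field mat"
  shows "abelian_subgroup (mat_image A) (module_vec TYPE('a) (dim_row A))"
proof -
  interpret V: vec_space "TYPE('a)" "dim_row A" .
  have im: "mat_image A \<subseteq> carrier_vec (dim_row A)"
    by (auto simp: mat_image_def intro!: mult_mat_vec_carrier[of A "dim_row A" "dim_col A"])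
  have "subgroup (mat_image A) (add_monoid (module_vec TYPE('a) (dim_row A)))"
  proof (rule group.subgroupI[OF abelian_group.a_group[OF V.M.abelian_group_axioms]])
    show "mat_image A \<subseteq> carrier (add_monoid V.V)" using im by (simp add: module_vec_simps)
    show "mat_image A \<noteq> {}" unfolding mat_image_def using zero_carrier_vec by blast
  next
    fix a assume "a \<in> mat_image A"
    then obtain x where x: "x \<in> carrier_vec (dim_col A)" "a = A *\<^sub>v x"
      by (auto simp: mat_image_def)
    then have a: "a \<in> carrier_vec (dim_row A)" using im \<open>a \<in> mat_image A\<close> by auto
    have "(-1) \<cdot>\<^sub>v a = A *\<^sub>v ((-1) \<cdot>\<^sub>v x)"
      using x by (simp add: mult_mat_vec[of A "dim_row A" "dim_col A"])
    moreover have "\<ominus>\<^bsub>V.V\<^esub> a = (-1) \<cdot>\<^sub>v a"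
      by (rule V.M.minus_equality) (use a in \<open>auto simp: module_vec_simps\<close>)
    ultimately show "inv\<^bsub>add_monoid V.V\<^esub> a \<in> mat_image A"
      using x by (auto simp: mat_image_def a_inv_def)
  next
    fix a b assume "a \<in> mat_image A" "b \<in> mat_image A"
    then obtain x y where *: "x \<in> carrier_vec (dim_col A)" "a = A *\<^sub>v x"
        "y \<in> carrier_vec (dim_col A)" "b = A *\<^sub>v y"
      by (auto simp: mat_image_def)
    then have "a + b = A *\<^sub>v (x + y)"
      by (simp add: mult_add_distrib_mat_vec[of A "dim_row A" "dim_col A"])
    with * show "a \<otimes>\<^bsub>add_monoid V.V\<^esub> b \<in> mat_image A"
      by (auto simp: mat_image_def module_vec_simps)
  qed
  then show ?thesis
    by (intro abelian_subgroupI3 additive_subgroupI) (auto intro: V.M.abelian_group_axioms)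
qed

lemma cokernel_smult:
  fixes A :: "'a :: field mat"
  assumes v: "v \<in> carrier_vec (dim_row A)"
  defines "V \<equiv> module_vec TYPE('a) (dim_row A)"
  shows "r \<odot>\<^bsub>cokernel A\<^esub> (a_r_coset V (mat_image A) v) = a_r_coset V (mat_image A) (r \<cdot>\<^sub>v v)"
proof -
  interpret V: vec_space "TYPE('a)" "dim_row A" .
  interpret S: abelian_subgroup "mat_image A" V
    unfolding V_def by (rule mat_image_abelian_subgroup)
  have [simp]: "carrier V = carrier_vec (dim_row A)" "add V = (+)" "smult V = (\<cdot>\<^sub>v)"
    by (auto simp: V_def module_vec_simps)
  have "a_r_coset V (mat_image A) (r \<cdot>\<^sub>v x) = a_r_coset V (mat_image A) (r \<cdot>\<^sub>v v)"
    if x: "x \<in> a_r_coset V (mat_image A) v" for x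
  proof -
    obtain w where w: "w \<in> mat_image A" "x = w + v"
      using x unfolding a_r_coset_def' by auto
    then obtain y where y: "y \<in> carrier_vec (dim_col A)" "w = A *\<^sub>v y"
      by (auto simp: mat_image_def)
    have wc: "w \<in> carrier_vec (dim_row A)"
      using y by (auto intro!: mult_mat_vec_carrier[of A "dim_row A" "dim_col A"])
    have "r \<cdot>\<^sub>v w = A *\<^sub>v (r \<cdot>\<^sub>v y)"
      using y by (simp add: mult_mat_vec[of A "dim_row A" "dim_col A"])
    then have "r \<cdot>\<^sub>v w \<in> mat_image A" using y by (auto simp: mat_image_def)
    moreover have "r \<cdot>\<^sub>v x = r \<cdot>\<^sub>v w + r \<cdot>\<^sub>v v"
      using w wc v by (simp add: smult_add_distrib_vec[of _ "dim_row A"])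
    ultimately have "r \<cdot>\<^sub>v x \<in> a_r_coset V (mat_image A) (r \<cdot>\<^sub>v v)"
      by (auto simp: a_r_coset_def')
    then show ?thesis using S.a_repr_independence' v by simp
  qed
  moreover have "v \<in> a_r_coset V (mat_image A) v"
    using v S.a_rcos_self by simp
  ultimately have "(\<Union>x\<in>a_r_coset V (mat_image A) v. a_r_coset V (mat_image A) (r \<cdot>\<^sub>v x)) = a_r_coset V (mat_image A) (r \<cdot>\<^sub>v v)"
    by blast
  then show ?thesis by (simp add: cokernel_def Let_def module_vec_simps flip: V_def)
qed

lemma cokernel_module:
  fixes A :: "'a :: field mat"
  shows "module (class_ring :: 'a ring) (cokernel A)"
proof -
  define V where "V = module_vec TYPE('a) (dim_row A)"
  interpret V: vec_space "TYPE('a)" "dim_row A" .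
  interpret S: abelian_subgroup "mat_image A" V
    unfolding V_def by (rule mat_image_abelian_subgroup)
  have [simp]: "carrier V = carrier_vec (dim_row A)" "add V = (+)" "smult V = (\<cdot>\<^sub>v)"
    by (auto simp: V_def module_vec_simps)
  have carr: "carrier (cokernel A) = (\<lambda>v. a_r_coset V (mat_image A) v) ` carrier_vec (dim_row A)"
    by (auto simp: cokernel_def Let_def A_RCOSETS_def' simp flip: V_def)
  have add: "(a_r_coset V (mat_image A) v) \<oplus>\<^bsub>cokernel A\<^esub> (a_r_coset V (mat_image A) w) = a_r_coset V (mat_image A) (v + w)"
    if "v \<in> carrier_vec (dim_row A)" "w \<in> carrier_vec (dim_row A)" for v w
    using S.a_rcos_sum[of v w] that by (simp add: cokernel_def Let_def flip: V_def)
  have sm: "r \<odot>\<^bsub>cokernel A\<^esub> (a_r_coset V (mat_image A) v) = a_r_coset V (mat_image A) (r \<cdot>\<^sub>v v)"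
    if "v \<in> carrier_vec (dim_row A)" for r v
    unfolding V_def by (rule cokernel_smult[OF that])
  have zero: "\<zero>\<^bsub>cokernel A\<^esub> = a_r_coset V (mat_image A) (0\<^sub>v (dim_row A))"
  proof -
    have "mat_image A \<subseteq> carrier_vec (dim_row A)" using S.a_subset by simp
    then show ?thesis
      by (force simp: cokernel_def Let_def a_r_coset_def' simp flip: V_def)
  qed
  have "abelian_group (cokernel A)"
  proof (rule abelian_groupI)
    fix X assume "X \<in> carrier (cokernel A)"
    then obtain v where v: "v \<in> carrier_vec (dim_row A)" "X = a_r_coset V (mat_image A) v"
      by (auto simp: carr)
    then show "\<exists>Y\<in>carrier (cokernel A). Y \<oplus>\<^bsub>cokernel A\<^esub> X = \<zero>\<^bsub>cokernel A\<^esub>"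
      by (auto simp: carr add zero intro!: bexI[of _ "- v"])
  qed (auto simp: carr add zero ac_simps)
  moreover have "cring (class_ring :: 'a ring)"
    by (rule class_cring.cring_axioms)
  ultimately show ?thesis
    by (intro module.intro module_axioms.intro)
       (auto simp: carr add sm class_ring_simps smult_add_distrib_vec[of _ "dim_row A"]
         add_smult_distrib_vec smult_smult_assoc)
qed

end

theory Submission
  imports Defs "HOL-Number_Theory.Cong" "HOL-Real_Asymp.Real_Asymp"
begin

text \<open>
Write \<open>\<alpha> = c ln n / n\<close>, and let the columns of the matrix be exposed one at a time.  The rank
is governed by the left kernel, the space of the \<open>v\<close> orthogonal to every exposed column.  A new
column either contains this space in its orthogonal complement, and then the space stays, or it
cuts the dimension down by exactly one.  A uniformly distributed column leaves a space of
dimension \<open>d\<close> alone with probability \<open>p\<^sup>-\<^sup>d\<close>.  The proof shows that the last \<open>s\<close> columns act on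
the left kernel almost as uniform columns do, and that just before them the left kernel
has dimension \<open>s\<close>, except with probability about \<open>p\<^sup>-\<^sup>s\<close>.  Letting first \<open>n\<close> and then \<open>s\<close> go
to infinity gives the law of the corank of a large uniform square matrix, which is the claimed
limit.

The comparison with uniform columns is Fourier analysis on \<open>F\<^sub>p\<^sup>n\<close>.  The probability that a column
\<open>x\<close> is orthogonal to a subspace \<open>K\<close> is the average over \<open>v \<in> K\<close> of the Fourier coefficient
\<open>E e(v \<bullet> x)\<close>, so it is close to \<open>1 / |K|\<close> once the coefficients at all nonzero \<open>v \<in> K\<close> are small
(\<open>stay_probability_near_uniform\<close>).  Independence of the entries factorises the coefficient, and a
balanced entry contributes a factor at most \<open>exp (- Y / 2)\<close>, where \<open>Y\<close> has mean
\<open>\<tau> = 2 \<alpha> (1 - \<alpha>)\<close> over the multiples of a nonzero frequency (\<open>decay_profile_exists\<close>).  Call \<open>v\<close>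
typical if the exponents of all nonzero multiples of \<open>v\<close> are almost as large as the mean
\<open>n \<tau> / 2\<close>, which is about \<open>c ln n\<close>.  A typical \<open>v\<close> has coefficients at most \<open>n\<^sup>-\<^sup>b\<close> with some
\<open>b > 1\<close>.

Both facts about the left kernel after \<open>n - s\<close> columns are first moment computations.
The expected number of nonzero atypical vectors in it tends to zero: a vector of small weight \<open>w\<close>
is orthogonal to all exposed columns with probability at most about \<open>n\<^sup>-\<^sup>c\<^sup>w\<close>, so here \<open>c > 1\<close> beats
the number of such vectors; vectors of weight below a small multiple of \<open>n\<close> lose to an
exponential factor; and the remaining atypical vectors form an exponentially small fraction of the
space.  The expected number of typical vectors is at most \<open>p\<^sup>s (1 + o(1))\<close>, because
\<open>(1 + p n\<^sup>-\<^sup>b)\<^sup>n \<rightarrow> 1\<close>.  The left kernel always has at least \<open>p\<^sup>s\<close> elements, so this upper bound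
leaves a probability of only \<open>O(p\<^sup>-\<^sup>s)\<close> for its having \<open>p\<^sup>s\<^sup>+\<^sup>1\<close> or more.  The lemmas
\<open>corank_near_chain\<close> and \<open>error_terms_vanish\<close> carry this out.

Finally, the corank of a square matrix is the dimension of its left kernel, and the
cokernel is a vector space of that dimension.
\<close>

unbundle no inner_syntax and no vec_syntax

section \<open>Additive characters\<close>

text \<open>
Faithfulness is what bounds the Fourier decay of an entry from below at every nonzero frequency
(\<open>char_gap\<close> below); it restricts these characters to prime fields.
\<close>

locale additive_character =
  fixes e :: "'a :: {field, finite} \<Rightarrow> complex"
  assumes char_add: "e (x + y) = e x * e y"
    and norm_char [simp]: "norm (e x) = 1"
    and char_faithful: "x \<noteq> 0 \<Longrightarrow> e x \<noteq> 1"
begin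

lemma char_0 [simp]: "e 0 = 1"
proof -
  have "e 0 * e 0 = e 0" using char_add[of 0 0] by simp
  moreover have "e 0 \<noteq> 0" using norm_char[of 0] by (metis norm_zero zero_neq_one)
  ultimately show ?thesis by simp
qed

lemma char_minus: "e (- x) = cnj (e x)"
proof -
  have "e x * e (- x) = 1" using char_add[of x "- x"] by simp
  moreover have "e x * cnj (e x) = 1" by (metis complex_norm_square norm_char of_real_1 power_one)
  moreover have "e x \<noteq> 0" using norm_char[of x] by (metis norm_zero zero_neq_one)
  ultimately show ?thesis by (metis mult_left_cancel)
qed

lemma char_sum: "finite I \<Longrightarrow> e (\<Sum>i\<in>I. f i) = (\<Prod>i\<in>I. e (f i))"
  by (induction I rule: finite_induct) (auto simp: char_add)

lemma Re_char_le: "Re (e x) \<le> 1"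
  using complex_Re_le_cmod[of "e x"] by simp

lemma Re_char_ge: "- 1 \<le> Re (e x)"
  using abs_Re_le_cmod[of "e x"] by (simp add: abs_le_iff)

lemma Re_char_less: "x \<noteq> 0 \<Longrightarrow> Re (e x) < 1"
proof (rule ccontr)
  assume "x \<noteq> 0" and "\<not> Re (e x) < 1"
  then have "Re (e x) = 1" using Re_char_le[of x] by simp
  moreover from this have "Im (e x) = 0"
    using norm_char[of x] by (simp add: cmod_def)
  ultimately have "e x = 1" by (simp add: complex_eq_iff)
  with char_faithful[OF \<open>x \<noteq> 0\<close>] show False by simp
qed

text \<open>
Translation by 1 multiplies the sum by \<open>e 1 \<noteq> 1\<close>.
\<close>

lemma sum_char_eq_0: "(\<Sum>u\<in>UNIV. e u) = 0"
proof -
  have "(\<Sum>u\<in>UNIV. e u) = (\<Sum>u\<in>UNIV. e (1 + u))"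
    by (rule sum.reindex_bij_witness[of _ "\<lambda>u. 1 + u" "\<lambda>u. u - 1"]) auto
  also have "\<dots> = e 1 * (\<Sum>u\<in>UNIV. e u)" by (simp add: char_add sum_distrib_left)
  finally show ?thesis using char_faithful[of 1] by simp
qed

lemma sum_char_mult: "(\<Sum>u\<in>UNIV. e (u * d)) = (if d = 0 then of_nat CARD('a) else 0)"
proof (cases "d = 0")
  case False
  have "(\<Sum>u\<in>UNIV. e (u * d)) = (\<Sum>u\<in>UNIV. e u)"
    by (rule sum.reindex_bij_witness[of _ "\<lambda>u. u / d" "\<lambda>u. u * d"]) (use False in auto)
  with False show ?thesis by (simp add: sum_char_eq_0)
qed simp

end

text \<open>
A field with \<open>p\<close> elements consists of the images of \<open>0, \<dots>, p - 1\<close>, and the residue \<open>m\<close> is sent to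
the \<open>p\<close>-th root of unity with angle \<open>2\<pi>m/p\<close>.
\<close>

lemma additive_character_exists:
  assumes "prime CARD('a :: {field, finite})"
  shows "\<exists>e :: 'a \<Rightarrow> complex. additive_character e"
proof -
  define p where "p = CARD('a)"
  have p: "prime p" using assms by (simp add: p_def)
  have "(\<Sum>x\<in>UNIV. x :: 'a) = (\<Sum>x\<in>UNIV. 1 + x)"
    by (rule sum.reindex_bij_witness[of _ "\<lambda>x. 1 + x" "\<lambda>x. x - 1"]) auto
  then have "of_nat p = (0 :: 'a)" by (simp add: sum.distrib p_def)
  then have "CHAR('a) dvd p" by (simp add: of_nat_eq_0_iff_char_dvd)
  moreover have "CHAR('a) \<noteq> 1" by simp
  ultimately have char: "CHAR('a) = p" using p by (metis prime_nat_iff)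
  have eq: "(of_nat a = (of_nat b :: 'a)) \<longleftrightarrow> [a = b] (mod p)" for a b
    using of_nat_eq_iff_cong_CHAR[of a b, where 'a='a] by (simp add: char)
  have "inj_on (of_nat :: nat \<Rightarrow> 'a) {..<p}"
    by (auto simp: inj_on_def eq cong_def)
  then have "card ((of_nat :: nat \<Rightarrow> 'a) ` {..<p}) = CARD('a)"
    by (simp add: card_image p_def)
  then have surj: "(of_nat :: nat \<Rightarrow> 'a) ` {..<p} = UNIV"
    by (intro card_subset_eq) auto
  then have "\<forall>x :: 'a. \<exists>m. of_nat m = x" by (metis UNIV_I image_iff)
  then obtain idx :: "'a \<Rightarrow> nat" where idx: "of_nat (idx x) = x" for x by metis
  define z where "z m = cis (2 * pi * real m / real p)" for m
  have p0: "p > 0" using p by (simp add: prime_gt_0_nat)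
  have z_eq_1: "z m = 1 \<longleftrightarrow> p dvd m" for m
  proof -
    have "z m = 1 \<longleftrightarrow> (\<exists>x::int. 2 * pi * real m / real p = of_int (2 * x) * pi)"
      unfolding z_def by (simp add: cis_conv_exp exp_eq_1)
    also have "\<dots> \<longleftrightarrow> (\<exists>x::int. real m = of_int x * real p)"
      using p0 by (simp add: field_simps)
    also have "\<dots> \<longleftrightarrow> (\<exists>x::int. int m = x * int p)"
      by (metis of_int_eq_iff of_int_mult of_int_of_nat_eq)
    also have "\<dots> \<longleftrightarrow> p dvd m"
      by (metis dvd_def int_dvd_int_iff mult.commute)
    finally show ?thesis .
  qed
  have z_add: "z (m + m') = z m * z m'" for m m'
    by (simp add: z_def cis_mult add_divide_distrib ring_distribs)
  have zp: "z (p * m) = 1" for m by (simp add: z_eq_1)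
  have z_mod: "z m = z (m mod p)" for m
    using z_add[of "p * (m div p)" "m mod p"] zp[of "m div p"] by simp
  show ?thesis
  proof (rule exI, unfold_locales)
    fix x y :: 'a
    have "of_nat (idx (x + y)) = (of_nat (idx x + idx y) :: 'a)" by (simp add: idx)
    then have "idx (x + y) mod p = (idx x + idx y) mod p" unfolding eq cong_def .
    then show "z (idx (x + y)) = z (idx x) * z (idx y)"
      by (metis z_add z_mod)
  next
    show "norm (z (idx x)) = 1" for x by (simp add: z_def)
  next
    fix x :: 'a assume "x \<noteq> 0"
    then have "\<not> [idx x = 0] (mod p)" using eq[of "idx x" 0] by (simp add: idx)
    then show "z (idx x) \<noteq> 1" by (simp add: z_eq_1 cong_0_iff)
  qed
qed

section \<open>Sums over coordinate vectors\<close>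

lemma one_less_card_field: "1 < CARD('a :: {field, finite})"
proof -
  have "card {0, 1 :: 'a} \<le> CARD('a)" by (rule card_mono) auto
  then show ?thesis by simp
qed

lemma carrier_vec_bij_PiE: "bij_betw (\<lambda>f. Matrix.vec n f) (PiE {..<n} (\<lambda>_. UNIV)) (carrier_vec n)"
  by (rule bij_betw_byWitness[where f' = "\<lambda>v. restrict (vec_index v) {..<n}"])
     (auto simp: PiE_def extensional_def fun_eq_iff)

lemma finite_carrier_vec [simp]: "finite (carrier_vec n :: 'a :: finite vec set)"
  using bij_betw_finite[OF carrier_vec_bij_PiE[of n, where 'a = 'a]] by (simp add: finite_PiE)

text \<open>
Fourier coefficients, the weight enumerator and exponential moments factorise over the coordinates
by this interchange.
\<close>

lemma sum_carrier_vec_prod: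
  fixes f :: "nat \<Rightarrow> 'a :: finite \<Rightarrow> 'c :: comm_semiring_1"
  shows "(\<Sum>v\<in>carrier_vec n. \<Prod>i<n. f i (vec_index v i)) = (\<Prod>i<n. \<Sum>u\<in>UNIV. f i u)"
proof -
  have "(\<Sum>v\<in>carrier_vec n. \<Prod>i<n. f i (vec_index v i)) =
        (\<Sum>g\<in>PiE {..<n} (\<lambda>_. UNIV). \<Prod>i<n. f i (g i))"
    by (subst sum.reindex_bij_betw[OF carrier_vec_bij_PiE, symmetric]) simp
  also have "\<dots> = (\<Prod>i<n. \<Sum>u\<in>UNIV. f i u)" by (subst prod_sum_PiE) auto
  finally show ?thesis by simp
qed

lemma card_carrier_vec: "card (carrier_vec n :: 'a :: finite vec set) = CARD('a) ^ n"
  using sum_carrier_vec_prod[where n = n and f = "\<lambda>_ (_::'a). 1::nat"] by simp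

section \<open>Subspaces cut down by random vectors\<close>

definition linear_set :: "nat \<Rightarrow> 'a :: field vec set \<Rightarrow> bool" where
  "linear_set n K \<longleftrightarrow> K \<subseteq> carrier_vec n \<and> 0\<^sub>v n \<in> K \<and>
     (\<forall>v\<in>K. \<forall>w\<in>K. v + w \<in> K) \<and> (\<forall>a. \<forall>v\<in>K. a \<cdot>\<^sub>v v \<in> K)"

definition perp :: "'a :: field vec set \<Rightarrow> 'a vec \<Rightarrow> 'a vec set" where
  "perp K x = {v \<in> K. scalar_prod v x = 0}"

lemma perp_subset: "perp K x \<subseteq> K" by (auto simp: perp_def)

lemma linear_set_carrier: "linear_set n (carrier_vec n)"
  by (auto simp: linear_set_def)

lemma linear_set_finite: "linear_set n (K :: 'a :: {field, finite} vec set) \<Longrightarrow> finite K"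
  unfolding linear_set_def by (meson finite_carrier_vec finite_subset)

lemma linear_set_perp:
  assumes "linear_set n K" "x \<in> carrier_vec n"
  shows "linear_set n (perp K x)"
proof -
  from assms have sub: "K \<subseteq> carrier_vec n" by (simp add: linear_set_def)
  show ?thesis unfolding linear_set_def perp_def
  proof (intro conjI ballI allI; (elim CollectE conjE)?)
    show "{v \<in> K. scalar_prod v x = 0} \<subseteq> carrier_vec n" using sub by auto
    show "0\<^sub>v n \<in> {v \<in> K. scalar_prod v x = 0}" using assms by (simp add: linear_set_def)
    show "v + w \<in> {v \<in> K. scalar_prod v x = 0}"
      if "v \<in> K" "scalar_prod v x = 0" "w \<in> K" "scalar_prod w x = 0" for v w
    proof -
      have "scalar_prod (v + w) x = 0"
        using that sub assms(2) by (subst add_scalar_prod_distrib[of _ n]) auto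
      then show ?thesis using that assms(1) by (simp add: linear_set_def)
    qed
    show "a \<cdot>\<^sub>v v \<in> {v \<in> K. scalar_prod v x = 0}"
      if "v \<in> K" "scalar_prod v x = 0" for v a
    proof -
      have "scalar_prod (a \<cdot>\<^sub>v v) x = a * scalar_prod v x"
        using that sub assms(2) by (subst scalar_prod_smult_left) auto
      then show ?thesis using that assms(1) by (simp add: linear_set_def)
    qed
  qed
qed

text \<open>
Scaling \<open>v0\<close> gives a vector on which the functional \<open>v \<mapsto> v \<bullet> x\<close> takes the value \<open>u\<close>, and
translation by it maps the kernel onto the fibre over \<open>u\<close>.
\<close>

lemma card_scalar_prod_fibre:
  fixes K :: "'a :: {field, finite} vec set"
  assumes K: "linear_set n K" and x: "x \<in> carrier_vec n" and v0: "v0 \<in> K" "scalar_prod v0 x \<noteq> 0"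
  shows "card {v \<in> K. scalar_prod v x = u} = card (perp K x)"
proof -
  \<comment> \<open>A vector of \<open>K\<close> with \<open>w \<bullet> x = u\<close>.\<close>
  define w where "w = (u / scalar_prod v0 x) \<cdot>\<^sub>v v0"
  have sub: "K \<subseteq> carrier_vec n" using K by (simp add: linear_set_def)
  have w: "w \<in> K" "w \<in> carrier_vec n" using K v0 sub by (auto simp: w_def linear_set_def)
  have wx: "scalar_prod w x = u"
    unfolding w_def using v0 x sub by (subst scalar_prod_smult_left) auto
  have mw: "- w \<in> K"
  proof -
    have "- w = (-1) \<cdot>\<^sub>v w" by auto
    then show ?thesis using K w(1) by (simp add: linear_set_def)
  qed
  have "bij_betw (\<lambda>v. v + w) (perp K x) {v \<in> K. scalar_prod v x = u}"
  proof (rule bij_betw_byWitness[where f' = "\<lambda>v. v + (- w)"])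
    show "\<forall>v\<in>perp K x. v + w + (- w) = v"
      using sub w by (auto simp: perp_def)
    show "\<forall>v\<in>{v \<in> K. scalar_prod v x = u}. v + (- w) + w = v"
      using sub w by auto
    show "(\<lambda>v. v + w) ` perp K x \<subseteq> {v \<in> K. scalar_prod v x = u}"
    proof (safe)
      fix v assume v: "v \<in> perp K x"
      show "v + w \<in> K" using v w K by (auto simp: perp_def linear_set_def)
      show "scalar_prod (v + w) x = u"
        using v w x sub wx by (subst add_scalar_prod_distrib[of _ n]) (auto simp: perp_def)
    qed
    show "(\<lambda>v. v + (- w)) ` {v \<in> K. scalar_prod v x = u} \<subseteq> perp K x"
    proof (safe)
      fix v assume v: "v \<in> K" "u = scalar_prod v x"
      have "v + - w \<in> K" using v mw K by (auto simp: linear_set_def)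
      moreover have "scalar_prod (v + - w) x = 0"
        using v w x sub wx by (subst add_scalar_prod_distrib[of _ n]) auto
      ultimately show "v + - w \<in> perp K x" by (simp add: perp_def)
    qed
  qed
  then show ?thesis by (simp add: bij_betw_same_card)
qed

lemma card_perp:
  fixes K :: "'a :: {field, finite} vec set"
  assumes K: "linear_set n K" and x: "x \<in> carrier_vec n" and ne: "perp K x \<noteq> K"
  shows "card K = CARD('a) * card (perp K x)"
proof -
  obtain v0 where v0: "v0 \<in> K" "scalar_prod v0 x \<noteq> 0" using ne by (auto simp: perp_def)
  have "card K = (\<Sum>v\<in>K. \<Sum>u\<in>UNIV. if scalar_prod v x = u then 1 else 0)" by simp
  also have "\<dots> = (\<Sum>u\<in>UNIV. card {v \<in> K. scalar_prod v x = u})"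
    by (subst sum.swap) (simp add: sum.If_cases linear_set_finite[OF K] Int_def)
  also have "\<dots> = CARD('a) * card (perp K x)"
    by (simp add: card_scalar_prod_fibre[OF K x v0])
  finally show ?thesis .
qed

lemma (in additive_character) sum_char_linear_set:
  assumes K: "linear_set n K" and x: "x \<in> carrier_vec n"
  shows "(\<Sum>v\<in>K. e (scalar_prod v x)) = (if perp K x = K then of_nat (card K) else 0)"
proof (cases "perp K x = K")
  case True
  then have "\<forall>v\<in>K. scalar_prod v x = 0" by (auto simp: perp_def)
  with True show ?thesis by simp
next
  case False
  obtain v0 where v0: "v0 \<in> K" "scalar_prod v0 x \<noteq> 0" using False by (auto simp: perp_def)
  have "(\<Sum>v\<in>K. e (scalar_prod v x)) = (\<Sum>v\<in>K. \<Sum>u\<in>UNIV. if scalar_prod v x = u then e u else 0)"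
    by simp
  also have "\<dots> = (\<Sum>u\<in>UNIV. of_nat (card {v \<in> K. scalar_prod v x = u}) * e u)"
    by (subst sum.swap) (simp add: sum.If_cases linear_set_finite[OF K] Int_def)
  also have "\<dots> = of_nat (card (perp K x)) * (\<Sum>u\<in>UNIV. e u)"
    by (simp add: card_scalar_prod_fibre[OF K x v0] sum_distrib_left)
  finally show ?thesis using False by (simp add: sum_char_eq_0)
qed

text \<open>
The expectation of \<open>g\<close> at the subspace that is left of \<open>K\<close> after cutting it with independent random
vectors of weights \<open>W (m - 1), \<dots>, W 0\<close>, in this order.  The recursion is a one-step conditioning,
so no joint probability space is needed for the analysis of the left kernel.
\<close>

primrec expose ::
  "nat \<Rightarrow> (nat \<Rightarrow> 'a :: {field, finite} vec \<Rightarrow> real) \<Rightarrow> nat \<Rightarrow> ('a vec set \<Rightarrow> real) \<Rightarrow> 'a vec set \<Rightarrow> real"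
where
  "expose n W 0 g K = g K"
| "expose n W (Suc m) g K = (\<Sum>x\<in>carrier_vec n. W m x * expose n W m g (perp K x))"

text \<open>
The probability that \<open>v\<close> is orthogonal to a random vector with weights \<open>w\<close>.
\<close>

definition annihilation :: "nat \<Rightarrow> ('a :: {field, finite} vec \<Rightarrow> real) \<Rightarrow> 'a vec \<Rightarrow> real" where
  "annihilation n w v = (\<Sum>x\<in>carrier_vec n. if scalar_prod v x = 0 then w x else 0)"

definition prob_weight :: "nat \<Rightarrow> ('a :: {field, finite} vec \<Rightarrow> real) \<Rightarrow> bool" where
  "prob_weight n w \<longleftrightarrow> (\<forall>x\<in>carrier_vec n. 0 \<le> w x) \<and> (\<Sum>x\<in>carrier_vec n. w x) = 1"

lemma annihilation_nonneg: "prob_weight n w \<Longrightarrow> 0 \<le> annihilation n w v"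
  unfolding annihilation_def prob_weight_def by (intro sum_nonneg) auto

lemma annihilation_le_1: "prob_weight n w \<Longrightarrow> annihilation n w v \<le> 1"
proof -
  assume w: "prob_weight n w"
  then have "annihilation n w v \<le> (\<Sum>x\<in>carrier_vec n. w x)"
    unfolding annihilation_def prob_weight_def by (intro sum_mono) auto
  with w show ?thesis by (simp add: prob_weight_def)
qed

lemma expose_add: "expose n W (s + m) g K = expose n (\<lambda>j. W (s + j)) m (expose n W s g) K"
  by (induction m arbitrary: K) simp_all

text \<open>
First moments: a vector survives all cuts with the product of the individual probabilities.
\<close>

lemma expose_sum:
  fixes K :: "'a :: {field, finite} vec set"
  assumes "finite K"
  shows "expose n W m (\<lambda>L. \<Sum>v\<in>L. f v) K = (\<Sum>v\<in>K. f v * (\<Prod>j<m. annihilation n (W j) v))"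
  using assms
proof (induction m arbitrary: K)
  case 0
  then show ?case by simp
next
  case (Suc m)
  have fin: "finite (perp K x)" for x using Suc.prems by (rule finite_subset[OF perp_subset])
  have "expose n W (Suc m) (\<lambda>L. \<Sum>v\<in>L. f v) K =
        (\<Sum>x\<in>carrier_vec n. W m x * (\<Sum>v\<in>perp K x. f v * (\<Prod>j<m. annihilation n (W j) v)))"
    using Suc.IH[OF fin] by simp
  also have "\<dots> = (\<Sum>x\<in>carrier_vec n. \<Sum>v\<in>K.
      (if scalar_prod v x = 0 then W m x else 0) * (f v * (\<Prod>j<m. annihilation n (W j) v)))"
    unfolding perp_def sum_distrib_left sum.inter_filter[OF Suc.prems]
    by (intro sum.cong refl) auto
  also have "\<dots> = (\<Sum>v\<in>K. annihilation n (W m) v * (f v * (\<Prod>j<m. annihilation n (W j) v)))"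
    unfolding annihilation_def by (subst sum.swap) (simp only: sum_distrib_right)
  finally show ?case by (simp add: mult_ac)
qed

lemma expose_abs_diff:
  assumes "\<And>j. j < m \<Longrightarrow> prob_weight n (W j)"
  shows "\<bar>expose n W m g K - c\<bar> \<le> expose n W m (\<lambda>L. \<bar>g L - c\<bar>) K"
  using assms
proof (induction m arbitrary: K)
  case (Suc m)
  have w: "prob_weight n (W m)" using Suc.prems by simp
  have "expose n W (Suc m) g K - c =
        (\<Sum>x\<in>carrier_vec n. W m x * (expose n W m g (perp K x) - c))"
    using w by (simp add: prob_weight_def right_diff_distrib sum_subtractf flip: sum_distrib_right)
  also have "\<bar>\<dots>\<bar> \<le> (\<Sum>x\<in>carrier_vec n. \<bar>W m x * (expose n W m g (perp K x) - c)\<bar>)"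
    by (rule sum_abs)
  also have "\<dots> \<le> (\<Sum>x\<in>carrier_vec n. W m x * expose n W m (\<lambda>L. \<bar>g L - c\<bar>) (perp K x))"
    using w Suc.IH Suc.prems
    by (intro sum_mono) (auto simp: abs_mult prob_weight_def intro!: mult_left_mono)
  finally show ?case by simp
qed simp

text \<open>
The dimension drops by at most one per exposed vector.
\<close>

lemma card_perp_cases:
  fixes K :: "'a :: {field, finite} vec set"
  assumes "linear_set n K" "x \<in> carrier_vec n" "card K = CARD('a) ^ d"
  shows "perp K x = K \<or> (d > 0 \<and> card (perp K x) = CARD('a) ^ (d - 1))"
proof (cases "perp K x = K")
  case False
  have *: "CARD('a) * card (perp K x) = CARD('a) ^ d"
    using card_perp[OF assms(1,2) False] assms(3) by simp
  then have "d > 0" using one_less_card_field[where 'a = 'a] by (cases d) auto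
  with * show ?thesis by (cases d) auto
qed simp

text \<open>
Since each cut lowers the dimension by at most one, the functions have to be compared only on
subspaces of dimension at least \<open>s\<close>.  This a priori lower bound is what turns an upper bound for
the expected size of the left kernel into information about its distribution.
\<close>

lemma expose_mono:
  fixes K :: "'a :: {field, finite} vec set"
  assumes "\<And>j. j < m \<Longrightarrow> prob_weight n (W j)"
    and "\<And>L d. linear_set n L \<Longrightarrow> card L = CARD('a) ^ d \<Longrightarrow> s \<le> d \<Longrightarrow> g L \<le> h L"
    and "linear_set n K" "card K = CARD('a) ^ d" "s + m \<le> d"
  shows "expose n W m g K \<le> expose n W m h K"
  using assms(1,3,4,5)
proof (induction m arbitrary: K d)
  case 0
  then show ?case using assms(2) by simp
next
  case (Suc m)
  have "expose n W m g (perp K x) \<le> expose n W m h (perp K x)" if x: "x \<in> carrier_vec n" for x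
  proof -
    have "\<exists>d'. card (perp K x) = CARD('a) ^ d' \<and> s + m \<le> d'"
      using card_perp_cases[OF Suc.prems(2) x Suc.prems(3)] Suc.prems(3,4)
    proof (elim disjE conjE)
      show ?thesis if "perp K x = K" using that Suc.prems(3,4) by (intro exI[of _ d]) simp
      show ?thesis if "card (perp K x) = CARD('a) ^ (d - 1)"
        using that Suc.prems(4) by (intro exI[of _ "d - 1"]) simp
    qed
    then show ?thesis using Suc.IH Suc.prems(1) linear_set_perp[OF Suc.prems(2) x] by auto
  qed
  then show ?case
    using Suc.prems(1)[of m] by (auto intro!: sum_mono mult_left_mono simp: prob_weight_def)
qed

lemma expose_cmult_add:
  "expose n W m (\<lambda>L. a * g L + h L) K = a * expose n W m g K + expose n W m h K"
  by (induction m arbitrary: K) (simp_all add: ring_distribs sum.distrib sum_distrib_left mult_ac)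

lemma expose_const:
  assumes "\<And>j. j < m \<Longrightarrow> prob_weight n (W j)"
  shows "expose n W m (\<lambda>_. c) K = c"
  using assms
  by (induction m arbitrary: K) (auto simp: prob_weight_def simp flip: sum_distrib_right)

text \<open>
The link to the joint law of all the columns.
\<close>

lemma expose_eq_sum_PiE:
  fixes K :: "'a :: {field, finite} vec set"
  shows "expose n W m g K = (\<Sum>f\<in>PiE {..<m} (\<lambda>_. carrier_vec n).
           (\<Prod>j<m. W j (f j)) * g {v \<in> K. \<forall>j<m. scalar_prod v (f j) = 0})"
proof (induction m arbitrary: K)
  case 0
  then show ?case by simp
next
  case (Suc m)
  let ?V = "carrier_vec n :: 'a vec set"
  have "(\<Sum>f\<in>PiE {..<Suc m} (\<lambda>_. ?V).
           (\<Prod>j<Suc m. W j (f j)) * g {v \<in> K. \<forall>j<Suc m. scalar_prod v (f j) = 0})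
      = (\<Sum>(x, f)\<in>?V \<times> PiE {..<m} (\<lambda>_. ?V).
           W m x * ((\<Prod>j<m. W j (f j)) * g {v \<in> perp K x. \<forall>j<m. scalar_prod v (f j) = 0}))"
    (is "?L = ?R")
  proof -
    have inj: "inj_on (\<lambda>(y, g). g(m := y)) (?V \<times> PiE {..<m} (\<lambda>_. ?V))"
      using inj_combinator[of m "{..<m}" "\<lambda>_. ?V"] by simp
    have "?R = (\<Sum>f\<in>(\<lambda>(y, g). g(m := y)) ` (?V \<times> PiE {..<m} (\<lambda>_. ?V)).
           (\<Prod>j<Suc m. W j (f j)) * g {v \<in> K. \<forall>j<Suc m. scalar_prod v (f j) = 0})"
      unfolding sum.reindex[OF inj]
    proof (intro sum.cong refl)
      fix xf assume "xf \<in> ?V \<times> PiE {..<m} (\<lambda>_. ?V)"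
      obtain x f where xf: "xf = (x, f)" by (cases xf)
      have "{v \<in> perp K x. \<forall>j<m. scalar_prod v (f j) = 0} =
            {v \<in> K. \<forall>j<Suc m. scalar_prod v ((f(m := x)) j) = 0}"
        by (auto simp: perp_def less_Suc_eq)
      moreover have "(\<Prod>j<Suc m. W j ((f(m := x)) j)) = W m x * (\<Prod>j<m. W j (f j))"
        by simp
      ultimately show "(case xf of (x, f) \<Rightarrow>
           W m x * ((\<Prod>j<m. W j (f j)) * g {v \<in> perp K x. \<forall>j<m. scalar_prod v (f j) = 0})) =
         ((\<lambda>f. (\<Prod>j<Suc m. W j (f j)) * g {v \<in> K. \<forall>j<Suc m. scalar_prod v (f j) = 0})
            \<circ> (\<lambda>(y, g). g(m := y))) xf"
        by (simp only: xf prod.case o_def mult.assoc)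
    qed
    also have "(\<lambda>(y, g). g(m := y)) ` (?V \<times> PiE {..<m} (\<lambda>_. ?V)) = PiE {..<Suc m} (\<lambda>_. ?V)"
      by (simp add: lessThan_Suc PiE_insert_eq)
    finally show ?thesis by simp
  qed
  then show ?case by (simp add: Suc.IH sum_distrib_left sum.cartesian_product)
qed

section \<open>The corank chain of uniform columns\<close>

text \<open>
With \<open>q = 1/p\<close>: the probability that \<open>m\<close> independent uniform vectors cut a space of dimension \<open>d\<close>
down to dimension \<open>k\<close>.  At \<open>d = 0\<close> the second summand vanishes, so the value of \<open>d - 1\<close> there does
not matter.
\<close>

primrec corank_chain :: "real \<Rightarrow> nat \<Rightarrow> nat \<Rightarrow> nat \<Rightarrow> real" where
  "corank_chain q k 0 d = (if d = k then 1 else 0)"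
| "corank_chain q k (Suc m) d =
     q ^ d * corank_chain q k m d + (1 - q ^ d) * corank_chain q k m (d - 1)"

lemma corank_chain_bounds:
  assumes "0 \<le> q" "q \<le> 1"
  shows "0 \<le> corank_chain q k m d \<and> corank_chain q k m d \<le> 1"
proof (induction m arbitrary: d)
  case (Suc m)
  have q: "0 \<le> q ^ d" "q ^ d \<le> 1" using assms by (auto simp: power_le_one)
  have "q ^ d * corank_chain q k m d + (1 - q ^ d) * corank_chain q k m (d - 1)
        \<le> q ^ d * 1 + (1 - q ^ d) * 1"
    using Suc q by (intro add_mono mult_left_mono) auto
  then show ?case using Suc q by auto
qed simp

text \<open>
The Gaussian binomial coefficients by their Pascal rule, which is the form that matches the
recursion of \<open>corank_chain\<close>.
\<close>

primrec q_binomial :: "real \<Rightarrow> nat \<Rightarrow> nat \<Rightarrow> real" where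
  "q_binomial q 0 r = (if r = 0 then 1 else 0)"
| "q_binomial q (Suc m) r = q ^ r * q_binomial q m r + (if r = 0 then 0 else q_binomial q m (r - 1))"

text \<open>
The \<open>q\<close>-factorial without the usual normalisation by \<open>(1 - q)\<^sup>m\<close>, that is, the \<open>q\<close>-Pochhammer symbol
\<open>(q; q)\<^sub>m\<close>, whose limit is the infinite product of the theorem.
\<close>

definition q_factorial :: "real \<Rightarrow> nat \<Rightarrow> real" where
  "q_factorial q m = (\<Prod>j=1..m. 1 - q ^ j)"

lemma q_factorial_0 [simp]: "q_factorial q 0 = 1"
  by (simp add: q_factorial_def)

lemma q_factorial_Suc: "q_factorial q (Suc m) = q_factorial q m * (1 - q ^ Suc m)"
  by (simp add: q_factorial_def)

lemma q_binomial_eq_0: "m < r \<Longrightarrow> q_binomial q m r = 0"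
  by (induction m arbitrary: r) auto

lemma q_binomial_0 [simp]: "q_binomial q m 0 = 1"
  by (induction m) auto

lemma q_binomial_factorial:
  "r \<le> m \<Longrightarrow> q_binomial q m r * q_factorial q r * q_factorial q (m - r) = q_factorial q m"
proof (induction m arbitrary: r)
  case 0
  then show ?case by (simp add: q_factorial_def)
next
  case (Suc m)
  consider "r = 0" | "r = Suc m" | r' where "r = Suc r'" "Suc r' \<le> m"
    using Suc.prems by (cases r) (auto simp: le_Suc_eq)
  then show ?case
  proof cases
    case 1
    then show ?thesis by simp
  next
    case 2
    have "q_binomial q m m * q_factorial q m = q_factorial q m" using Suc.IH[of m] by simp
    then show ?thesis using 2 by (simp add: q_binomial_eq_0 q_factorial_Suc flip: mult.assoc)
  next
    case 3
    obtain t where t: "m = Suc r' + t" using 3 by (metis le_iff_add)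
    have "q_binomial q m r * q_factorial q r * q_factorial q t = q_factorial q m"
      using Suc.IH[of r] 3 t by simp
    moreover have "q_binomial q m r' * q_factorial q r' * (q_factorial q t * (1 - q ^ Suc t)) = q_factorial q m"
      using Suc.IH[of r'] 3 t by (simp add: Suc_diff_le q_factorial_Suc)
    moreover have "q_binomial q (Suc m) r * q_factorial q r * q_factorial q (Suc m - r) =
       q ^ r * (1 - q ^ Suc t) * (q_binomial q m r * q_factorial q r * q_factorial q t) +
       (1 - q ^ r) * (q_binomial q m r' * q_factorial q r' * (q_factorial q t * (1 - q ^ Suc t)))"
      using 3 t by (simp add: Suc_diff_le q_factorial_Suc algebra_simps)
    ultimately have "q_binomial q (Suc m) r * q_factorial q r * q_factorial q (Suc m - r) =
       q ^ r * (1 - q ^ Suc t) * q_factorial q m + (1 - q ^ r) * q_factorial q m" by simp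
    also have "\<dots> = q_factorial q m * (1 - q ^ (r + Suc t))"
      by (simp add: algebra_simps power_add)
    finally show ?thesis using 3 t by (simp add: q_factorial_Suc)
  qed
qed

text \<open>
The right-hand side is the classical count of \<open>d \<times> m\<close> matrices of rank \<open>d - k\<close>, divided by the
number of all matrices.  After cancelling the common product, the recursion becomes the Pascal
rule.
\<close>

lemma corank_chain_closed_form:
  "corank_chain q k m d = (if d < k then 0 else
     q ^ (k * (m - (d - k))) * q_binomial q m (d - k) * (\<Prod>i<d - k. 1 - q ^ (d - i)))"
proof (induction m arbitrary: d)
  case 0
  then show ?case by auto
next
  case (Suc m)
  consider "d < k" | "d = k" | r where "d = k + Suc r"
    by (metis less_iff_Suc_add linorder_neqE_nat add_Suc_right)
  then show ?case
  proof cases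
    case 1
    then show ?thesis by (simp add: Suc.IH)
  next
    case 2
    then show ?thesis using Suc.IH[of d] Suc.IH[of "d - 1"]
      by (cases "k = 0") (simp_all add: power_add)
  next
    case 3
    have prod: "(\<Prod>i<Suc r. 1 - q ^ (d - i)) = (1 - q ^ d) * (\<Prod>i<r. 1 - q ^ (d - 1 - i))"
      by (subst prod.lessThan_Suc_shift) simp
    have E1: "q ^ d * (q ^ (k * (m - Suc r)) * q_binomial q m (Suc r)) =
          q ^ (k * (Suc m - Suc r)) * (q ^ Suc r * q_binomial q m (Suc r))"
    proof (cases "Suc r \<le> m")
      case True
      then obtain t where "m = Suc r + t" by (metis le_iff_add)
      then show ?thesis using 3 by (simp add: power_add algebra_simps)
    qed (simp add: q_binomial_eq_0)
    have "corank_chain q k (Suc m) d =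
       q ^ d * (q ^ (k * (m - Suc r)) * q_binomial q m (Suc r) * (\<Prod>i<Suc r. 1 - q ^ (d - i))) +
       (1 - q ^ d) * (q ^ (k * (m - r)) * q_binomial q m r * (\<Prod>i<r. 1 - q ^ (d - 1 - i)))"
      using 3 by (simp add: Suc.IH)
    also have "\<dots> = (q ^ d * (q ^ (k * (m - Suc r)) * q_binomial q m (Suc r)) +
        q ^ (k * (m - r)) * q_binomial q m r) * (\<Prod>i<Suc r. 1 - q ^ (d - i))"
      unfolding prod by (simp add: algebra_simps)
    also have "\<dots> = q ^ (k * (Suc m - Suc r)) * q_binomial q (Suc m) (Suc r) * (\<Prod>i<Suc r. 1 - q ^ (d - i))"
      unfolding E1 by (simp add: algebra_simps)
    finally show ?thesis using 3 by simp
  qed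
qed

lemma q_factorial_pos: "0 < q \<Longrightarrow> q < 1 \<Longrightarrow> 0 < q_factorial q m"
  unfolding q_factorial_def by (intro prod_pos) (auto simp: power_less_one_iff)

lemma corank_chain_diagonal:
  assumes q: "0 < q" "q < 1" and k: "k \<le> s"
  shows "corank_chain q k s s =
           q ^ (k ^ 2) * (q_factorial q s ^ 2 / (q_factorial q (s - k) * q_factorial q k ^ 2))"
proof -
  have "(\<Prod>i<s - k. 1 - q ^ (s - i)) * q_factorial q k = q_factorial q s"
    using k
  proof (induction s rule: dec_induct)
    case base
    then show ?case by simp
  next
    case (step s)
    have "(\<Prod>i<Suc s - k. 1 - q ^ (Suc s - i)) = (1 - q ^ Suc s) * (\<Prod>i<s - k. 1 - q ^ (s - i))"
    proof -
      have "Suc s - k = Suc (s - k)" using step.hyps by simp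
      then show ?thesis by (simp only: prod.lessThan_Suc_shift) simp
    qed
    then show ?case using step.IH by (simp add: q_factorial_Suc mult_ac)
  qed
  moreover have "q_binomial q s (s - k) * q_factorial q (s - k) * q_factorial q k = q_factorial q s"
    using q_binomial_factorial[of "s - k" s q] k by simp
  moreover have "q_factorial q m \<noteq> 0" for m using q_factorial_pos[OF q, of m] by simp
  ultimately have "(\<Prod>i<s - k. 1 - q ^ (s - i)) = q_factorial q s / q_factorial q k"
    "q_binomial q s (s - k) = q_factorial q s / (q_factorial q (s - k) * q_factorial q k)"
    by (simp_all add: field_simps)
  then show ?thesis using k by (simp add: corank_chain_closed_form power2_eq_square)
qed

text \<open>
The limit has to be nonzero because the closed form has a \<open>q\<close>-factorial in the denominator.
\<close>

lemma q_factorial_tendsto: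
  assumes q: "0 < q" "q < 1"
  shows "(\<lambda>s. q_factorial q s) \<longlonglongrightarrow> (\<Prod>j. 1 - q ^ (j + 1))" and "(\<Prod>j. 1 - q ^ (j + 1)) \<noteq> 0"
proof -
  have "summable (\<lambda>j. norm ((1 - q ^ (j + 1)) - 1))"
    using q summable_geometric[of q] by (simp add: abs_mult summable_mult power_abs)
  then have "abs_convergent_prod (\<lambda>j. 1 - q ^ (j + 1))"
    by (rule summable_imp_abs_convergent_prod)
  then have conv: "convergent_prod (\<lambda>j. 1 - q ^ (j + 1))"
    by (rule abs_convergent_prod_imp_convergent_prod)
  have nz: "1 - q ^ (j + 1) \<noteq> 0" for j
    using power_less_one_iff[of q "j + 1"] q by simp
  show "(\<Prod>j. 1 - q ^ (j + 1)) \<noteq> 0"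
    using conv nz by (simp add: prodinf_nonzero)
  have "(\<lambda>s. \<Prod>j\<le>s. 1 - q ^ (j + 1)) \<longlonglongrightarrow> (\<Prod>j. 1 - q ^ (j + 1))"
    using conv by (rule convergent_prod_LIMSEQ)
  moreover have "(\<Prod>j\<le>s. 1 - q ^ (j + 1)) = q_factorial q (Suc s)" for s
    unfolding q_factorial_def by (induction s) simp_all
  ultimately have "(\<lambda>s. q_factorial q (Suc s)) \<longlonglongrightarrow> (\<Prod>j. 1 - q ^ (j + 1))" by simp
  then show "(\<lambda>s. q_factorial q s) \<longlonglongrightarrow> (\<Prod>j. 1 - q ^ (j + 1))"
    by (simp add: filterlim_sequentially_Suc)
qed

lemma corank_chain_tendsto:
  assumes q: "0 < q" "q < 1"
  shows "(\<lambda>s. corank_chain q k s s) \<longlonglongrightarrow>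
           q ^ (k ^ 2) * ((\<Prod>j. 1 - q ^ (j + 1)) / q_factorial q k ^ 2)"
proof -
  let ?P = "\<Prod>j. 1 - q ^ (j + 1)"
  note lim = q_factorial_tendsto[OF q]
  have "(\<lambda>s. q_factorial q ((s - k) + k - k)) \<longlonglongrightarrow> ?P"
  proof -
    have "filterlim (\<lambda>s::nat. s - k) at_top sequentially"
      by (rule filterlim_minus_const_nat_at_top)
    from filterlim_compose[OF lim(1) this] show ?thesis by simp
  qed
  then have lim': "(\<lambda>s. q_factorial q (s - k)) \<longlonglongrightarrow> ?P" by simp
  have "(\<lambda>s. q ^ (k ^ 2) * (q_factorial q s ^ 2 / (q_factorial q (s - k) * q_factorial q k ^ 2)))
     \<longlonglongrightarrow> q ^ (k ^ 2) * (?P ^ 2 / (?P * q_factorial q k ^ 2))"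
    using lim(2) q_factorial_pos[OF q, of k] by (intro tendsto_intros lim lim') auto
  also have "?P ^ 2 / (?P * q_factorial q k ^ 2) = ?P / q_factorial q k ^ 2"
    using lim(2) by (simp add: power2_eq_square)
  finally show ?thesis
    by (rule Lim_transform_eventually)
       (use corank_chain_diagonal[OF q] in \<open>auto simp: eventually_sequentially intro!: exI[of _ k]\<close>)
qed

section \<open>Columns with small Fourier coefficients\<close>

context additive_character
begin

text \<open>
The Fourier coefficient at \<open>v\<close> of the distribution with weights \<open>w\<close>.
\<close>

definition char_transform :: "nat \<Rightarrow> ('a vec \<Rightarrow> real) \<Rightarrow> 'a vec \<Rightarrow> complex" where
  "char_transform n w v = (\<Sum>x\<in>carrier_vec n. of_real (w x) * e (scalar_prod v x))"

lemma char_transform_0: "prob_weight n w \<Longrightarrow> char_transform n w (0\<^sub>v n) = 1"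
  unfolding char_transform_def prob_weight_def
  by (simp flip: of_real_sum)

text \<open>
Orthogonality of characters on \<open>K\<close>: the sum of \<open>e (v \<bullet> x)\<close> over \<open>v \<in> K\<close> detects whether \<open>x\<close> is
orthogonal to \<open>K\<close>.
\<close>

lemma stay_probability:
  assumes K: "linear_set n K"
  shows "of_nat (card K) * of_real (\<Sum>x\<in>carrier_vec n. if perp K x = K then w x else 0) =
         (\<Sum>v\<in>K. char_transform n w v)"
proof -
  have "(\<Sum>v\<in>K. char_transform n w v) =
        (\<Sum>x\<in>carrier_vec n. of_real (w x) * (\<Sum>v\<in>K. e (scalar_prod v x)))"
    unfolding char_transform_def by (subst sum.swap) (simp add: sum_distrib_left)
  also have "\<dots> = (\<Sum>x\<in>carrier_vec n. of_nat (card K) * of_real (if perp K x = K then w x else 0))"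
    by (intro sum.cong refl) (simp add: sum_char_linear_set[OF K])
  finally show ?thesis by (simp add: sum_distrib_left)
qed

lemma stay_probability_near_uniform:
  assumes K: "linear_set n K" and w: "prob_weight n w"
    and small: "\<And>v. v \<in> K \<Longrightarrow> v \<noteq> 0\<^sub>v n \<Longrightarrow> norm (char_transform n w v) \<le> \<theta>" and \<theta>: "0 \<le> \<theta>"
  shows "\<bar>(\<Sum>x\<in>carrier_vec n. if perp K x = K then w x else 0) - 1 / card K\<bar> \<le> \<theta>"
proof -
  define S where "S = (\<Sum>x\<in>carrier_vec n. if perp K x = K then w x else 0)"
  have fin: "finite K" by (rule linear_set_finite[OF K])
  have 0: "0\<^sub>v n \<in> K" using K by (simp add: linear_set_def)
  have pos: "card K > 0" using fin 0 by (auto simp: card_gt_0_iff)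
  have "(\<Sum>v\<in>K. char_transform n w v) = 1 + (\<Sum>v\<in>K - {0\<^sub>v n}. char_transform n w v)"
    using sum.remove[OF fin 0, of "char_transform n w"] by (simp only: char_transform_0[OF w])
  then have "(\<Sum>v\<in>K - {0\<^sub>v n}. char_transform n w v) = of_real (card K * S - 1)"
    using stay_probability[OF K, of w, folded S_def] by simp
  then have "\<bar>card K * S - 1\<bar> = norm (\<Sum>v\<in>K - {0\<^sub>v n}. char_transform n w v)"
    by (simp only: norm_of_real)
  also have "\<dots> \<le> (\<Sum>v\<in>K - {0\<^sub>v n}. norm (char_transform n w v))" by (rule norm_sum)
  also have "\<dots> \<le> (\<Sum>v\<in>K - {0\<^sub>v n}. \<theta>)" by (intro sum_mono small) auto
  also have "\<dots> \<le> card K * \<theta>" using \<theta> by (auto intro!: mult_right_mono card_mono fin)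
  finally have "\<bar>card K * S - 1\<bar> \<le> card K * \<theta>" .
  moreover have "card K * S - 1 = card K * (S - 1 / card K)" using pos by (simp add: field_simps)
  ultimately have "card K * \<bar>S - 1 / card K\<bar> \<le> card K * \<theta>" by (simp add: abs_mult)
  then show ?thesis using pos by (simp add: S_def)
qed

text \<open>
The subspaces that arise from \<open>K\<close> lie inside \<open>K\<close>, so the hypothesis on the Fourier coefficients is
inherited, and each of the \<open>m\<close> steps adds an error of at most \<open>\<theta>\<close>.
\<close>

lemma expose_near_corank_chain:
  fixes \<theta> :: real
  assumes W: "\<And>j. j < m \<Longrightarrow> prob_weight n (W j)"
    and K: "linear_set n K" "card K = CARD('a) ^ d"
    and small: "\<And>j v. j < m \<Longrightarrow> v \<in> K \<Longrightarrow> v \<noteq> 0\<^sub>v n \<Longrightarrow> norm (char_transform n (W j) v) \<le> \<theta>"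
    and \<theta>: "0 \<le> \<theta>"
  shows "\<bar>expose n W m (\<lambda>L. if card L = CARD('a) ^ k then 1 else 0) K
           - corank_chain (1 / CARD('a)) k m d\<bar> \<le> m * \<theta>"
  using W K small
proof (induction m arbitrary: K d)
  case 0
  show ?case using 0 one_less_card_field[where 'a = 'a] by simp
next
  case (Suc m)
  let ?q = "1 / real CARD('a)"
  let ?g = "\<lambda>L :: 'a vec set. if card L = CARD('a) ^ k then 1 else (0 :: real)"
  let ?c = "corank_chain ?q k m"
  let ?V = "carrier_vec n :: 'a vec set"
  define S where "S = (\<Sum>x\<in>?V. if perp K x = K then W m x else 0)"
  have w: "prob_weight n (W m)" using Suc.prems(1) by simp
  have S: "\<bar>S - ?q ^ d\<bar> \<le> \<theta>"
    using stay_probability_near_uniform[OF Suc.prems(2) w Suc.prems(4)[of m] \<theta>]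
    by (simp add: S_def Suc.prems(3) power_divide)
  \<comment> \<open>The value of the chain after the first step, along the actual column \<open>x\<close>.\<close>
  define t where "t x = (if perp K x = K then ?c d else ?c (d - 1))" for x
  have IH: "\<bar>expose n W m ?g (perp K x) - t x\<bar> \<le> m * \<theta>" if x: "x \<in> ?V" for x
  proof (cases "perp K x = K")
    case True
    then show ?thesis using Suc.IH[of K d] Suc.prems by (simp add: t_def)
  next
    case False
    then have "card (perp K x) = CARD('a) ^ (d - 1)"
      using card_perp_cases[OF Suc.prems(2) x Suc.prems(3)] by blast
    then have "\<bar>expose n W m ?g (perp K x) - ?c (d - 1)\<bar> \<le> m * \<theta>"
      by (rule Suc.IH[rotated 2])
         (use Suc.prems perp_subset[of K x] linear_set_perp[OF Suc.prems(2) x] in auto)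
    then show ?thesis using False by (simp add: t_def)
  qed
  have c01: "0 \<le> ?c d'" "?c d' \<le> 1" for d'
    using corank_chain_bounds[of ?q k m d'] by (auto simp: divide_le_eq_1 Suc_le_eq)
  have sumt: "(\<Sum>x\<in>?V. W m x * t x) = S * ?c d + (1 - S) * ?c (d - 1)"
  proof -
    have "(\<Sum>x\<in>?V. W m x * t x) = (\<Sum>x\<in>?V. (if perp K x = K then W m x else 0) * (?c d - ?c (d - 1)) + W m x * ?c (d - 1))"
      by (intro sum.cong refl) (simp add: t_def algebra_simps)
    also have "\<dots> = S * (?c d - ?c (d - 1)) + ?c (d - 1)"
      using w by (simp add: sum.distrib S_def prob_weight_def flip: sum_distrib_right)
    finally show ?thesis by (simp add: algebra_simps)
  qed
  have "expose n W (Suc m) ?g K - corank_chain ?q k (Suc m) d =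
     (\<Sum>x\<in>?V. W m x * (expose n W m ?g (perp K x) - t x)) + (S - ?q ^ d) * (?c d - ?c (d - 1))"
    unfolding right_diff_distrib sum_subtractf sumt by (simp add: algebra_simps)
  also have "\<bar>\<dots>\<bar> \<le> \<bar>\<Sum>x\<in>?V. W m x * (expose n W m ?g (perp K x) - t x)\<bar> + \<bar>S - ?q ^ d\<bar> * \<bar>?c d - ?c (d - 1)\<bar>"
    by (rule order.trans[OF abs_triangle_ineq]) (simp only: abs_mult order.refl)
  also have "\<bar>S - ?q ^ d\<bar> * \<bar>?c d - ?c (d - 1)\<bar> \<le> \<theta> * 1"
    using S c01[of d] c01[of "d - 1"] \<theta> by (intro mult_mono) auto
  also have "\<bar>\<Sum>x\<in>?V. W m x * (expose n W m ?g (perp K x) - t x)\<bar> \<le> (\<Sum>x\<in>?V. W m x * (m * \<theta>))"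
    using w IH by (intro order.trans[OF sum_abs] sum_mono)
      (auto simp: abs_mult prob_weight_def intro!: mult_left_mono)
  also have "\<dots> = m * \<theta>" using w by (simp add: prob_weight_def flip: sum_distrib_right)
  finally show ?case by (simp add: algebra_simps)
qed

end

section \<open>Fourier decay of balanced entries\<close>

text \<open>
Convexity: on \<open>[0, 2x]\<close> the exponential lies below its chord.
\<close>

lemma exp_le_chord:
  fixes z x :: real
  assumes "0 \<le> z" "z \<le> 2 * x"
  shows "exp (- z) \<le> 1 - z * ((1 - exp (- (2 * x))) / (2 * x))"
proof (cases "x = 0")
  case False
  then have x: "x > 0" using assms by simp
  define s where "s = z / (2 * x)"
  have s: "0 \<le> s" "s \<le> 1" using assms x by (auto simp: s_def)
  have "exp ((1 - s) * 0 + s * (- (2 * x))) \<le> (1 - s) * exp 0 + s * exp (- (2 * x))"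
    using convex_onD[OF exp_convex, of s 0 "- (2 * x)"] s by simp
  moreover have "(1 - s) * 0 + s * (- (2 * x)) = - z" using x by (simp add: s_def)
  ultimately have "exp (- z) \<le> 1 - s * (1 - exp (- (2 * x)))" by (simp add: algebra_simps)
  then show ?thesis by (simp add: s_def)
qed (use assms in auto)

text \<open>
Among all families with values in \<open>[0, 2x]\<close> and mean \<open>x\<close>, the mean of \<open>exp (- Z)\<close> is largest when \<open>Z\<close>
takes only the two extreme values.
\<close>

lemma sum_exp_le:
  fixes Z :: "'t \<Rightarrow> real" and x :: real
  assumes "finite T" "\<And>t. t \<in> T \<Longrightarrow> 0 \<le> Z t" "\<And>t. t \<in> T \<Longrightarrow> Z t \<le> 2 * x" "(\<Sum>t\<in>T. Z t) = real (card T) * x"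
  shows "(\<Sum>t\<in>T. exp (- Z t)) \<le> real (card T) * ((1 + exp (- (2 * x))) / 2)"
proof -
  have "(\<Sum>t\<in>T. exp (- Z t)) \<le> (\<Sum>t\<in>T. 1 - Z t * ((1 - exp (- (2 * x))) / (2 * x)))"
    using assms by (intro sum_mono exp_le_chord)
  also have "\<dots> = card T - card T * x * ((1 - exp (- (2 * x))) / (2 * x))"
    by (simp add: sum_subtractf assms(4) flip: sum_distrib_right sum_divide_distrib)
  also have "\<dots> \<le> card T * ((1 + exp (- (2 * x))) / 2)"
  proof (cases "x = 0")
    case False
    then have "card T * x * ((1 - exp (- (2 * x))) / (2 * x)) = card T * ((1 - exp (- (2 * x))) / 2)"
      by simp
    then show ?thesis by (simp add: field_simps)
  qed simp
  finally show ?thesis .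
qed

text \<open>
The linear term \<open>y / 2\<close> is exact.  Its constant decides that the threshold for the sparsity is
\<open>c = 1\<close>.
\<close>

lemma half_one_plus_exp_le:
  fixes y :: real
  assumes "0 \<le> y"
  shows "(1 + exp (- y)) / 2 \<le> exp (- (y / 2) + y\<^sup>2 / 4)"
proof -
  have "1 + y + y\<^sup>2 / 2 \<le> exp y" using exp_lower_Taylor_quadratic[OF assms] by simp
  moreover have "1 \<le> (1 - y + y\<^sup>2 / 2) * (1 + y + y\<^sup>2 / 2)"
  proof -
    have "(1 - y + y\<^sup>2 / 2) * (1 + y + y\<^sup>2 / 2) = 1 + (y\<^sup>2 / 2)\<^sup>2"
      by (simp add: algebra_simps power2_eq_square)
    then show ?thesis by simp
  qed
  moreover have pos: "0 \<le> 1 - y + y\<^sup>2 / 2"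
  proof -
    have "1 - y + y\<^sup>2 / 2 = ((1 - y)\<^sup>2 + 1) / 2" by (simp add: power2_eq_square algebra_simps)
    then show ?thesis by (simp only:) simp
  qed
  ultimately have "1 \<le> (1 - y + y\<^sup>2 / 2) * exp y"
    by (meson mult_left_mono order_trans)
  then have "exp (- y) \<le> 1 - y + y\<^sup>2 / 2" by (simp add: exp_minus field_simps)
  then have "(1 + exp (- y)) / 2 \<le> 1 + (- (y / 2) + y\<^sup>2 / 4)" by simp
  also have "\<dots> \<le> exp (- (y / 2) + y\<^sup>2 / 4)" by (rule exp_ge_add_one_self)
  finally show ?thesis .
qed

definition entry_dist :: "real \<Rightarrow> ('a :: finite \<Rightarrow> real) \<Rightarrow> bool" where
  "entry_dist \<alpha> q \<longleftrightarrow> (\<forall>u. 0 \<le> q u \<and> q u \<le> 1 - \<alpha>) \<and> (\<Sum>u\<in>UNIV. q u) = 1"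

definition col_weight :: "nat \<Rightarrow> (nat \<Rightarrow> 'a \<Rightarrow> real) \<Rightarrow> 'a vec \<Rightarrow> real" where
  "col_weight n q x = (\<Prod>i<n. q i (vec_index x i))"

lemma prob_weight_col_weight:
  fixes q :: "nat \<Rightarrow> 'a :: {field, finite} \<Rightarrow> real"
  assumes "\<And>i. i < n \<Longrightarrow> entry_dist \<alpha> (q i)"
  shows "prob_weight n (col_weight n q)"
  unfolding prob_weight_def col_weight_def
proof
  show "\<forall>x\<in>carrier_vec n. 0 \<le> (\<Prod>i<n. q i (vec_index x i))"
    using assms by (auto simp: entry_dist_def intro!: prod_nonneg)
  show "(\<Sum>x\<in>carrier_vec n. \<Prod>i<n. q i (vec_index x i)) = 1"
    unfolding sum_carrier_vec_prod using assms by (simp add: entry_dist_def)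
qed

text \<open>
The left-hand side is the probability that two independent copies of the entry agree.  If the most
likely value has probability \<open>1 - \<beta>\<close> with \<open>\<beta> \<le> 1/2\<close>, the other values contribute at most \<open>\<beta>\<^sup>2\<close>, as if
they were a single one; the two-point distribution \<open>{1 - \<alpha>, \<alpha>}\<close> is extremal.
\<close>

lemma collision_le:
  assumes q: "entry_dist \<alpha> q" and \<alpha>: "0 \<le> \<alpha>" "\<alpha> \<le> 1 / 2"
  shows "(\<Sum>u\<in>UNIV. (q u)\<^sup>2) \<le> 1 - 2 * \<alpha> * (1 - \<alpha>)"
proof -
  have q0: "0 \<le> q u" "q u \<le> 1 - \<alpha>" for u using q by (auto simp: entry_dist_def)
  have q1: "(\<Sum>u\<in>UNIV. q u) = 1" using q by (simp add: entry_dist_def)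
  have fin: "finite (range q)" by simp
  obtain u0 where u0: "\<And>u. q u \<le> q u0"
    using Max_in[OF fin] Max_ge[OF fin] by (metis UNIV_not_empty image_iff image_is_empty rangeI)
  define \<beta> where "\<beta> = 1 - q u0"
  have \<beta>: "\<alpha> \<le> \<beta>" using q0(2)[of u0] by (simp add: \<beta>_def)
  show ?thesis
  proof (cases "\<beta> \<le> 1 / 2")
    case True
    have rest: "(\<Sum>u\<in>UNIV - {u0}. q u) = \<beta>"
      using q1 sum.remove[of UNIV u0 q] by (simp add: \<beta>_def)
    have "(\<Sum>u\<in>UNIV - {u0}. (q u)\<^sup>2) \<le> (\<Sum>u\<in>UNIV - {u0}. q u * \<beta>)"
    proof (intro sum_mono)
      fix u assume u: "u \<in> UNIV - {u0}"
      have "q u \<le> \<beta>" unfolding rest[symmetric] using q0 u by (intro member_le_sum) auto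
      then show "(q u)\<^sup>2 \<le> q u * \<beta>" using q0 by (simp add: power2_eq_square mult_left_mono)
    qed
    also have "\<dots> = \<beta>\<^sup>2" by (simp add: rest power2_eq_square flip: sum_distrib_right)
    finally have "(\<Sum>u\<in>UNIV. (q u)\<^sup>2) \<le> (1 - \<beta>)\<^sup>2 + \<beta>\<^sup>2"
      using sum.remove[of UNIV u0 "\<lambda>u. (q u)\<^sup>2"] by (simp add: \<beta>_def)
    also have "\<dots> = 1 - 2 * \<alpha> * (1 - \<alpha>) - 2 * ((\<beta> - \<alpha>) * (1 - \<alpha> - \<beta>))"
      by (simp add: power2_eq_square algebra_simps)
    also have "\<dots> \<le> 1 - 2 * \<alpha> * (1 - \<alpha>)" using \<alpha> \<beta> True by simp
    finally show ?thesis .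
  next
    case False
    have "(\<Sum>u\<in>UNIV. (q u)\<^sup>2) \<le> (\<Sum>u\<in>UNIV. q u * q u0)"
      using q0 u0 by (intro sum_mono) (simp add: power2_eq_square mult_left_mono)
    also have "\<dots> = 1 - \<beta>" using q1 by (simp add: \<beta>_def flip: sum_distrib_right)
    also have "\<dots> \<le> 1 - 2 * \<alpha> * (1 - \<alpha>) - 2 * (1 / 2 - \<alpha>)\<^sup>2"
      using False by (simp add: power2_eq_square algebra_simps)
    also have "\<dots> \<le> 1 - 2 * \<alpha> * (1 - \<alpha>)" by simp
    finally show ?thesis .
  qed
qed

context additive_character
begin

definition char_gap :: real where
  "char_gap = Min ((\<lambda>x. 1 - Re (e x)) ` (UNIV - {0}))"

lemma char_gap_pos: "0 < char_gap"
proof -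
  have "(1 :: 'a) \<in> UNIV - {0}" by simp
  then have "UNIV - {0 :: 'a} \<noteq> {}" by blast
  then show ?thesis unfolding char_gap_def by (subst Min_gr_iff) (auto simp: Re_char_less)
qed

lemma char_gap_le: "x \<noteq> 0 \<Longrightarrow> char_gap \<le> 1 - Re (e x)"
  unfolding char_gap_def by (intro Min_le) auto

definition entry_transform :: "('a \<Rightarrow> real) \<Rightarrow> 'a \<Rightarrow> complex" where
  "entry_transform q t = (\<Sum>u\<in>UNIV. of_real (q u) * e (t * u))"

text \<open>
The squared modulus is the Fourier coefficient of the difference of two independent copies of the
entry.
\<close>

lemma norm_entry_transform:
  assumes "(\<Sum>u\<in>UNIV. q u) = 1"
  shows "(norm (entry_transform q t))\<^sup>2 =
           1 - (\<Sum>u\<in>UNIV. \<Sum>u'\<in>UNIV. q u * q u' * (1 - Re (e (t * (u - u')))))"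
proof -
  have "of_real ((norm (entry_transform q t))\<^sup>2) = entry_transform q t * cnj (entry_transform q t)"
    by (rule complex_norm_square)
  also have "\<dots> = (\<Sum>u\<in>UNIV. \<Sum>u'\<in>UNIV. of_real (q u * q u') * e (t * (u - u')))"
  proof -
    have "e (t * (u - u')) = e (t * u) * cnj (e (t * u'))" for u u'
      using char_add[of "t * u" "- (t * u')"] by (simp add: char_minus algebra_simps)
    then show ?thesis unfolding entry_transform_def by (simp add: sum_product mult_ac)
  qed
  finally have "(norm (entry_transform q t))\<^sup>2 =
      Re (\<Sum>u\<in>UNIV. \<Sum>u'\<in>UNIV. of_real (q u * q u') * e (t * (u - u')))"
    by (metis Re_complex_of_real)
  also have "\<dots> = (\<Sum>u\<in>UNIV. \<Sum>u'\<in>UNIV. q u * q u' * Re (e (t * (u - u'))))"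
    by simp
  also have "\<dots> = (\<Sum>u\<in>UNIV. \<Sum>u'\<in>UNIV. q u * q u' - q u * q u' * (1 - Re (e (t * (u - u')))))"
    by (intro sum.cong refl) (simp add: algebra_simps)
  also have "\<dots> = (\<Sum>u\<in>UNIV. q u) * (\<Sum>u\<in>UNIV. q u) -
      (\<Sum>u\<in>UNIV. \<Sum>u'\<in>UNIV. q u * q u' * (1 - Re (e (t * (u - u')))))"
    by (simp only: sum_subtractf sum_product)
  finally show ?thesis using assms by simp
qed

text \<open>
Half of \<open>Y t\<close> is a guaranteed exponent for the Fourier coefficient of \<open>q\<close> at the frequency \<open>t\<close>.  The
profile is normalised to have mean exactly \<open>\<tau>\<close> and values at most twice the mean, whatever the
distribution of the entry is; these are the hypotheses of \<open>sum_exp_le\<close>.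
\<close>

definition decay_profile :: "real \<Rightarrow> ('a \<Rightarrow> real) \<Rightarrow> ('a \<Rightarrow> real) \<Rightarrow> bool" where
  "decay_profile \<tau> q Y \<longleftrightarrow>
     (\<forall>t. 0 \<le> Y t \<and> Y t \<le> 2 * \<tau>) \<and> (\<Sum>t\<in>UNIV. Y t) = real CARD('a) * \<tau> \<and>
     (\<forall>t. t \<noteq> 0 \<longrightarrow> char_gap * \<tau> \<le> Y t) \<and>
     (\<forall>t. norm (entry_transform q t) \<le> exp (- (Y t / 2)))"

text \<open>
One minus the squared Fourier coefficient is a combination of the functions \<open>1 - Re e(t (u - u'))\<close>,
each of which has mean 1 over \<open>t\<close> and values in \<open>[0, 2]\<close>.  The total mass \<open>Q\<close> of the combination is the
probability that two independent copies of the entry differ, so \<open>Q \<ge> \<tau>\<close>, and scaling by \<open>\<tau> / Q\<close>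
gives the normalised profile.
\<close>

lemma decay_profile_exists:
  assumes q: "entry_dist \<alpha> q" and \<alpha>: "0 < \<alpha>" "\<alpha> \<le> 1 / 2"
  shows "\<exists>Y. decay_profile (2 * \<alpha> * (1 - \<alpha>)) q Y"
proof -
  define \<tau> where "\<tau> = 2 * \<alpha> * (1 - \<alpha>)"
  have \<tau>: "\<tau> > 0" using \<alpha> by (simp add: \<tau>_def)
  have q0: "0 \<le> q u" for u using q by (simp add: entry_dist_def)
  have q1: "(\<Sum>u\<in>UNIV. q u) = 1" using q by (simp add: entry_dist_def)
  define r where "r u u' = (if u = u' then 0 else q u * q u')" for u u'
  define Q where "Q = (\<Sum>u\<in>UNIV. \<Sum>u'\<in>UNIV. r u u')"
  define g where "g t = (\<Sum>u\<in>UNIV. \<Sum>u'\<in>UNIV. r u u' * (1 - Re (e (t * (u - u')))))" for t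
  have r0: "0 \<le> r u u'" for u u' using q0 by (simp add: r_def)
  have norm_g: "(norm (entry_transform q t))\<^sup>2 = 1 - g t" for t
    unfolding norm_entry_transform[OF q1] g_def
    by (intro arg_cong[where f = "\<lambda>x. 1 - x"] sum.cong refl) (simp add: r_def)
  have "Q = (\<Sum>u\<in>UNIV. \<Sum>u'\<in>UNIV. q u * q u' - (if u = u' then (q u)\<^sup>2 else 0))"
    unfolding Q_def by (intro sum.cong refl) (simp add: r_def power2_eq_square)
  also have "\<dots> = (\<Sum>u\<in>UNIV. q u) * (\<Sum>u\<in>UNIV. q u) - (\<Sum>u\<in>UNIV. (q u)\<^sup>2)"
    by (simp add: sum_subtractf sum_product)
  finally have "Q = 1 - (\<Sum>u\<in>UNIV. (q u)\<^sup>2)" using q1 by simp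
  then have Q: "\<tau> \<le> Q" using collision_le[OF q] \<alpha> by (simp add: \<tau>_def)
  define Y where "Y t = \<tau> / Q * g t" for t
  have Qpos: "Q > 0" using Q \<tau> by simp
  have gpos: "0 \<le> g t" for t
    unfolding g_def using r0 Re_char_le by (intro sum_nonneg mult_nonneg_nonneg) auto
  have g2: "g t \<le> 2 * Q" for t
  proof -
    have "g t \<le> (\<Sum>u\<in>UNIV. \<Sum>u'\<in>UNIV. r u u' * 2)"
      unfolding g_def using r0
    proof (intro sum_mono mult_left_mono)
      show "1 - Re (e (t * (u - u'))) \<le> 2" for u u' using Re_char_ge[of "t * (u - u')"] by simp
    qed auto
    then show ?thesis by (simp add: Q_def sum_distrib_left mult.commute)
  qed
  have gsum: "(\<Sum>t\<in>UNIV. g t) = CARD('a) * Q"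
  proof -
    have "(\<Sum>t\<in>UNIV. g t) = (\<Sum>u\<in>UNIV. \<Sum>u'\<in>UNIV. r u u' * (\<Sum>t\<in>UNIV. 1 - Re (e (t * (u - u')))))"
      unfolding g_def sum_distrib_left
      by (subst sum.swap, rule sum.cong[OF refl], rule sum.swap)
    also have "\<dots> = (\<Sum>u\<in>UNIV. \<Sum>u'\<in>UNIV. r u u' * CARD('a))"
    proof (intro sum.cong refl)
      fix u u' :: 'a
      have "(\<Sum>t\<in>UNIV. Re (e (t * (u - u')))) = 0" if "u \<noteq> u'"
        using sum_char_mult[of "u - u'"] that by (simp flip: Re_sum)
      then show "r u u' * (\<Sum>t\<in>UNIV. 1 - Re (e (t * (u - u')))) = r u u' * CARD('a)"
        by (simp add: r_def sum_subtractf)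
    qed
    finally show ?thesis by (simp add: Q_def sum_distrib_left mult.commute)
  qed
  have ggap: "char_gap * Q \<le> g t" if "t \<noteq> 0" for t
  proof -
    have "(\<Sum>u\<in>UNIV. \<Sum>u'\<in>UNIV. r u u' * char_gap) \<le> g t"
      unfolding g_def
    proof (intro sum_mono)
      fix u u' :: 'a
      show "r u u' * char_gap \<le> r u u' * (1 - Re (e (t * (u - u'))))"
      proof (cases "u = u'")
        case False
        then show ?thesis using r0 that by (intro mult_left_mono char_gap_le) auto
      qed (simp add: r_def)
    qed
    then show ?thesis by (simp add: Q_def sum_distrib_left mult.commute)
  qed
  have Yg: "Y t \<le> g t" for t
  proof -
    have "\<tau> / Q \<le> 1" using Q Qpos by simp
    then show ?thesis unfolding Y_def using mult_right_mono[OF _ gpos[of t], of "\<tau> / Q" 1] by simp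
  qed
  have "decay_profile \<tau> q Y"
    unfolding decay_profile_def
  proof (intro conjI allI impI)
    fix t
    show "0 \<le> Y t" using gpos \<tau> Qpos by (simp add: Y_def)
    have "\<tau> / Q * g t \<le> \<tau> / Q * (2 * Q)" using g2 \<tau> Qpos by (intro mult_left_mono) auto
    then show "Y t \<le> 2 * \<tau>" using Qpos by (simp add: Y_def)
    show "char_gap * \<tau> \<le> Y t" if "t \<noteq> 0"
    proof -
      have "\<tau> / Q * (char_gap * Q) \<le> \<tau> / Q * g t"
        using ggap[OF that] \<tau> Qpos by (intro mult_left_mono) auto
      then show ?thesis using Qpos by (simp add: Y_def mult.commute)
    qed
    have "(norm (entry_transform q t))\<^sup>2 \<le> 1 + (- Y t)" using Yg[of t] norm_g[of t] by simp
    also have "\<dots> \<le> exp (- Y t)" by (rule exp_ge_add_one_self)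
    also have "\<dots> = (exp (- (Y t / 2)))\<^sup>2" by (simp add: power2_eq_square flip: exp_add)
    finally show "norm (entry_transform q t) \<le> exp (- (Y t / 2))"
      by (rule power2_le_imp_le) simp
  next
    show "(\<Sum>t\<in>UNIV. Y t) = real CARD('a) * \<tau>"
      unfolding Y_def sum_distrib_left[symmetric] gsum using Qpos by simp
  qed
  then show ?thesis by (auto simp: \<tau>_def)
qed

lemma char_transform_col_weight:
  assumes v: "v \<in> carrier_vec n"
  shows "char_transform n (col_weight n q) v = (\<Prod>i<n. entry_transform (q i) (vec_index v i))"
proof -
  have "char_transform n (col_weight n q) v =
    (\<Sum>x\<in>carrier_vec n. \<Prod>i<n. of_real (q i (vec_index x i)) * e (vec_index v i * vec_index x i))"
    unfolding char_transform_def col_weight_def scalar_prod_def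
    by (intro sum.cong refl) (simp add: char_sum prod.distrib lessThan_atLeast0)
  also have "\<dots> = (\<Prod>i<n. \<Sum>u\<in>UNIV. of_real (q i u) * e (vec_index v i * u))"
    by (rule sum_carrier_vec_prod)
  finally show ?thesis by (simp add: entry_transform_def)
qed

text \<open>
Orthogonality of characters on the line spanned by \<open>v\<close>.
\<close>

lemma annihilation_char_transform:
  assumes v: "v \<in> carrier_vec n"
  shows "of_real (CARD('a) * annihilation n w v) = (\<Sum>t\<in>UNIV. char_transform n w (t \<cdot>\<^sub>v v))"
proof -
  have "(\<Sum>t\<in>UNIV. char_transform n w (t \<cdot>\<^sub>v v)) =
        (\<Sum>x\<in>carrier_vec n. of_real (w x) * (\<Sum>t\<in>UNIV. e (t * scalar_prod v x)))"
    unfolding char_transform_def using v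
    by (subst sum.swap) (simp add: sum_distrib_left)
  also have "\<dots> = (\<Sum>x\<in>carrier_vec n. of_nat CARD('a) * of_real (if scalar_prod v x = 0 then w x else 0))"
    by (intro sum.cong refl) (simp add: sum_char_mult)
  finally show ?thesis by (simp add: annihilation_def sum_distrib_left)
qed

lemma annihilation_le_norm:
  assumes v: "v \<in> carrier_vec n"
  shows "CARD('a) * annihilation n w v \<le> (\<Sum>t\<in>UNIV. norm (char_transform n w (t \<cdot>\<^sub>v v)))"
proof -
  have "CARD('a) * annihilation n w v \<le> norm (of_real (CARD('a) * annihilation n w v) :: complex)"
    unfolding norm_of_real by simp
  also have "\<dots> \<le> (\<Sum>t\<in>UNIV. norm (char_transform n w (t \<cdot>\<^sub>v v)))"
    unfolding annihilation_char_transform[OF v] by (rule norm_sum)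
  finally show ?thesis .
qed

lemma annihilation_le_of_small_transform:
  fixes \<theta> :: real
  assumes v: "v \<in> carrier_vec n" and w: "prob_weight n w" and \<theta>: "0 \<le> \<theta>"
    and small: "\<And>t. t \<noteq> 0 \<Longrightarrow> norm (char_transform n w (t \<cdot>\<^sub>v v)) \<le> \<theta>"
  shows "annihilation n w v \<le> (1 + CARD('a) * \<theta>) / CARD('a)"
proof -
  have 0: "0 \<cdot>\<^sub>v v = 0\<^sub>v n" using v by auto
  have "CARD('a) * annihilation n w v \<le> (\<Sum>t\<in>UNIV. norm (char_transform n w (t \<cdot>\<^sub>v v)))"
    by (rule annihilation_le_norm[OF v])
  also have "\<dots> = 1 + (\<Sum>t\<in>UNIV - {0}. norm (char_transform n w (t \<cdot>\<^sub>v v)))"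
    using sum.remove[of UNIV 0 "\<lambda>t. norm (char_transform n w (t \<cdot>\<^sub>v v))"]
    by (simp add: 0 char_transform_0[OF w])
  also have "(\<Sum>t\<in>UNIV - {0}. norm (char_transform n w (t \<cdot>\<^sub>v v))) \<le> (\<Sum>t\<in>UNIV - {0 :: 'a}. \<theta>)"
    by (intro sum_mono small) auto
  also have "\<dots> \<le> CARD('a) * \<theta>" using \<theta> by (auto intro!: mult_right_mono card_mono)
  finally show ?thesis by (simp add: field_simps)
qed

end

section \<open>First moment of the left kernel\<close>

definition vec_weight :: "'a :: zero vec \<Rightarrow> nat" where
  "vec_weight v = card {i. i < dim_vec v \<and> vec_index v i \<noteq> 0}"

lemma vec_weight_zero: "vec_weight (0\<^sub>v n) = 0"
proof -
  have "{i. i < n \<and> vec_index (0\<^sub>v n) i \<noteq> 0} = {}" by auto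
  then show ?thesis by (simp add: vec_weight_def)
qed

lemma prod_power_vec_weight:
  fixes \<rho> :: real
  assumes "v \<in> carrier_vec n"
  shows "\<rho> ^ vec_weight v = (\<Prod>i<n. if vec_index v i \<noteq> 0 then \<rho> else 1)"
proof -
  have "{i. i < dim_vec v \<and> vec_index v i \<noteq> 0} = {i \<in> {..<n}. vec_index v i \<noteq> 0}"
    using assms by auto
  then show ?thesis by (simp add: vec_weight_def flip: prod.inter_filter)
qed

text \<open>
The weight enumerator of the whole space.  It serves twice: as the total contribution of the
vectors of small weight, and in a Chernoff bound for their number.
\<close>

lemma sum_power_vec_weight:
  fixes \<rho> :: real
  shows "(\<Sum>v\<in>(carrier_vec n :: 'a :: {field, finite} vec set). \<rho> ^ vec_weight v)
           = (1 + (real CARD('a) - 1) * \<rho>) ^ n"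
proof -
  have "(\<Sum>v\<in>(carrier_vec n :: 'a vec set). \<rho> ^ vec_weight v) =
        (\<Sum>v\<in>(carrier_vec n :: 'a vec set). \<Prod>i<n. if vec_index v i \<noteq> 0 then \<rho> else 1)"
    by (intro sum.cong refl prod_power_vec_weight)
  also have "\<dots> = (\<Prod>i<n. \<Sum>u\<in>(UNIV :: 'a set). if u \<noteq> 0 then \<rho> else 1)"
    by (rule sum_carrier_vec_prod)
  also have "(\<Sum>u\<in>(UNIV :: 'a set). if u \<noteq> 0 then \<rho> else 1) = 1 + (real CARD('a) - 1) * \<rho>"
  proof -
    have "(\<Sum>u\<in>(UNIV :: 'a set). if u \<noteq> 0 then \<rho> else 1) = 1 + (\<Sum>u\<in>UNIV - {0 :: 'a}. \<rho>)"
      by (subst sum.remove[of _ 0]) (auto intro!: sum.cong)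
    then show ?thesis using one_less_card_field[where 'a = 'a] by (simp add: card_Diff_singleton of_nat_diff)
  qed
  finally show ?thesis by simp
qed

lemma power_one_plus_le_exp: "0 \<le> x \<Longrightarrow> (1 + x) ^ n \<le> exp (real n * x)" for x :: real
  using power_mono[OF exp_ge_add_one_self, of x n] by (simp add: exp_of_nat_mult)

text \<open>
Chernoff's method: a vector of weight at most \<open>\<zeta>n\<close> contributes at least \<open>x\<^sup>\<zeta>\<^sup>n\<close> to the weight
enumerator at \<open>x\<close>.
\<close>

lemma card_low_vec_weight_le:
  fixes \<zeta> x :: real
  assumes x: "0 < x" "x \<le> 1"
  shows "card {v \<in> (carrier_vec n :: 'a :: {field, finite} vec set). vec_weight v \<le> \<zeta> * n}
           \<le> exp (n * (\<zeta> * ln (1 / x) + CARD('a) * x))"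
proof -
  let ?V = "carrier_vec n :: 'a vec set"
  let ?L = "{v \<in> ?V. vec_weight v \<le> \<zeta> * n}"
  have "card ?L * x powr (\<zeta> * n) \<le> (\<Sum>v\<in>?L. x ^ vec_weight v)"
  proof -
    have "x powr (\<zeta> * n) \<le> x ^ vec_weight v" if "v \<in> ?L" for v
      using that x powr_mono'[of "real (vec_weight v)" "\<zeta> * n" x] by (simp add: powr_realpow)
    then have "(\<Sum>v\<in>?L. x powr (\<zeta> * n)) \<le> (\<Sum>v\<in>?L. x ^ vec_weight v)" by (rule sum_mono)
    then show ?thesis by simp
  qed
  also have "\<dots> \<le> (\<Sum>v\<in>?V. x ^ vec_weight v)" using x by (intro sum_mono2) auto
  also have "\<dots> = (1 + (real CARD('a) - 1) * x) ^ n" by (rule sum_power_vec_weight)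
  also have "\<dots> \<le> (1 + CARD('a) * x) ^ n"
    using x one_less_card_field[where 'a = 'a]
    by (intro power_mono add_mono mult_right_mono) auto
  also have "\<dots> \<le> exp (n * (CARD('a) * x))" using x by (intro power_one_plus_le_exp) auto
  finally have "card ?L * x powr (\<zeta> * n) \<le> exp (n * (CARD('a) * x))" .
  then have le: "card ?L * x powr (\<zeta> * n) * exp (n * (\<zeta> * ln (1 / x)))
      \<le> exp (n * (CARD('a) * x)) * exp (n * (\<zeta> * ln (1 / x)))"
    by (rule mult_right_mono) simp
  have inv: "x powr (\<zeta> * n) * exp (n * (\<zeta> * ln (1 / x))) = 1"
    using x by (simp add: powr_def ln_div algebra_simps flip: exp_add)
  have "card ?L \<le> exp (n * (CARD('a) * x)) * exp (n * (\<zeta> * ln (1 / x)))"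
    using le unfolding mult.assoc inv by simp
  then show ?thesis by (simp add: algebra_simps flip: exp_add)
qed

text \<open>
A matrix with independent entries, seen through the distributions \<open>q j i\<close> of the entry in row \<open>i\<close> and
column \<open>j\<close> and their decay profiles \<open>Y j i\<close>.
\<close>

locale balanced_columns = additive_character e
  for e :: "'a :: {field, finite} \<Rightarrow> complex" +
  fixes n :: nat and \<tau> :: real and q Y :: "nat \<Rightarrow> nat \<Rightarrow> 'a \<Rightarrow> real"
  assumes tau_pos: "0 < \<tau>"
    and weight: "\<And>j. j < n \<Longrightarrow> prob_weight n (col_weight n (q j))"
    and profile: "\<And>i j. i < n \<Longrightarrow> j < n \<Longrightarrow> decay_profile \<tau> (q j i) (Y j i)"
begin

abbreviation column :: "nat \<Rightarrow> 'a vec \<Rightarrow> real" where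
  "column j \<equiv> col_weight n (q j)"

abbreviation vectors :: "'a vec set" where
  "vectors \<equiv> carrier_vec n"

lemma Y_bounds:
  assumes "i < n" "j < n"
  shows "0 \<le> Y j i t" "Y j i t \<le> 2 * \<tau>" "t \<noteq> 0 \<Longrightarrow> char_gap * \<tau> \<le> Y j i t"
    "norm (entry_transform (q j i) t) \<le> exp (- (Y j i t / 2))"
  using profile[OF assms] by (auto simp: decay_profile_def)

lemma sum_Y_mult:
  assumes "i < n" "j < n" "a \<noteq> 0"
  shows "(\<Sum>t\<in>UNIV. Y j i (t * a)) = real CARD('a) * \<tau>"
proof -
  have "(\<Sum>t\<in>UNIV. Y j i (t * a)) = (\<Sum>t\<in>UNIV. Y j i t)"
    by (rule sum.reindex_bij_witness[of _ "\<lambda>t. t / a" "\<lambda>t. t * a"]) (use assms in auto)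
  then show ?thesis using profile[OF assms(1,2)] by (simp add: decay_profile_def)
qed

text \<open>
By independence the exponents of the entries add up.
\<close>

definition decay :: "nat \<Rightarrow> 'a vec \<Rightarrow> real" where
  "decay j v = (\<Sum>i<n. Y j i (vec_index v i))"

lemma norm_char_transform_le:
  assumes j: "j < n" and v: "v \<in> vectors"
  shows "norm (char_transform n (column j) v) \<le> exp (- (decay j v / 2))"
proof -
  have "norm (char_transform n (column j) v) = (\<Prod>i<n. norm (entry_transform (q j i) (vec_index v i)))"
    by (simp add: char_transform_col_weight[OF v] prod_norm)
  also have "\<dots> \<le> (\<Prod>i<n. exp (- (Y j i (vec_index v i) / 2)))"
    using Y_bounds(4)[OF _ j] by (intro prod_mono) auto
  also have "\<dots> = exp (- (decay j v / 2))"
    by (simp add: exp_sum[symmetric] decay_def sum_negf sum_divide_distrib)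
  finally show ?thesis .
qed

text \<open>
For a fixed coordinate with \<open>v\<^sub>i \<noteq> 0\<close> the products \<open>t v\<^sub>i\<close> run through the whole field as \<open>t\<close> does, so
the exponents at the multiples \<open>t v\<close> have mean \<open>w \<tau> / 2\<close> and maximum at most \<open>w \<tau>\<close>, where \<open>w\<close> is the
weight of \<open>v\<close>.  In the worst case of \<open>sum_exp_le\<close>, half of the multiples have exponent zero, as over
the field with two elements.
\<close>

lemma annihilation_le_vec_weight:
  assumes j: "j < n" and v: "v \<in> vectors"
  shows "annihilation n (column j) v \<le> (1 + exp (- (vec_weight v * \<tau>))) / 2"
proof -
  define S where "S = {i. i < n \<and> vec_index v i \<noteq> 0}"
  have S: "finite S" "S \<subseteq> {..<n}" "card S = vec_weight v"
    using v by (auto simp: S_def vec_weight_def)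
  define Z where "Z t = (\<Sum>i\<in>S. Y j i (t * vec_index v i)) / 2" for t
  have "CARD('a) * annihilation n (column j) v \<le>
        (\<Sum>t\<in>UNIV. norm (char_transform n (column j) (t \<cdot>\<^sub>v v)))"
    by (rule annihilation_le_norm[OF v])
  also have "\<dots> \<le> (\<Sum>t\<in>UNIV. exp (- Z t))"
  proof (intro sum_mono)
    fix t
    have "2 * Z t \<le> decay j (t \<cdot>\<^sub>v v)"
    proof -
      have "2 * Z t \<le> (\<Sum>i<n. Y j i (t * vec_index v i))"
        unfolding Z_def using S Y_bounds(1)[OF _ j] by (simp, intro sum_mono2) auto
      also have "\<dots> = decay j (t \<cdot>\<^sub>v v)" using v by (simp add: decay_def)
      finally show ?thesis .
    qed
    then have "exp (- (decay j (t \<cdot>\<^sub>v v) / 2)) \<le> exp (- Z t)" by simp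
    then show "norm (char_transform n (column j) (t \<cdot>\<^sub>v v)) \<le> exp (- Z t)"
      using norm_char_transform_le[OF j, of "t \<cdot>\<^sub>v v"] v by (meson order_trans smult_carrier_vec)
  qed
  also have "\<dots> \<le> real CARD('a) * ((1 + exp (- (2 * (vec_weight v * \<tau> / 2)))) / 2)"
  proof (rule sum_exp_le)
    show "0 \<le> Z t" for t
      unfolding Z_def using S Y_bounds(1)[OF _ j] by (auto intro!: sum_nonneg)
    show "Z t \<le> 2 * (vec_weight v * \<tau> / 2)" for t
    proof -
      have "(\<Sum>i\<in>S. Y j i (t * vec_index v i)) \<le> (\<Sum>i\<in>S. 2 * \<tau>)"
        using S Y_bounds(2)[OF _ j] by (intro sum_mono) auto
      then show ?thesis using S by (simp add: Z_def)
    qed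
    show "(\<Sum>t\<in>UNIV. Z t) = real CARD('a) * (vec_weight v * \<tau> / 2)"
    proof -
      have "(\<Sum>t\<in>UNIV. Z t) = (\<Sum>i\<in>S. \<Sum>t\<in>UNIV. Y j i (t * vec_index v i)) / 2"
        unfolding Z_def sum_divide_distrib[symmetric] by (subst sum.swap) simp
      also have "(\<Sum>i\<in>S. \<Sum>t\<in>UNIV. Y j i (t * vec_index v i)) = (\<Sum>i\<in>S. real CARD('a) * \<tau>)"
        using sum_Y_mult[OF _ j] by (intro sum.cong) (auto simp: S_def)
      finally show ?thesis using S by simp
    qed
  qed simp
  finally show ?thesis by simp
qed

lemma vec_weight_decay:
  assumes j: "j < n" and v: "v \<in> vectors" and t: "t \<noteq> 0"
  shows "char_gap * \<tau> * vec_weight v \<le> decay j (t \<cdot>\<^sub>v v)"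
proof -
  define S where "S = {i. i < n \<and> vec_index v i \<noteq> 0}"
  have S: "finite S" "S \<subseteq> {..<n}" "card S = vec_weight v"
    using v by (auto simp: S_def vec_weight_def)
  have "char_gap * \<tau> * vec_weight v = (\<Sum>i\<in>S. char_gap * \<tau>)" using S by simp
  also have "\<dots> \<le> (\<Sum>i\<in>S. Y j i (t * vec_index v i))"
    using Y_bounds(3)[OF _ j] t by (intro sum_mono) (auto simp: S_def)
  also have "\<dots> \<le> (\<Sum>i<n. Y j i (t * vec_index v i))"
    using S Y_bounds(1)[OF _ j] by (intro sum_mono2) auto
  finally show ?thesis using v by (simp add: decay_def)
qed

text \<open>
A uniformly random \<open>v\<close> has expected decay exactly \<open>n \<tau>\<close> for each column, and a typical vector
reaches the fraction \<open>1 - \<epsilon>\<close> of it, for all columns and all nonzero multiples.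
\<close>

definition typical :: "real \<Rightarrow> 'a vec \<Rightarrow> bool" where
  "typical \<epsilon> v \<longleftrightarrow> (\<forall>j<n. \<forall>t. t \<noteq> 0 \<longrightarrow> (1 - \<epsilon>) * n * \<tau> \<le> decay j (t \<cdot>\<^sub>v v))"

text \<open>
Chernoff's method again: the coordinates of a uniformly random \<open>v\<close> are independent, and their decays
have mean \<open>\<tau>\<close> and values in \<open>[0, 2\<tau>]\<close>.
\<close>

lemma card_low_decay_le:
  fixes \<epsilon> :: real
  assumes j: "j < n" and t: "t \<noteq> 0" and \<epsilon>: "0 < \<epsilon>"
  shows "card {v \<in> vectors. decay j (t \<cdot>\<^sub>v v) < (1 - \<epsilon>) * n * \<tau>}
           \<le> real CARD('a) ^ n * exp (- (n * \<epsilon>\<^sup>2 / 4))"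
proof -
  let ?L = "{v \<in> vectors. decay j (t \<cdot>\<^sub>v v) < (1 - \<epsilon>) * n * \<tau>}"
  \<comment> \<open>This value minimises the resulting exponent \<open>(l \<tau>)\<^sup>2 - \<epsilon> l \<tau>\<close> per coordinate.\<close>
  define l where "l = \<epsilon> / (2 * \<tau>)"
  have l: "l > 0" "l * \<tau> = \<epsilon> / 2" using tau_pos \<epsilon> by (auto simp: l_def)
  have factor: "(\<Sum>u\<in>UNIV. exp (- (l * Y j i (t * u)))) \<le> real CARD('a) * exp (- (\<epsilon> / 2) + \<epsilon>\<^sup>2 / 4)"
    if i: "i < n" for i
  proof -
    have "(\<Sum>u\<in>UNIV. exp (- (l * Y j i (t * u)))) \<le> real CARD('a) * ((1 + exp (- (2 * (l * \<tau>)))) / 2)"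
    proof (rule sum_exp_le)
      show "0 \<le> l * Y j i (t * u)" for u using Y_bounds(1)[OF i j] l by simp
      show "l * Y j i (t * u) \<le> 2 * (l * \<tau>)" for u
        using mult_left_mono[OF Y_bounds(2)[OF i j], of l] l by simp
      show "(\<Sum>u\<in>UNIV. l * Y j i (t * u)) = real CARD('a) * (l * \<tau>)"
        using sum_Y_mult[OF i j t] by (simp add: mult.commute flip: sum_distrib_left)
    qed simp
    also have "\<dots> = real CARD('a) * ((1 + exp (- \<epsilon>)) / 2)" by (simp add: l)
    also have "\<dots> \<le> real CARD('a) * exp (- (\<epsilon> / 2) + \<epsilon>\<^sup>2 / 4)"
      using \<epsilon> by (intro mult_left_mono half_one_plus_exp_le) auto
    finally show ?thesis .
  qed
  have "card ?L * exp (- (l * ((1 - \<epsilon>) * n * \<tau>))) = (\<Sum>v\<in>?L. exp (- (l * ((1 - \<epsilon>) * n * \<tau>))))"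
    by simp
  also have "\<dots> \<le> (\<Sum>v\<in>?L. exp (- (l * decay j (t \<cdot>\<^sub>v v))))"
    using l by (intro sum_mono) auto
  also have "\<dots> \<le> (\<Sum>v\<in>vectors. exp (- (l * decay j (t \<cdot>\<^sub>v v))))"
    by (intro sum_mono2) auto
  also have "\<dots> = (\<Sum>v\<in>vectors. \<Prod>i<n. exp (- (l * Y j i (t * vec_index v i))))"
    by (intro sum.cong refl) (simp add: decay_def sum_distrib_left sum_negf flip: exp_sum)
  also have "\<dots> = (\<Prod>i<n. \<Sum>u\<in>UNIV. exp (- (l * Y j i (t * u))))"
    by (rule sum_carrier_vec_prod)
  also have "\<dots> \<le> (\<Prod>i<n. real CARD('a) * exp (- (\<epsilon> / 2) + \<epsilon>\<^sup>2 / 4))"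
    using factor by (intro prod_mono) (auto intro!: sum_nonneg)
  also have "\<dots> = real CARD('a) ^ n * exp (n * (- (\<epsilon> / 2) + \<epsilon>\<^sup>2 / 4))"
    by (simp add: power_mult_distrib flip: exp_of_nat_mult)
  finally have le: "card ?L * exp (- (l * ((1 - \<epsilon>) * n * \<tau>))) \<le>
      real CARD('a) ^ n * exp (n * (- (\<epsilon> / 2) + \<epsilon>\<^sup>2 / 4))" .
  have eq: "l * ((1 - \<epsilon>) * n * \<tau>) = n * (\<epsilon> / 2 - \<epsilon>\<^sup>2 / 2)"
  proof -
    have "l * ((1 - \<epsilon>) * n * \<tau>) = l * \<tau> * ((1 - \<epsilon>) * n)" by simp
    then show ?thesis unfolding l(2) by (simp add: power2_eq_square algebra_simps)
  qed
  have "card ?L = card ?L * exp (- (n * (\<epsilon> / 2 - \<epsilon>\<^sup>2 / 2))) * exp (n * (\<epsilon> / 2 - \<epsilon>\<^sup>2 / 2))"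
    unfolding mult.assoc exp_add[symmetric] by simp
  also have "\<dots> \<le> real CARD('a) ^ n * exp (n * (- (\<epsilon> / 2) + \<epsilon>\<^sup>2 / 4)) *
      exp (n * (\<epsilon> / 2 - \<epsilon>\<^sup>2 / 2))"
    using le unfolding eq by (rule mult_right_mono) simp
  also have "\<dots> = real CARD('a) ^ n * exp (n * (- (\<epsilon> / 2) + \<epsilon>\<^sup>2 / 4) + n * (\<epsilon> / 2 - \<epsilon>\<^sup>2 / 2))"
    unfolding mult.assoc exp_add[symmetric] ..
  also have "n * (- (\<epsilon> / 2) + \<epsilon>\<^sup>2 / 4) + n * (\<epsilon> / 2 - \<epsilon>\<^sup>2 / 2) = - (n * \<epsilon>\<^sup>2 / 4)"
    by (simp add: algebra_simps)
  finally show ?thesis .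
qed

lemma card_atypical_le:
  fixes \<epsilon> :: real
  assumes \<epsilon>: "0 < \<epsilon>"
  shows "card {v \<in> vectors. \<not> typical \<epsilon> v}
           \<le> n * CARD('a) * (real CARD('a) ^ n * exp (- (n * \<epsilon>\<^sup>2 / 4)))"
proof -
  let ?I = "{..<n} \<times> (UNIV - {0 :: 'a})"
  let ?B = "\<lambda>(j, t). {v \<in> vectors. decay j (t \<cdot>\<^sub>v v) < (1 - \<epsilon>) * n * \<tau>}"
  let ?b = "real CARD('a) ^ n * exp (- (n * \<epsilon>\<^sup>2 / 4))"
  have "{v \<in> vectors. \<not> typical \<epsilon> v} \<subseteq> (\<Union>x\<in>?I. ?B x)"
    unfolding typical_def by (fastforce simp: not_le)
  then have "card {v \<in> vectors. \<not> typical \<epsilon> v} \<le> card (\<Union>x\<in>?I. ?B x)"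
    by (intro card_mono) auto
  also have "\<dots> \<le> (\<Sum>x\<in>?I. card (?B x))" by (rule card_UN_le) simp
  finally have "real (card {v \<in> vectors. \<not> typical \<epsilon> v}) \<le> (\<Sum>x\<in>?I. real (card (?B x)))"
    by (simp flip: of_nat_sum)
  also have "\<dots> \<le> (\<Sum>x\<in>?I. ?b)"
    using card_low_decay_le[OF _ _ \<epsilon>] by (intro sum_mono) auto
  also have "\<dots> = real n * real (card (UNIV - {0 :: 'a})) * ?b" by (simp add: card_cartesian_product)
  also have "\<dots> \<le> real n * real CARD('a) * ?b"
    by (intro mult_right_mono mult_left_mono of_nat_mono card_mono) auto
  finally show ?thesis by simp
qed

end

lemma sum_Un_le_add:
  fixes f :: "'b \<Rightarrow> real"
  assumes "finite A" "finite B" "\<And>x. 0 \<le> f x"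
  shows "sum f (A \<union> B) \<le> sum f A + sum f B"
  using sum.union_inter[OF assms(1,2), of f] sum_nonneg[of "A \<inter> B" f] assms(3) by simp

context balanced_columns
begin

text \<open>
The probability that \<open>v\<close> is orthogonal to all the columns with index in \<open>J\<close>.
\<close>

definition kernel_moment :: "nat set \<Rightarrow> 'a vec \<Rightarrow> real" where
  "kernel_moment J v = (\<Prod>j\<in>J. annihilation n (column j) v)"

lemma kernel_moment_le:
  assumes "J \<subseteq> {..<n}" "\<And>j. j < n \<Longrightarrow> annihilation n (column j) v \<le> b"
  shows "kernel_moment J v \<le> b ^ card J"
proof -
  have "kernel_moment J v \<le> (\<Prod>j\<in>J. b)"
    unfolding kernel_moment_def using assms annihilation_nonneg[OF weight]
    by (intro prod_mono) auto
  then show ?thesis by simp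
qed

lemma kernel_moment_nonneg: "J \<subseteq> {..<n} \<Longrightarrow> 0 \<le> kernel_moment J v"
  unfolding kernel_moment_def using annihilation_nonneg[OF weight] by (intro prod_nonneg) auto

lemma sum_kernel_moment_le:
  assumes S: "S \<subseteq> vectors" and J: "J \<subseteq> {..<n}"
    and b: "\<And>v j. v \<in> S \<Longrightarrow> j < n \<Longrightarrow> annihilation n (column j) v \<le> b"
    and c: "real (card S) \<le> c" and b0: "0 \<le> b"
  shows "(\<Sum>v\<in>S. kernel_moment J v) \<le> c * b ^ card J"
proof -
  have "(\<Sum>v\<in>S. kernel_moment J v) \<le> (\<Sum>v\<in>S. b ^ card J)"
    using kernel_moment_le[OF J b] by (intro sum_mono) auto
  also have "\<dots> \<le> c * b ^ card J" using c b0 by (simp add: mult_right_mono)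
  finally show ?thesis .
qed

text \<open>
Here \<open>exp (- w \<tau> |J| / 2)\<close> is about \<open>n\<^sup>-\<^sup>c\<^sup>w\<close>, and the bound is nearly multiplicative in the weight, so that
the sum is controlled by the weight enumerator.
\<close>

lemma light_moment_le:
  fixes \<epsilon> :: real
  assumes J: "J \<subseteq> {..<n}" and \<epsilon>: "0 < \<epsilon>" "\<epsilon> < 1"
  shows "(\<Sum>v\<in>{v \<in> vectors. v \<noteq> 0\<^sub>v n \<and> vec_weight v * \<tau> \<le> 2 * \<epsilon>}. kernel_moment J v)
           \<le> exp (n * (CARD('a) * exp (- ((1 - \<epsilon>) * \<tau> / 2 * card J)))) - 1"
proof -
  define \<rho> where "\<rho> = exp (- ((1 - \<epsilon>) * \<tau> / 2 * card J))"
  let ?S = "{v \<in> vectors. v \<noteq> 0\<^sub>v n \<and> vec_weight v * \<tau> \<le> 2 * \<epsilon>}"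
  have le: "kernel_moment J v \<le> \<rho> ^ vec_weight v" if v: "v \<in> ?S" for v
  proof -
    define y where "y = vec_weight v * \<tau>"
    have y: "0 \<le> y" "y \<le> 2 * \<epsilon>" using v tau_pos by (auto simp: y_def)
    have "annihilation n (column j) v \<le> exp (- ((1 - \<epsilon>) * (y / 2)))" if "j < n" for j
    proof -
      have "annihilation n (column j) v \<le> (1 + exp (- y)) / 2"
        using annihilation_le_vec_weight[OF that, of v] v by (simp add: y_def)
      also have "\<dots> \<le> exp (- (y / 2) + y\<^sup>2 / 4)" by (rule half_one_plus_exp_le[OF y(1)])
      also have "\<dots> \<le> exp (- ((1 - \<epsilon>) * (y / 2)))"
      proof -
        have "y * y \<le> y * (2 * \<epsilon>)" using y by (intro mult_left_mono)
        moreover have "- ((1 - \<epsilon>) * (y / 2)) = - (y / 2) + y * (2 * \<epsilon>) / 4" by (simp add: field_simps)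
        ultimately show ?thesis by (simp add: power2_eq_square mult_ac)
      qed
      finally show ?thesis .
    qed
    then have "kernel_moment J v \<le> exp (- ((1 - \<epsilon>) * (y / 2))) ^ card J"
      by (rule kernel_moment_le[OF J])
    also have "\<dots> = \<rho> ^ vec_weight v"
      by (simp add: \<rho>_def y_def flip: exp_of_nat_mult)
    finally show ?thesis .
  qed
  have "(\<Sum>v\<in>?S. kernel_moment J v) \<le> (\<Sum>v\<in>?S. \<rho> ^ vec_weight v)" by (rule sum_mono) (rule le)
  also have "\<dots> \<le> (\<Sum>v\<in>vectors - {0\<^sub>v n}. \<rho> ^ vec_weight v)"
    by (intro sum_mono2) (auto simp: \<rho>_def)
  also have "\<dots> = (\<Sum>v\<in>vectors. \<rho> ^ vec_weight v) - 1"
    by (simp add: sum_diff1 vec_weight_zero)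
  also have "(\<Sum>v\<in>vectors. \<rho> ^ vec_weight v) = (1 + (real CARD('a) - 1) * \<rho>) ^ n"
    by (rule sum_power_vec_weight)
  also have "\<dots> \<le> (1 + CARD('a) * \<rho>) ^ n"
    using one_less_card_field[where 'a = 'a]
    by (intro power_mono add_mono mult_right_mono) (auto simp: \<rho>_def)
  also have "\<dots> \<le> exp (n * (CARD('a) * \<rho>))" by (intro power_one_plus_le_exp) (simp add: \<rho>_def)
  finally show ?thesis by (simp add: \<rho>_def)
qed

text \<open>
Once \<open>w \<tau>\<close> is bounded away from zero, so is the probability that a single column is not orthogonal to
\<open>v\<close>.  This gives an exponentially small factor, against an exponential number of vectors with a
smaller rate.
\<close>

lemma medium_moment_le:
  fixes \<epsilon> \<zeta> x :: real
  assumes J: "J \<subseteq> {..<n}" and x: "0 < x" "x \<le> 1"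
  shows "(\<Sum>v\<in>{v \<in> vectors. 2 * \<epsilon> < vec_weight v * \<tau> \<and> vec_weight v \<le> \<zeta> * n}. kernel_moment J v)
           \<le> exp (n * (\<zeta> * ln (1 / x) + CARD('a) * x)) * ((1 + exp (- (2 * \<epsilon>))) / 2) ^ card J"
proof (rule sum_kernel_moment_le[OF _ J])
  fix v j
  assume v: "v \<in> {v \<in> vectors. 2 * \<epsilon> < vec_weight v * \<tau> \<and> vec_weight v \<le> \<zeta> * n}" and j: "j < n"
  have "annihilation n (column j) v \<le> (1 + exp (- (vec_weight v * \<tau>))) / 2"
    using annihilation_le_vec_weight[OF j] v by blast
  also have "\<dots> \<le> (1 + exp (- (2 * \<epsilon>))) / 2" using v by simp
  finally show "annihilation n (column j) v \<le> (1 + exp (- (2 * \<epsilon>))) / 2" .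
next
  have "real (card {v \<in> vectors. 2 * \<epsilon> < vec_weight v * \<tau> \<and> vec_weight v \<le> \<zeta> * n}) \<le>
        card {v \<in> vectors. vec_weight v \<le> \<zeta> * n}"
    by (intro of_nat_mono card_mono) auto
  also have "\<dots> \<le> exp (n * (\<zeta> * ln (1 / x) + CARD('a) * x))" by (rule card_low_vec_weight_le[OF x])
  finally show "real (card {v \<in> vectors. 2 * \<epsilon> < vec_weight v * \<tau> \<and> vec_weight v \<le> \<zeta> * n})
      \<le> exp (n * (\<zeta> * ln (1 / x) + CARD('a) * x))" .
qed (auto intro: add_nonneg_nonneg)

text \<open>
For weights of order \<open>n\<close> a column is orthogonal to \<open>v\<close> with probability \<open>(1 + n\<^sup>-\<^sup>g) / p\<close> for some \<open>g > 0\<close>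
that may well be less than 1.  The resulting loss \<open>exp (n\<^sup>1\<^sup>-\<^sup>g)\<close> is compensated by the exponentially small
proportion of atypical vectors.
\<close>

lemma heavy_atypical_moment_le:
  fixes \<epsilon> \<zeta> :: real
  assumes J: "J \<subseteq> {..<n}" and \<epsilon>: "0 < \<epsilon>"
  shows "(\<Sum>v\<in>{v \<in> vectors. \<not> typical \<epsilon> v \<and> \<zeta> * n < vec_weight v}. kernel_moment J v)
           \<le> n * CARD('a) * (real CARD('a) ^ n * exp (- (n * \<epsilon>\<^sup>2 / 4))) *
             ((1 + CARD('a) * exp (- (char_gap * \<tau> * (\<zeta> * n) / 2))) / CARD('a)) ^ card J"
proof (rule sum_kernel_moment_le[OF _ J])
  fix v j
  assume v: "v \<in> {v \<in> vectors. \<not> typical \<epsilon> v \<and> \<zeta> * n < vec_weight v}" and j: "j < n"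
  show "annihilation n (column j) v \<le> (1 + CARD('a) * exp (- (char_gap * \<tau> * (\<zeta> * n) / 2))) / CARD('a)"
  proof (rule annihilation_le_of_small_transform[OF _ weight[OF j]])
    show "v \<in> vectors" using v by simp
    fix t :: 'a assume t: "t \<noteq> 0"
    have "norm (char_transform n (column j) (t \<cdot>\<^sub>v v)) \<le> exp (- (decay j (t \<cdot>\<^sub>v v) / 2))"
      using v by (intro norm_char_transform_le[OF j]) auto
    also have "\<dots> \<le> exp (- (char_gap * \<tau> * (\<zeta> * n) / 2))"
    proof -
      have "char_gap * \<tau> * (\<zeta> * n) \<le> char_gap * \<tau> * vec_weight v"
        using v char_gap_pos tau_pos by (intro mult_left_mono) auto
      also have "\<dots> \<le> decay j (t \<cdot>\<^sub>v v)" using v by (intro vec_weight_decay[OF j _ t]) auto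
      finally show ?thesis by simp
    qed
    finally show "norm (char_transform n (column j) (t \<cdot>\<^sub>v v)) \<le> exp (- (char_gap * \<tau> * (\<zeta> * n) / 2))" .
  qed simp
next
  have "real (card {v \<in> vectors. \<not> typical \<epsilon> v \<and> \<zeta> * n < vec_weight v}) \<le>
        card {v \<in> vectors. \<not> typical \<epsilon> v}"
    by (intro of_nat_mono card_mono) auto
  also have "\<dots> \<le> n * CARD('a) * (real CARD('a) ^ n * exp (- (n * \<epsilon>\<^sup>2 / 4)))"
    by (rule card_atypical_le[OF \<epsilon>])
  finally show "real (card {v \<in> vectors. \<not> typical \<epsilon> v \<and> \<zeta> * n < vec_weight v}) \<le>
    n * CARD('a) * (real CARD('a) ^ n * exp (- (n * \<epsilon>\<^sup>2 / 4)))" .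
qed (auto intro!: divide_nonneg_nonneg add_nonneg_nonneg)

lemma typical_transform_le:
  fixes \<epsilon> :: real
  assumes j: "j < n" and v: "v \<in> vectors" "typical \<epsilon> v" and t: "t \<noteq> 0"
  shows "norm (char_transform n (column j) (t \<cdot>\<^sub>v v)) \<le> exp (- ((1 - \<epsilon>) * n * \<tau> / 2))"
proof -
  have "norm (char_transform n (column j) (t \<cdot>\<^sub>v v)) \<le> exp (- (decay j (t \<cdot>\<^sub>v v) / 2))"
    using v by (intro norm_char_transform_le[OF j]) auto
  also have "\<dots> \<le> exp (- ((1 - \<epsilon>) * n * \<tau> / 2))"
    using v t j by (auto simp: typical_def)
  finally show ?thesis .
qed

lemma typical_moment_le:
  fixes \<epsilon> :: real
  assumes J: "J \<subseteq> {..<n}"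
  shows "(\<Sum>v\<in>{v \<in> vectors. typical \<epsilon> v}. kernel_moment J v)
           \<le> real CARD('a) ^ n * ((1 + CARD('a) * exp (- ((1 - \<epsilon>) * n * \<tau> / 2))) / CARD('a)) ^ card J"
proof (rule sum_kernel_moment_le[OF _ J])
  fix v j
  assume v: "v \<in> {v \<in> vectors. typical \<epsilon> v}" and j: "j < n"
  show "annihilation n (column j) v \<le> (1 + CARD('a) * exp (- ((1 - \<epsilon>) * n * \<tau> / 2))) / CARD('a)"
    using v typical_transform_le[OF j]
    by (intro annihilation_le_of_small_transform[OF _ weight[OF j]]) auto
next
  have "card {v \<in> vectors. typical \<epsilon> v} \<le> card vectors" by (intro card_mono) auto
  also have "\<dots> = CARD('a) ^ n" by (rule card_carrier_vec)
  finally show "real (card {v \<in> vectors. typical \<epsilon> v}) \<le> real CARD('a) ^ n"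
    by (metis of_nat_mono of_nat_power)
qed (auto intro!: divide_nonneg_nonneg add_nonneg_nonneg)

text \<open>
The sum of the bounds for vectors of light, medium and heavy weight.
\<close>

definition atypical_bound :: "nat \<Rightarrow> real \<Rightarrow> real \<Rightarrow> real \<Rightarrow> real" where
  "atypical_bound m \<epsilon> \<zeta> x =
     (exp (real n * (real CARD('a) * exp (- ((1 - \<epsilon>) * \<tau> / 2 * real m)))) - 1) +
     exp (real n * (\<zeta> * ln (1 / x) + real CARD('a) * x)) * ((1 + exp (- (2 * \<epsilon>))) / 2) ^ m +
     real n * real CARD('a) * (real CARD('a) ^ n * exp (- (real n * \<epsilon>\<^sup>2 / 4))) *
             ((1 + real CARD('a) * exp (- (char_gap * \<tau> * (\<zeta> * real n) / 2))) / real CARD('a)) ^ m"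

definition typical_bound :: "nat \<Rightarrow> real \<Rightarrow> real" where
  "typical_bound m \<epsilon> =
     real CARD('a) ^ n * ((1 + real CARD('a) * exp (- ((1 - \<epsilon>) * real n * \<tau> / 2))) / real CARD('a)) ^ m"

lemma atypical_moment_le:
  fixes \<epsilon> \<zeta> x :: real
  assumes J: "J \<subseteq> {..<n}" and \<epsilon>: "0 < \<epsilon>" "\<epsilon> < 1" and x: "0 < x" "x \<le> 1"
  shows "(\<Sum>v\<in>{v \<in> vectors. v \<noteq> 0\<^sub>v n \<and> \<not> typical \<epsilon> v}. kernel_moment J v) \<le> atypical_bound (card J) \<epsilon> \<zeta> x"
proof -
  let ?A = "{v \<in> vectors. v \<noteq> 0\<^sub>v n \<and> vec_weight v * \<tau> \<le> 2 * \<epsilon>}"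
  let ?B = "{v \<in> vectors. 2 * \<epsilon> < vec_weight v * \<tau> \<and> vec_weight v \<le> \<zeta> * n}"
  let ?C = "{v \<in> vectors. \<not> typical \<epsilon> v \<and> \<zeta> * n < vec_weight v}"
  have fin: "finite {v \<in> vectors. P v}" for P by (rule finite_subset[OF _ finite_carrier_vec]) auto
  have nn: "0 \<le> kernel_moment J v" for v by (rule kernel_moment_nonneg[OF J])
  have "(\<Sum>v\<in>{v \<in> vectors. v \<noteq> 0\<^sub>v n \<and> \<not> typical \<epsilon> v}. kernel_moment J v)
      \<le> (\<Sum>v\<in>(?A \<union> ?B) \<union> ?C. kernel_moment J v)"
    using fin nn by (intro sum_mono2) auto
  also have "\<dots> \<le> (\<Sum>v\<in>?A \<union> ?B. kernel_moment J v) + (\<Sum>v\<in>?C. kernel_moment J v)"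
    using fin nn by (intro sum_Un_le_add) auto
  also have "(\<Sum>v\<in>?A \<union> ?B. kernel_moment J v) \<le> (\<Sum>v\<in>?A. kernel_moment J v) + (\<Sum>v\<in>?B. kernel_moment J v)"
    using fin nn by (intro sum_Un_le_add) auto
  finally show ?thesis
    using light_moment_le[OF J \<epsilon>] medium_moment_le[OF J x, of \<epsilon> \<zeta>] heavy_atypical_moment_le[OF J \<epsilon>(1), of \<zeta>]
    unfolding atypical_bound_def of_nat_mult by linarith
qed

text \<open>
After the first \<open>n - s\<close> exposed columns the left kernel \<open>K\<close> has dimension at least \<open>s\<close>.  If \<open>K\<close> has
dimension exactly \<open>s\<close> and no nonzero atypical vector, the remaining columns follow the chain up to
\<open>s \<theta>\<close>.  The failure of the second condition is bounded by the number of atypical vectors in \<open>K\<close>, and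
that of the first, as in Markov's inequality, by \<open>(|K| - p\<^sup>s) / (p\<^sup>s\<^sup>+\<^sup>1 - p\<^sup>s)\<close>; the expectations of both are
first moments.
\<close>

theorem corank_near_chain:
  fixes \<epsilon> \<zeta> x :: real
  assumes s: "s \<le> n" and \<epsilon>: "0 < \<epsilon>" "\<epsilon> < 1" and x: "0 < x" "x \<le> 1"
  defines "p \<equiv> real CARD('a)"
  shows "\<bar>expose n column n (\<lambda>K. if card K = CARD('a) ^ k then 1 else 0) vectors
            - corank_chain (1 / p) k s s\<bar>
         \<le> atypical_bound (n - s) \<epsilon> \<zeta> x
           + (1 + atypical_bound (n - s) \<epsilon> \<zeta> x + typical_bound (n - s) \<epsilon> - p ^ s) / (p ^ s * (p - 1))
           + s * exp (- ((1 - \<epsilon>) * n * \<tau> / 2))"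
proof -
  define m where "m = n - s"
  have n: "n = s + m" using s by (simp add: m_def)
  define \<theta> where "\<theta> = exp (- ((1 - \<epsilon>) * n * \<tau> / 2))"
  let ?g = "\<lambda>K :: 'a vec set. if card K = CARD('a) ^ k then 1 else (0 :: real)"
  let ?c = "corank_chain (1 / p) k s s"
  define W where "W j = column (s + j)" for j
  define J where "J = {s..<n}"
  have J: "J \<subseteq> {..<n}" "card J = m" by (auto simp: J_def m_def)
  have p: "p > 1" using one_less_card_field[where 'a = 'a] by (simp add: p_def)
  have W: "prob_weight n (W j)" if "j < m" for j
    using weight[of "s + j"] that by (simp add: W_def n)
  have moment: "expose n W m (\<lambda>L. \<Sum>v\<in>L. f v) vectors = (\<Sum>v\<in>vectors. f v * kernel_moment J v)" for f
  proof -
    have "(\<Prod>j<m. annihilation n (W j) v) = kernel_moment J v" for v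
      unfolding kernel_moment_def W_def J_def
      by (rule prod.reindex_bij_witness[of _ "\<lambda>j. j - s" "\<lambda>j. s + j"]) (auto simp: m_def)
    then show ?thesis by (simp add: expose_sum)
  qed
  define bad where "bad v = (if v \<noteq> 0\<^sub>v n \<and> \<not> typical \<epsilon> v then 1 else (0 :: real))" for v
  \<comment> \<open>The smallest possible excess of \<open>|K|\<close> over \<open>p\<^sup>s\<close> if the dimension of \<open>K\<close> exceeds \<open>s\<close>.\<close>
  define D where "D = p ^ s * (p - 1)"
  have D: "D > 0" using p by (simp add: D_def)
  \<comment> \<open>The three errors, arranged as a sum over the vectors of \<open>L\<close> and a constant, the form whose expectation \<open>expose_sum\<close> computes.\<close>
  define h where "h L = (\<Sum>v\<in>L. bad v + 1 / D) + (- (p ^ s / D) + s * \<theta>)" for L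
  have "expose n column n ?g vectors = expose n W m (expose n column s ?g) vectors"
    using expose_add[of n column s m ?g vectors] s by (simp add: W_def[abs_def] m_def)
  then have "\<bar>expose n column n ?g vectors - ?c\<bar> \<le> expose n W m (\<lambda>L. \<bar>expose n column s ?g L - ?c\<bar>) vectors"
    using expose_abs_diff[OF W] by simp
  also have "\<dots> \<le> expose n W m h vectors"
  proof (rule expose_mono[where s = s and d = n])
    show "prob_weight n (W j)" if "j < m" for j by (rule W[OF that])
    show "linear_set n vectors" by (rule linear_set_carrier)
    show "card vectors = CARD('a) ^ n" by (rule card_carrier_vec)
    show "s + m \<le> n" by (simp add: n)
    fix L :: "'a vec set" and d
    assume L: "linear_set n L" "card L = CARD('a) ^ d" and d: "s \<le> d"
    have finL: "finite L" by (rule linear_set_finite[OF L(1)])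
    have cardL: "real (card L) = p ^ d" using L(2) by (simp add: p_def)
    have h: "h L = (\<Sum>v\<in>L. bad v) + (p ^ d - p ^ s) / D + s * \<theta>"
      unfolding h_def using cardL by (simp add: sum.distrib diff_divide_distrib)
    have nonneg: "0 \<le> (\<Sum>v\<in>L. bad v)" "0 \<le> (p ^ d - p ^ s) / D" "0 \<le> s * \<theta>"
      using d p D by (auto simp: bad_def \<theta>_def intro!: sum_nonneg divide_nonneg_pos power_increasing)
    have c01: "0 \<le> ?c" "?c \<le> 1"
      using corank_chain_bounds[of "1 / p" k s s] p by auto
    have E01: "0 \<le> expose n column s ?g L" "expose n column s ?g L \<le> 1"
    proof -
      have w: "prob_weight n (column j)" if "j < s" for j using weight that s by simp
      show "0 \<le> expose n column s ?g L"
        using expose_mono[of s n column 0 "\<lambda>_. 0" ?g L d] w L d expose_const[of s n column 0 L] by auto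
      show "expose n column s ?g L \<le> 1"
        using expose_mono[of s n column 0 ?g "\<lambda>_. 1" L d] w L d expose_const[of s n column 1 L] by auto
    qed
    show "\<bar>expose n column s ?g L - ?c\<bar> \<le> h L"
    proof (cases "(\<exists>v\<in>L. bad v = 1) \<or> d > s")
      case True
      have "1 \<le> h L"
      proof (cases "d > s")
        case True
        then have "p ^ Suc s \<le> p ^ d" using p by (intro power_increasing) auto
        then have "D \<le> p ^ d - p ^ s" by (simp add: D_def algebra_simps)
        then have "1 \<le> (p ^ d - p ^ s) / D" using D by simp
        then show ?thesis using h nonneg by linarith
      next
        case False
        then obtain v where v: "v \<in> L" "bad v = 1" using True by blast
        then have "1 \<le> (\<Sum>v\<in>L. bad v)"
          using member_le_sum[of v L bad] finL by (auto simp: bad_def)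
        then show ?thesis using h nonneg by linarith
      qed
      then show ?thesis using c01 E01 by linarith
    next
      case False
      then have ds: "d = s" and good: "\<And>v. v \<in> L \<Longrightarrow> v \<noteq> 0\<^sub>v n \<Longrightarrow> typical \<epsilon> v"
        using d by (auto simp: bad_def split: if_splits)
      have "\<bar>expose n column s ?g L - corank_chain (1 / real CARD('a)) k s s\<bar> \<le> s * \<theta>"
      proof (rule expose_near_corank_chain)
        show "prob_weight n (column j)" if "j < s" for j using weight that s by simp
        show "norm (char_transform n (column j) v) \<le> \<theta>" if "j < s" "v \<in> L" "v \<noteq> 0\<^sub>v n" for j v
        proof -
          have v: "v \<in> vectors" using that L(1) by (auto simp: linear_set_def)
          show ?thesis using typical_transform_le[of j v \<epsilon> 1] v good[OF that(2,3)] that s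
            by (simp add: \<theta>_def)
        qed
      qed (use L ds in \<open>auto simp: \<theta>_def\<close>)
      then show ?thesis using h nonneg by (simp add: p_def)
    qed
  qed
  also have "expose n W m h vectors =
     (\<Sum>v\<in>vectors. (bad v + 1 / D) * kernel_moment J v) + (- (p ^ s / D) + s * \<theta>)"
  proof -
    have "h = (\<lambda>L. 1 * (\<Sum>v\<in>L. bad v + 1 / D) + (- (p ^ s / D) + s * \<theta>))"
      by (simp add: h_def fun_eq_iff)
    then have "expose n W m h vectors = 1 * expose n W m (\<lambda>L. \<Sum>v\<in>L. bad v + 1 / D) vectors +
        expose n W m (\<lambda>_. - (p ^ s / D) + s * \<theta>) vectors"
      by (simp only: expose_cmult_add)
    moreover have "expose n W m (\<lambda>_. c) vectors = c" for c
      by (rule expose_const) (rule W)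
    ultimately show ?thesis by (simp only: moment mult_1)
  qed
  also have "(\<Sum>v\<in>vectors. (bad v + 1 / D) * kernel_moment J v) =
      (\<Sum>v\<in>vectors. bad v * kernel_moment J v) + (\<Sum>v\<in>vectors. kernel_moment J v) / D"
    by (simp add: distrib_right sum.distrib flip: sum_divide_distrib)
  also have "(\<Sum>v\<in>vectors. bad v * kernel_moment J v) =
      (\<Sum>v\<in>{v \<in> vectors. v \<noteq> 0\<^sub>v n \<and> \<not> typical \<epsilon> v}. kernel_moment J v)"
    by (subst sum.inter_filter) (auto simp: bad_def intro!: sum.cong)
  finally have main: "\<bar>expose n column n ?g vectors - ?c\<bar> \<le>
      (\<Sum>v\<in>{v \<in> vectors. v \<noteq> 0\<^sub>v n \<and> \<not> typical \<epsilon> v}. kernel_moment J v) +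
      (\<Sum>v\<in>vectors. kernel_moment J v) / D + (- (p ^ s / D) + s * \<theta>)" .
  have b: "(\<Sum>v\<in>{v \<in> vectors. v \<noteq> 0\<^sub>v n \<and> \<not> typical \<epsilon> v}. kernel_moment J v) \<le> atypical_bound m \<epsilon> \<zeta> x"
    using atypical_moment_le[OF J(1) \<epsilon> x] J(2) by simp
  have t: "(\<Sum>v\<in>{v \<in> vectors. typical \<epsilon> v}. kernel_moment J v) \<le> typical_bound m \<epsilon>"
    using typical_moment_le[OF J(1)] J(2) by (simp add: typical_bound_def)
  have z: "kernel_moment J (0\<^sub>v n) \<le> 1"
    unfolding kernel_moment_def using J annihilation_nonneg[OF weight] annihilation_le_1[OF weight]
    by (intro prod_le_1) auto
  have fin: "finite {v \<in> vectors. P v}" for P by (rule finite_subset[OF _ finite_carrier_vec]) auto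
  have nn: "0 \<le> kernel_moment J v" for v by (rule kernel_moment_nonneg[OF J(1)])
  let ?A = "{v \<in> vectors. v \<noteq> 0\<^sub>v n \<and> \<not> typical \<epsilon> v}" and ?T = "{v \<in> vectors. typical \<epsilon> v}"
  have "(\<Sum>v\<in>vectors. kernel_moment J v) \<le> (\<Sum>v\<in>({0\<^sub>v n} \<union> ?A) \<union> ?T. kernel_moment J v)"
    using fin nn by (intro sum_mono2) auto
  also have "\<dots> \<le> (\<Sum>v\<in>{0\<^sub>v n} \<union> ?A. kernel_moment J v) + (\<Sum>v\<in>?T. kernel_moment J v)"
    using fin nn by (intro sum_Un_le_add) auto
  also have "(\<Sum>v\<in>{0\<^sub>v n} \<union> ?A. kernel_moment J v) \<le> (\<Sum>v\<in>{0\<^sub>v n}. kernel_moment J v) + (\<Sum>v\<in>?A. kernel_moment J v)"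
    using fin nn by (intro sum_Un_le_add) auto
  finally have "(\<Sum>v\<in>vectors. kernel_moment J v) \<le> 1 + atypical_bound m \<epsilon> \<zeta> x + typical_bound m \<epsilon>"
    using b t z by simp
  then have "(\<Sum>v\<in>vectors. kernel_moment J v) / D \<le> (1 + atypical_bound m \<epsilon> \<zeta> x + typical_bound m \<epsilon>) / D"
    using D by (intro divide_right_mono) auto
  with main b have "\<bar>expose n column n ?g vectors - ?c\<bar> \<le> atypical_bound m \<epsilon> \<zeta> x +
      ((1 + atypical_bound m \<epsilon> \<zeta> x + typical_bound m \<epsilon>) / D - p ^ s / D) + s * \<theta>"
    by linarith
  then show ?thesis by (simp add: D_def m_def \<theta>_def diff_divide_distrib)
qed

end

section \<open>Asymptotics of the error terms\<close>

text \<open>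
The parameter \<open>\<tau> = 2 \<alpha> (1 - \<alpha>)\<close> for \<open>\<alpha> = c ln n / n\<close>, by \<open>collision_le\<close> a lower bound for the
probability that two independent copies of an entry differ, as soon as \<open>\<alpha> \<le> 1/2\<close>.
\<close>

definition noncollision_rate :: "real \<Rightarrow> nat \<Rightarrow> real" where
  "noncollision_rate c n = 2 * (c * ln n / n) * (1 - c * ln n / n)"

text \<open>
Half of the rate times \<open>n\<close> is asymptotic to \<open>c ln n\<close>.
\<close>

lemma noncollision_rate_ge:
  fixes b c \<epsilon> :: real and s :: nat
  assumes "b < (1 - \<epsilon>) * c"
  shows "eventually (\<lambda>n. b * ln (real n) \<le> (1 - \<epsilon>) * noncollision_rate c n / 2 * real (n - s)) sequentially"
proof -
  have "(\<lambda>n. (c * ln (real n) / n) * (1 - c * ln (real n) / n) * (real n - real s) / ln (real n)) \<longlonglongrightarrow> c"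
    by real_asymp
  then have "(\<lambda>n. (1 - \<epsilon>) * ((c * ln (real n) / n) * (1 - c * ln (real n) / n) * (real n - real s) / ln (real n)))
     \<longlonglongrightarrow> (1 - \<epsilon>) * c"
    by (intro tendsto_intros)
  then have "eventually (\<lambda>n. b < (1 - \<epsilon>) * ((c * ln (real n) / n) * (1 - c * ln (real n) / n) * (real n - real s) / ln (real n))) sequentially"
    by (rule order_tendstoD(1)) (rule assms)
  then show ?thesis using eventually_ge_at_top[of s] eventually_gt_at_top[of 1]
  proof eventually_elim
    case (elim n)
    have ln: "ln (real n) > 0" using elim by simp
    have "b * ln (real n) \<le> (1 - \<epsilon>) * ((c * ln (real n) / n) * (1 - c * ln (real n) / n) * (real n - real s) / ln (real n)) * ln (real n)"
      using elim ln by (intro mult_right_mono) auto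
    also have "\<dots> = (1 - \<epsilon>) * noncollision_rate c n / 2 * real (n - s)"
      using elim ln by (simp add: noncollision_rate_def of_nat_diff)
    finally show ?case .
  qed
qed

text \<open>
The parameters are chosen in the order \<open>\<epsilon>\<close>, \<open>x\<close>, \<open>\<zeta>\<close>: the first so that \<open>(1 - \<epsilon>) c > 1\<close>, the others so
that the number of vectors of weight at most \<open>\<zeta>n\<close> grows at half the exponential rate \<open>\<eta>\<close> at which a
vector of medium weight is eliminated.
\<close>

lemma error_terms_vanish:
  fixes p c \<kappa> :: real and s :: nat
  assumes p: "p > 1" and c: "c > 1" and \<kappa>: "\<kappa> > 0"
  shows "\<exists>\<epsilon> \<zeta> x. 0 < \<epsilon> \<and> \<epsilon> < 1 \<and> 0 < x \<and> x \<le> 1 \<and>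
    (\<lambda>n. (exp (real n * (p * exp (- ((1 - \<epsilon>) * noncollision_rate c n / 2 * real (n - s))))) - 1) +
     exp (real n * (\<zeta> * ln (1 / x) + p * x)) * ((1 + exp (- (2 * \<epsilon>))) / 2) ^ (n - s) +
     real n * p * (p ^ n * exp (- (real n * \<epsilon>\<^sup>2 / 4))) *
             ((1 + p * exp (- (\<kappa> * noncollision_rate c n * (\<zeta> * real n) / 2))) / p) ^ (n - s)) \<longlonglongrightarrow> 0 \<and>
    (\<lambda>n. p ^ n * ((1 + p * exp (- ((1 - \<epsilon>) * real n * noncollision_rate c n / 2))) / p) ^ (n - s)) \<longlonglongrightarrow> p ^ s \<and>
    (\<lambda>n. exp (- ((1 - \<epsilon>) * real n * noncollision_rate c n / 2))) \<longlonglongrightarrow> 0"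
proof -
  define \<epsilon> where "\<epsilon> = (c - 1) / (2 * c)"
  \<comment> \<open>With this choice \<open>(1 - \<epsilon>) c = (c + 1) / 2\<close>, and \<open>b\<close> is the midpoint between it and 1.\<close>
  define b where "b = (c + 3) / 4"
  have \<epsilon>: "0 < \<epsilon>" "\<epsilon> < 1" using c by (auto simp: \<epsilon>_def field_simps)
  have b: "1 < b" "b < (1 - \<epsilon>) * c" using c by (auto simp: b_def \<epsilon>_def field_simps)
  define \<eta> where "\<eta> = - ln ((1 + exp (- (2 * \<epsilon>))) / 2)"
  have \<eta>: "0 < \<eta>" "(1 + exp (- (2 * \<epsilon>))) / 2 = exp (- \<eta>)"
    using \<epsilon> by (auto simp: \<eta>_def add_pos_pos)
  \<comment> \<open>The growth rate \<open>\<zeta> ln (1 / x) + p x\<close> of the number of vectors of weight at most \<open>\<zeta>n\<close> is split evenly between its two terms.\<close>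
  define x where "x = min 1 (\<eta> / (4 * p))"
  have x: "0 < x" "x \<le> 1" "p * x \<le> \<eta> / 4"
    using \<eta> p by (auto simp: x_def min_def field_simps)
  have lnx: "0 \<le> ln (1 / x)" using x by simp
  define \<zeta> where "\<zeta> = \<eta> / (4 * (1 + ln (1 / x)))"
  have \<zeta>: "0 < \<zeta>" using \<eta> lnx by (auto simp: \<zeta>_def)
  have \<zeta>x: "\<zeta> * ln (1 / x) \<le> \<eta> / 4"
  proof -
    have "\<zeta> * ln (1 / x) \<le> \<zeta> * (1 + ln (1 / x))" using \<zeta> by (intro mult_left_mono) auto
    also have "\<dots> = \<eta> / 4"
    proof -
      have "\<eta> / (4 * d) * d = \<eta> / 4" if "d \<noteq> 0" for d using that by simp
      from this[of "1 + ln (1 / x)"] show ?thesis using lnx by (simp only: \<zeta>_def)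
    qed
    finally show ?thesis .
  qed
  define g where "g = \<kappa> * \<zeta>"
  have g: "0 < g" using \<kappa> \<zeta> by (simp add: g_def)
  define \<theta> where "\<theta> n = exp (- ((1 - \<epsilon>) * real n * noncollision_rate c n / 2))" for n
  have ev0: "eventually (\<lambda>n. 1 \<le> n \<and> s \<le> n) sequentially"
    by (rule eventually_conj) (rule eventually_ge_at_top)+
  have ev1: "eventually (\<lambda>n. exp (- ((1 - \<epsilon>) * noncollision_rate c n / 2 * real (n - s))) \<le> exp (- (b * ln (real n)))) sequentially"
    using noncollision_rate_ge[OF b(2), of s] by eventually_elim simp
  have ev2: "eventually (\<lambda>n. \<theta> n \<le> exp (- (b * ln (real n)))) sequentially"
    using noncollision_rate_ge[OF b(2), of 0] by eventually_elim (simp add: \<theta>_def mult_ac)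
  have ev3: "eventually (\<lambda>n. exp (- (\<kappa> * noncollision_rate c n * (\<zeta> * real n) / 2)) \<le> exp (- (g * ln (real n)))) sequentially"
  proof -
    have "1 < (1 - 0) * c" using c by simp
    from noncollision_rate_ge[OF this, of 0] show ?thesis
    proof eventually_elim
      case (elim n)
      then have "ln (real n) \<le> noncollision_rate c n / 2 * real n" by simp
      then have "g * ln (real n) \<le> g * (noncollision_rate c n / 2 * real n)" using g by (intro mult_left_mono) auto
      then show ?case by (simp add: g_def mult_ac)
    qed
  qed
  have T1: "(\<lambda>n. exp (real n * (p * exp (- ((1 - \<epsilon>) * noncollision_rate c n / 2 * real (n - s))))) - 1) \<longlonglongrightarrow> 0"
  proof (rule tendsto_sandwich[OF _ _ tendsto_const])
    show "(\<lambda>n. exp (real n * (p * exp (- (b * ln (real n))))) - 1) \<longlonglongrightarrow> 0"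
      using b p by real_asymp
    show "eventually (\<lambda>n. exp (real n * (p * exp (- ((1 - \<epsilon>) * noncollision_rate c n / 2 * real (n - s))))) - 1
       \<le> exp (real n * (p * exp (- (b * ln (real n))))) - 1) sequentially"
      using ev1 by eventually_elim (use p in \<open>simp add: mult_left_mono\<close>)
  qed (use p in \<open>auto intro!: always_eventually\<close>)
  have T2: "(\<lambda>n. exp (real n * (\<zeta> * ln (1 / x) + p * x)) * ((1 + exp (- (2 * \<epsilon>))) / 2) ^ (n - s)) \<longlonglongrightarrow> 0"
  proof (rule tendsto_sandwich[OF _ _ tendsto_const])
    show "(\<lambda>n. exp (\<eta> * s - real n * (\<eta> / 2))) \<longlonglongrightarrow> 0"
      using \<eta>(1) by real_asymp
    show "eventually (\<lambda>n. exp (real n * (\<zeta> * ln (1 / x) + p * x)) * ((1 + exp (- (2 * \<epsilon>))) / 2) ^ (n - s)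
        \<le> exp (\<eta> * s - real n * (\<eta> / 2))) sequentially"
      using ev0
    proof eventually_elim
      case (elim n)
      have "real n * (\<zeta> * ln (1 / x) + p * x) \<le> real n * (\<eta> / 2)"
        using \<zeta>x x(3) by (intro mult_left_mono) auto
      then have "exp (real n * (\<zeta> * ln (1 / x) + p * x)) * exp (- \<eta>) ^ (n - s)
          \<le> exp (real n * (\<eta> / 2)) * exp (- \<eta>) ^ (n - s)" by (intro mult_right_mono) auto
      also have "\<dots> = exp (real n * (\<eta> / 2) + real (n - s) * (- \<eta>))"
        unfolding exp_add exp_of_nat_mult by simp
      also have "real n * (\<eta> / 2) + real (n - s) * (- \<eta>) = \<eta> * s - real n * (\<eta> / 2)"
        using elim by (simp add: of_nat_diff algebra_simps)
      finally show ?case by (simp add: \<eta>(2))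
    qed
  qed (auto intro!: always_eventually)
  have cancel: "p ^ n * (y / p) ^ (n - s) = p ^ s * y ^ (n - s)" if "s \<le> n" for y and n
  proof -
    have "p ^ n = p ^ s * p ^ (n - s)" using that by (simp flip: power_add)
    then show ?thesis using p by (simp add: power_divide)
  qed
  have T3: "(\<lambda>n. real n * p * (p ^ n * exp (- (real n * \<epsilon>\<^sup>2 / 4))) *
             ((1 + p * exp (- (\<kappa> * noncollision_rate c n * (\<zeta> * real n) / 2))) / p) ^ (n - s)) \<longlonglongrightarrow> 0"
  proof (rule tendsto_sandwich[OF _ _ tendsto_const])
    define e4 where "e4 = \<epsilon>\<^sup>2 / 4"
    have e4: "e4 > 0" using \<epsilon> by (simp add: e4_def)
    have "(\<lambda>n. real n * exp (- (real n * e4) + real n * (p * exp (- (g * ln (real n)))))) \<longlonglongrightarrow> 0"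
      using e4 g p by real_asymp
    then have "(\<lambda>n. p * p ^ s * (real n * exp (- (real n * e4) + real n * (p * exp (- (g * ln (real n))))))) \<longlonglongrightarrow> p * p ^ s * 0"
      by (intro tendsto_intros)
    then show "(\<lambda>n. p * p ^ s * (real n * exp (- (real n * e4) + real n * (p * exp (- (g * ln (real n))))))) \<longlonglongrightarrow> 0"
      by simp
    show "eventually (\<lambda>n. real n * p * (p ^ n * exp (- (real n * \<epsilon>\<^sup>2 / 4))) *
             ((1 + p * exp (- (\<kappa> * noncollision_rate c n * (\<zeta> * real n) / 2))) / p) ^ (n - s)
        \<le> p * p ^ s * (real n * exp (- (real n * e4) + real n * (p * exp (- (g * ln (real n))))))) sequentially"
      using ev0 ev3
    proof eventually_elim
      case (elim n)
      let ?y = "1 + p * exp (- (\<kappa> * noncollision_rate c n * (\<zeta> * real n) / 2))"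
      have "?y ^ (n - s) \<le> ?y ^ n" using p by (intro power_increasing) auto
      also have "\<dots> \<le> (1 + p * exp (- (g * ln (real n)))) ^ n"
        using elim p by (intro power_mono add_mono mult_left_mono) (auto intro: add_nonneg_nonneg)
      also have "\<dots> \<le> exp (real n * (p * exp (- (g * ln (real n)))))"
        using p by (intro power_one_plus_le_exp) auto
      finally have y: "?y ^ (n - s) \<le> exp (real n * (p * exp (- (g * ln (real n)))))" .
      have "real n * p * (p ^ n * exp (- (real n * \<epsilon>\<^sup>2 / 4))) * (?y / p) ^ (n - s) =
          p * p ^ s * (real n * (exp (- (real n * e4)) * ?y ^ (n - s)))"
        using cancel[of n ?y] elim by (simp add: e4_def mult_ac)
      also have "\<dots> \<le> p * p ^ s * (real n * (exp (- (real n * e4)) * exp (real n * (p * exp (- (g * ln (real n)))))))"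
        using y p by (intro mult_left_mono) auto
      finally show ?case by (simp only: exp_add)
    qed
  qed (use p in \<open>auto intro!: always_eventually mult_nonneg_nonneg zero_le_power divide_nonneg_nonneg add_nonneg_nonneg\<close>)
  have T4: "(\<lambda>n. p ^ n * ((1 + p * \<theta> n) / p) ^ (n - s)) \<longlonglongrightarrow> p ^ s"
  proof (rule tendsto_sandwich[OF _ _ tendsto_const])
    have "(\<lambda>n. exp (real n * (p * exp (- (b * ln (real n)))))) \<longlonglongrightarrow> 1"
      using b p by real_asymp
    then have "(\<lambda>n. p ^ s * exp (real n * (p * exp (- (b * ln (real n)))))) \<longlonglongrightarrow> p ^ s * 1"
      by (intro tendsto_intros)
    then show "(\<lambda>n. p ^ s * exp (real n * (p * exp (- (b * ln (real n)))))) \<longlonglongrightarrow> p ^ s" by simp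
    show "eventually (\<lambda>n. p ^ s \<le> p ^ n * ((1 + p * \<theta> n) / p) ^ (n - s)) sequentially"
      using ev0
    proof eventually_elim
      case (elim n)
      have "1 \<le> (1 + p * \<theta> n) ^ (n - s)" using p by (intro one_le_power) (simp add: \<theta>_def)
      then show ?case using cancel[of n "1 + p * \<theta> n"] elim p by simp
    qed
    show "eventually (\<lambda>n. p ^ n * ((1 + p * \<theta> n) / p) ^ (n - s) \<le> p ^ s * exp (real n * (p * exp (- (b * ln (real n)))))) sequentially"
      using ev0 ev2
    proof eventually_elim
      case (elim n)
      have "(1 + p * \<theta> n) ^ (n - s) \<le> (1 + p * \<theta> n) ^ n"
        using p by (intro power_increasing) (auto simp: \<theta>_def)
      also have "\<dots> \<le> (1 + p * exp (- (b * ln (real n)))) ^ n"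
        using elim p by (intro power_mono add_mono mult_left_mono) (auto simp: \<theta>_def intro: add_nonneg_nonneg)
      also have "\<dots> \<le> exp (real n * (p * exp (- (b * ln (real n)))))"
        using p by (intro power_one_plus_le_exp) auto
      finally show ?case using cancel[of n "1 + p * \<theta> n"] elim p by (simp add: mult_left_mono)
    qed
  qed
  have T5: "\<theta> \<longlonglongrightarrow> 0"
  proof (rule tendsto_sandwich[OF _ ev2 tendsto_const])
    show "(\<lambda>n. exp (- (b * ln (real n)))) \<longlonglongrightarrow> 0" using b by real_asymp
  qed (auto intro!: always_eventually simp: \<theta>_def)
  show ?thesis
    using \<epsilon> x(1,2) tendsto_add[OF tendsto_add[OF T1 T2] T3] T4 T5 unfolding \<theta>_def
    by (intro exI[of _ \<epsilon>] exI[of _ \<zeta>] exI[of _ x] conjI) simp_all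
qed

section \<open>Left kernel, rank and cokernel\<close>

definition left_kernel :: "nat \<Rightarrow> 'a :: field mat \<Rightarrow> 'a vec set" where
  "left_kernel n B = {v \<in> carrier_vec n. \<forall>j<n. scalar_prod v (col B j) = 0}"

definition annihilator :: "nat \<Rightarrow> 'a :: field vec set \<Rightarrow> 'a vec set" where
  "annihilator n I = {v \<in> carrier_vec n. \<forall>y\<in>I. scalar_prod v y = 0}"

text \<open>
Both sides come from summing \<open>e (y \<bullet> v)\<close> over \<open>y \<in> I\<close> and all \<open>v\<close>, once in each order.
\<close>

lemma (in additive_character) card_annihilator:
  fixes I :: "'a vec set"
  assumes I: "linear_set n I"
  shows "card I * card (annihilator n I) = CARD('a) ^ n"
proof -
  let ?V = "carrier_vec n :: 'a vec set"
  have sub: "I \<subseteq> ?V" and 0: "0\<^sub>v n \<in> I" using I by (auto simp: linear_set_def)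
  have fin: "finite I" by (rule linear_set_finite[OF I])
  have "(\<Sum>v\<in>?V. \<Sum>y\<in>I. e (scalar_prod y v)) = (\<Sum>v\<in>?V. if v \<in> annihilator n I then of_nat (card I) else 0)"
  proof (intro sum.cong refl)
    fix v assume v: "v \<in> ?V"
    have "scalar_prod y v = scalar_prod v y" if "y \<in> I" for y
      using that sub v by (intro comm_scalar_prod[of _ n]) auto
    moreover have "perp I v = I \<longleftrightarrow> (\<forall>y\<in>I. scalar_prod y v = 0)" by (auto simp: perp_def)
    ultimately have "perp I v = I \<longleftrightarrow> v \<in> annihilator n I" using v by (simp add: annihilator_def)
    then show "(\<Sum>y\<in>I. e (scalar_prod y v)) = (if v \<in> annihilator n I then of_nat (card I) else 0)"
      by (simp add: sum_char_linear_set[OF I v])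
  qed
  also have "\<dots> = of_nat (card (annihilator n I)) * of_nat (card I)"
    by (simp add: sum.If_cases annihilator_def Int_def)
  finally have 1: "(\<Sum>v\<in>?V. \<Sum>y\<in>I. e (scalar_prod y v)) = of_nat (card (annihilator n I)) * of_nat (card I)" .
  have "(\<Sum>y\<in>I. \<Sum>v\<in>?V. e (scalar_prod y v)) = (\<Sum>y\<in>I. if y = 0\<^sub>v n then of_nat (CARD('a) ^ n) else 0)"
  proof (intro sum.cong refl)
    fix y assume "y \<in> I"
    then have y: "y \<in> ?V" using sub by auto
    have "perp ?V y = ?V \<longleftrightarrow> y = 0\<^sub>v n"
    proof
      assume *: "perp ?V y = ?V"
      show "y = 0\<^sub>v n"
      proof (rule eq_vecI)
        fix i assume i: "i < dim_vec (0\<^sub>v n)"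
        then have "unit_vec n i \<in> perp ?V y" using * by simp
        then show "vec_index y i = vec_index (0\<^sub>v n) i" using i y by (simp add: perp_def)
      qed (use y in auto)
    qed (auto simp: perp_def)
    moreover have "(\<Sum>v\<in>?V. e (scalar_prod y v)) = (\<Sum>v\<in>?V. e (scalar_prod v y))"
      using y by (intro sum.cong refl arg_cong[where f = e] comm_scalar_prod) auto
    ultimately show "(\<Sum>v\<in>?V. e (scalar_prod y v)) = (if y = 0\<^sub>v n then of_nat (CARD('a) ^ n) else 0)"
      by (simp add: sum_char_linear_set[OF linear_set_carrier y] card_carrier_vec)
  qed
  also have "\<dots> = of_nat (CARD('a) ^ n)" using fin 0 by simp
  finally have "of_nat (card (annihilator n I) * card I) = (of_nat (CARD('a) ^ n) :: complex)"
    using 1 by (subst (asm) sum.swap) simp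
  then show ?thesis by (simp only: of_nat_eq_iff mult.commute)
qed

lemma linear_set_left_kernel: "B \<in> carrier_mat n n \<Longrightarrow> linear_set n (left_kernel n B)"
  unfolding linear_set_def left_kernel_def
  by (auto simp: add_scalar_prod_distrib[of _ n])

lemma linear_set_mat_image:
  assumes B: "B \<in> carrier_mat n n"
  shows "linear_set n (mat_image B)"
  unfolding linear_set_def mat_image_def
proof (intro conjI ballI allI)
  show "(\<lambda>x. B *\<^sub>v x) ` carrier_vec (dim_col B) \<subseteq> carrier_vec n" using B by auto
  show "0\<^sub>v n \<in> (\<lambda>x. B *\<^sub>v x) ` carrier_vec (dim_col B)"
    using B by (intro image_eqI[of _ _ "0\<^sub>v n"]) auto
  fix v w assume "v \<in> (\<lambda>x. B *\<^sub>v x) ` carrier_vec (dim_col B)" "w \<in> (\<lambda>x. B *\<^sub>v x) ` carrier_vec (dim_col B)"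
  then obtain x y where "x \<in> carrier_vec n" "y \<in> carrier_vec n" "v = B *\<^sub>v x" "w = B *\<^sub>v y" using B by auto
  then show "v + w \<in> (\<lambda>x. B *\<^sub>v x) ` carrier_vec (dim_col B)"
    using B by (intro image_eqI[of _ _ "x + y"]) (auto simp: mult_add_distrib_mat_vec[of B n n])
next
  fix a v assume "v \<in> (\<lambda>x. B *\<^sub>v x) ` carrier_vec (dim_col B)"
  then obtain x where "x \<in> carrier_vec n" "v = B *\<^sub>v x" using B by auto
  then show "a \<cdot>\<^sub>v v \<in> (\<lambda>x. B *\<^sub>v x) ` carrier_vec (dim_col B)"
    using B by (intro image_eqI[of _ _ "a \<cdot>\<^sub>v x"]) (auto simp: mult_mat_vec[of B n n])
qed

text \<open>
The image is spanned by the columns.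
\<close>

lemma annihilator_mat_image:
  assumes B: "B \<in> carrier_mat n n"
  shows "annihilator n (mat_image B) = left_kernel n B"
proof -
  have "(\<forall>y\<in>mat_image B. scalar_prod v y = 0) \<longleftrightarrow> (\<forall>j<n. scalar_prod v (col B j) = 0)"
    if v: "v \<in> carrier_vec n" for v
  proof
    assume *: "\<forall>y\<in>mat_image B. scalar_prod v y = 0"
    show "\<forall>j<n. scalar_prod v (col B j) = 0"
    proof (intro allI impI)
      fix j assume j: "j < n"
      have "col B j = B *\<^sub>v unit_vec n j" using B j by (intro eq_vecI) auto
      then have "col B j \<in> mat_image B" using B by (auto simp: mat_image_def)
      then show "scalar_prod v (col B j) = 0" using * by blast
    qed
  next
    assume *: "\<forall>j<n. scalar_prod v (col B j) = 0"
    show "\<forall>y\<in>mat_image B. scalar_prod v y = 0"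
    proof
      fix y assume "y \<in> mat_image B"
      then obtain x where x: "x \<in> carrier_vec n" "y = B *\<^sub>v x" using B by (auto simp: mat_image_def)
      have T: "B\<^sup>T *\<^sub>v v = 0\<^sub>v n"
        using * B v by (intro eq_vecI) (auto simp: comm_scalar_prod[of _ n v])
      have "scalar_prod v (B *\<^sub>v x) = scalar_prod (B\<^sup>T *\<^sub>v v) x"
        using transpose_vec_mult_scalar[OF B x(1) v] by simp
      then show "scalar_prod v y = 0" using T x by simp
    qed
  qed
  then show ?thesis by (auto simp: annihilator_def left_kernel_def)
qed

lemma card_left_kernel_power:
  fixes B :: "'a :: {field, finite} mat"
  assumes B: "B \<in> carrier_mat n n"
  shows "\<exists>d. card (left_kernel n B) = CARD('a) ^ d"
proof -
  have "linear_set n {v \<in> carrier_vec n. \<forall>j<m. scalar_prod v (col B j) = 0} \<and>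
        (\<exists>d. card {v \<in> carrier_vec n. \<forall>j<m. scalar_prod v (col B j) = 0} = CARD('a) ^ d)" if "m \<le> n" for m
    using that
  proof (induction m)
    case 0
    have *: "{v \<in> carrier_vec n. \<forall>j<0. scalar_prod v (col B j) = 0} = carrier_vec n" by auto
    show ?case unfolding * using linear_set_carrier card_carrier_vec by blast
  next
    case (Suc m)
    define K where "K = {v \<in> carrier_vec n. \<forall>j<m. scalar_prod v (col B j) = 0}"
    have K: "linear_set n K" "\<exists>d. card K = CARD('a) ^ d" using Suc by (auto simp: K_def)
    have c: "col B m \<in> carrier_vec n" using B Suc.prems by auto
    have *: "{v \<in> carrier_vec n. \<forall>j<Suc m. scalar_prod v (col B j) = 0} = perp K (col B m)"
      by (auto simp: K_def perp_def less_Suc_eq)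
    show ?case unfolding * using linear_set_perp[OF K(1) c] card_perp_cases[OF K(1) c] K(2) by metis
  qed
  from this[of n] show ?thesis by (auto simp: left_kernel_def)
qed

text \<open>
Coordinates with respect to a basis are a bijection.
\<close>

lemma (in vectorspace) card_carrier_fin_dim:
  assumes "fin_dim"
  shows "card (carrier V) = card (carrier K) ^ dim"
proof -
  obtain \<beta> where \<beta>: "finite \<beta>" "basis \<beta>" using finite_basis_exists[OF assms] by blast
  then have sub: "\<beta> \<subseteq> carrier V" by (simp add: basis_def)
  have ex1: "\<forall>v. v \<in> carrier V \<longrightarrow> (\<exists>!a. a \<in> \<beta> \<rightarrow>\<^sub>E carrier K \<and> lincomb a \<beta> = v)"
    using basis_criterion[OF \<beta>(1) sub] \<beta>(2) by blast
  have closed: "lincomb a \<beta> \<in> carrier V" if "a \<in> \<beta> \<rightarrow>\<^sub>E carrier K" for a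
    using that sub \<beta>(1) by (intro lincomb_closed) auto
  have "bij_betw (\<lambda>a. lincomb a \<beta>) (\<beta> \<rightarrow>\<^sub>E carrier K) (carrier V)"
    unfolding bij_betw_def
  proof
    show "inj_on (\<lambda>a. lincomb a \<beta>) (\<beta> \<rightarrow>\<^sub>E carrier K)"
      using ex1 closed by (auto simp: inj_on_def)
    show "(\<lambda>a. lincomb a \<beta>) ` (\<beta> \<rightarrow>\<^sub>E carrier K) = carrier V"
      using ex1 closed by (auto simp: image_iff)
  qed
  then have "card (carrier V) = card (\<beta> \<rightarrow>\<^sub>E carrier K)" by (simp add: bij_betw_same_card)
  also have "\<dots> = card (carrier K) ^ card \<beta>" using \<beta>(1) by (simp add: card_PiE)
  finally show ?thesis using dim_basis[OF \<beta>] by simp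
qed

lemma card_mat_image:
  fixes B :: "'a :: {field, finite} mat"
  assumes B: "B \<in> carrier_mat n n"
  shows "card (mat_image B) = CARD('a) ^ vec_space.rank n B"
proof -
  interpret V: vec_space "TYPE('a)" n .
  have sub: "set (cols B) \<subseteq> carrier_vec n" using B cols_dim by blast
  interpret S: vectorspace class_ring "V.span_vs (set (cols B))"
    using V.span_is_subspace[THEN V.subspace_is_vs] sub by simp
  have "mat_image B = V.span (set (cols B))"
    using V.col_space_eq[OF B] B unfolding V.col_space_def mat_image_def by auto
  then have "card (mat_image B) = card (carrier (V.span_vs (set (cols B))))" by simp
  also have "\<dots> = card (carrier (class_ring :: 'a ring)) ^ S.dim"
    by (rule S.card_carrier_fin_dim) (use V.fin_dim_span_cols[OF B] in simp)
  finally show ?thesis by (simp add: V.rank_def class_ring_simps)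
qed

lemma rank_iff_card_left_kernel:
  fixes e :: "'a :: {field, finite} \<Rightarrow> complex" and B :: "'a mat"
  assumes e: "additive_character e" and B: "B \<in> carrier_mat n n"
  shows "int (vec_space.rank n B) = int n - int k \<longleftrightarrow> card (left_kernel n B) = CARD('a) ^ k"
proof -
  interpret additive_character e by (rule e)
  obtain d where d: "card (left_kernel n B) = CARD('a) ^ d" using card_left_kernel_power[OF B] by blast
  have "CARD('a) ^ (vec_space.rank n B + d) = CARD('a) ^ n"
    using card_annihilator[OF linear_set_mat_image[OF B]]
    by (simp add: annihilator_mat_image[OF B] d card_mat_image[OF B] power_add)
  then have "vec_space.rank n B + d = n"
    using one_less_card_field[where 'a = 'a] power_inject_exp by blast
  moreover have "card (left_kernel n B) = CARD('a) ^ k \<longleftrightarrow> d = k"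
    unfolding d using one_less_card_field[where 'a = 'a] power_inject_exp by blast
  ultimately show ?thesis by auto
qed

text \<open>
The vectors \<open>vs i\<close> play the role of a basis of \<open>K\<close>.  They are found by induction: \<open>K\<close> is the sum of a
hyperplane section \<open>perp K x\<close> and the line through a vector \<open>w\<close> outside it.
\<close>

lemma linear_set_generators:
  fixes K :: "'a :: {field, finite} vec set"
  assumes "linear_set n K" "card K = CARD('a) ^ k"
  shows "\<exists>vs. (\<forall>i<k. vs i \<in> K) \<and>
     (\<forall>y\<in>carrier_vec n. (\<forall>i<k. scalar_prod (vs i) y = 0) \<longrightarrow> (\<forall>v\<in>K. scalar_prod v y = 0))"
  using assms
proof (induction k arbitrary: K)
  case 0
  then have "K = {0\<^sub>v n}" by (auto simp: card_1_singleton_iff linear_set_def)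
  then show ?case by auto
next
  case (Suc k)
  have sub: "K \<subseteq> carrier_vec n" using Suc.prems by (simp add: linear_set_def)
  have "card K \<noteq> 1" using Suc.prems one_less_card_field[where 'a = 'a]
    by (metis nat_neq_iff one_less_power zero_less_Suc)
  then have "K \<noteq> {0\<^sub>v n}" by auto
  then obtain w where w: "w \<in> K" "w \<noteq> 0\<^sub>v n" using Suc.prems by (auto simp: linear_set_def)
  then obtain i where i: "i < n" "vec_index w i \<noteq> 0"
    using sub by (metis carrier_vecD eq_vecI index_zero_vec subsetD)
  define x where "x = (unit_vec n i :: 'a vec)"
  have x: "x \<in> carrier_vec n" by (simp add: x_def)
  have wx: "scalar_prod w x \<noteq> 0" using w i sub by (auto simp: x_def)
  have ne: "perp K x \<noteq> K" using w wx by (auto simp: perp_def)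
  then have "card (perp K x) = CARD('a) ^ k"
    using card_perp_cases[OF Suc.prems(1) x Suc.prems(2)] by simp
  from Suc.IH[OF linear_set_perp[OF Suc.prems(1) x] this] obtain vs where
    vs: "\<And>i. i < k \<Longrightarrow> vs i \<in> perp K x"
      "\<And>y. y \<in> carrier_vec n \<Longrightarrow> \<forall>i<k. scalar_prod (vs i) y = 0 \<Longrightarrow> \<forall>v\<in>perp K x. scalar_prod v y = 0"
    by blast
  show ?case
  proof (intro exI[of _ "vs(k := w)"] conjI allI ballI impI)
    show "(vs(k := w)) i \<in> K" if "i < Suc k" for i
      using that vs(1)[of i] w by (auto simp: perp_def less_Suc_eq)
    fix y v
    assume y: "y \<in> carrier_vec n" and 0: "\<forall>i<Suc k. scalar_prod ((vs(k := w)) i) y = 0" and v: "v \<in> K"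
    have wy: "scalar_prod w y = 0" using 0 by auto
    have "\<forall>i<k. scalar_prod (vs i) y = 0" using 0 by (metis fun_upd_other less_SucI nat_neq_iff)
    then have perp: "\<forall>v\<in>perp K x. scalar_prod v y = 0" using vs(2)[OF y] by blast
    \<comment> \<open>Projection of \<open>v\<close> along \<open>w\<close> to the hyperplane section.\<close>
    define a where "a = - (scalar_prod v x / scalar_prod w x)"
    have vc: "v \<in> carrier_vec n" "w \<in> carrier_vec n" using v w sub by auto
    have sp: "scalar_prod (v + a \<cdot>\<^sub>v w) z = scalar_prod v z + a * scalar_prod w z" if "z \<in> carrier_vec n" for z
      using vc that by (simp add: add_scalar_prod_distrib[of _ n])
    have "v + a \<cdot>\<^sub>v w \<in> K" using v w Suc.prems by (auto simp: linear_set_def)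
    moreover have "scalar_prod (v + a \<cdot>\<^sub>v w) x = 0" using sp[OF x] wx by (simp add: a_def)
    ultimately have "scalar_prod (v + a \<cdot>\<^sub>v w) y = 0" using perp by (auto simp: perp_def)
    then show "scalar_prod v y = 0" using sp[OF y] wy by simp
  qed
qed

lemma cokernel_props:
  fixes B :: "'a :: {field, finite} mat"
  assumes B: "B \<in> carrier_mat n n"
  defines "V \<equiv> module_vec TYPE('a) n"
  defines "cls \<equiv> a_r_coset V (mat_image B)"
  shows "carrier (cokernel B) = cls ` carrier_vec n"
    and "\<And>v w. v \<in> carrier_vec n \<Longrightarrow> w \<in> carrier_vec n \<Longrightarrow> cls v \<oplus>\<^bsub>cokernel B\<^esub> cls w = cls (v + w)"
    and "\<And>r v. v \<in> carrier_vec n \<Longrightarrow> r \<odot>\<^bsub>cokernel B\<^esub> cls v = cls (r \<cdot>\<^sub>v v)"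
    and "\<And>v w. v \<in> carrier_vec n \<Longrightarrow> w \<in> carrier_vec n \<Longrightarrow> cls v = cls w \<longleftrightarrow> v - w \<in> mat_image B"
    and "card (carrier (cokernel B)) * card (mat_image B) = CARD('a) ^ n"
proof -
  interpret V: vec_space "TYPE('a)" n .
  have dim: "dim_row B = n" using B by simp
  interpret S: abelian_subgroup "mat_image B" V
    unfolding V_def using mat_image_abelian_subgroup[of B] by (simp add: dim)
  have [simp]: "carrier V = carrier_vec n" "add V = (+)" "smult V = (\<cdot>\<^sub>v)"
    by (auto simp: V_def module_vec_simps)
  note I = linear_set_mat_image[OF B]
  show "carrier (cokernel B) = cls ` carrier_vec n"
    by (auto simp: cokernel_def Let_def A_RCOSETS_def' dim cls_def simp flip: V_def)
  show "cls v \<oplus>\<^bsub>cokernel B\<^esub> cls w = cls (v + w)"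
    if "v \<in> carrier_vec n" "w \<in> carrier_vec n" for v w
    using S.a_rcos_sum[of v w] that by (simp add: cokernel_def Let_def dim cls_def flip: V_def)
  show "r \<odot>\<^bsub>cokernel B\<^esub> cls v = cls (r \<cdot>\<^sub>v v)" if "v \<in> carrier_vec n" for r v
    using cokernel_smult[of v B r] that by (simp add: dim cls_def V_def)
  show "cls v = cls w \<longleftrightarrow> v - w \<in> mat_image B" if v: "v \<in> carrier_vec n" and w: "w \<in> carrier_vec n" for v w
  proof
    assume "cls v = cls w"
    moreover have "v \<in> cls v" unfolding cls_def using v by (intro S.a_rcos_self) simp
    ultimately have "v \<in> cls w" by simp
    then obtain h where h: "h \<in> mat_image B" "v = h + w" by (auto simp: cls_def a_r_coset_def')
    have "h \<in> carrier_vec n" using h I by (auto simp: linear_set_def)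
    then have "v - w = h" using w h(2) by (intro eq_vecI) auto
    then show "v - w \<in> mat_image B" using h by simp
  next
    assume *: "v - w \<in> mat_image B"
    have "v = (v - w) + w" using v w by auto
    then have "v \<in> cls w" unfolding cls_def a_r_coset_def' using * by auto
    then show "cls v = cls w"
      unfolding cls_def using w by (intro S.a_repr_independence'[symmetric]) auto
  qed
  have "card (a_rcosets\<^bsub>V\<^esub> mat_image B) * card (mat_image B) = order (add_monoid V)"
    using S.a_lagrange[OF _ S.additive_subgroup_axioms] by (simp add: order_def)
  then show "card (carrier (cokernel B)) * card (mat_image B) = CARD('a) ^ n"
    by (simp add: cokernel_def Let_def dim order_def card_carrier_vec flip: V_def)
qed

text \<open>
In one direction cardinalities are compared.  In the other, \<open>k\<close> generators \<open>vs i\<close> of the left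
kernel define the map \<open>y \<mapsto> (vs i \<bullet> y)\<^sub>i\<close>.  Its kernel is the annihilator of the left kernel, which by
counting is no larger than the image of \<open>B\<close>; so it descends to an injection of the cokernel into
\<open>F\<^sub>p\<^sup>k\<close>, and the two have the same number of elements.
\<close>

lemma cokernel_iso_iff_card_left_kernel:
  fixes e :: "'a :: {field, finite} \<Rightarrow> complex" and B :: "'a mat"
  assumes e: "additive_character e" and B: "B \<in> carrier_mat n n"
  shows "module_isomorphic class_ring (cokernel B) (module_vec TYPE('a) k) \<longleftrightarrow>
         card (left_kernel n B) = CARD('a) ^ k"
proof -
  interpret additive_character e by (rule e)
  define cls where "cls = a_r_coset (module_vec TYPE('a) n) (mat_image B)"
  note cok = cokernel_props[OF B, folded cls_def]
  have I: "linear_set n (mat_image B)" by (rule linear_set_mat_image[OF B])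
  have K: "linear_set n (left_kernel n B)" by (rule linear_set_left_kernel[OF B])
  have Isub: "mat_image B \<subseteq> carrier_vec n" and Ksub: "left_kernel n B \<subseteq> carrier_vec n"
    using I K by (auto simp: linear_set_def)
  have card_I: "card (mat_image B) * card (left_kernel n B) = CARD('a) ^ n"
    using card_annihilator[OF I] by (simp add: annihilator_mat_image[OF B])
  then have pos: "card (mat_image B) > 0" "card (left_kernel n B) > 0"
    by (metis mult_is_0 neq0_conv one_less_card_field power_not_zero less_nat_zero_code)+
  have card_cok: "card (carrier (cokernel B)) = card (left_kernel n B)"
    using cok(5) card_I pos by (metis mult.commute mult_cancel1 not_gr0)
  show ?thesis
  proof
    assume "module_isomorphic class_ring (cokernel B) (module_vec TYPE('a) k)"
    then obtain f where "bij_betw f (carrier (cokernel B)) (carrier_vec k :: 'a vec set)"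
      by (auto simp: module_isomorphic_def module_vec_simps)
    then have "card (carrier (cokernel B)) = card (carrier_vec k :: 'a vec set)"
      by (rule bij_betw_same_card)
    then show "card (left_kernel n B) = CARD('a) ^ k" by (simp add: card_cok card_carrier_vec)
  next
    assume card: "card (left_kernel n B) = CARD('a) ^ k"
    obtain vs where vs: "\<And>i. i < k \<Longrightarrow> vs i \<in> left_kernel n B"
      "\<And>y. y \<in> carrier_vec n \<Longrightarrow> \<forall>i<k. scalar_prod (vs i) y = 0 \<Longrightarrow> \<forall>v\<in>left_kernel n B. scalar_prod v y = 0"
      using linear_set_generators[OF K card] by blast
    have vsc: "vs i \<in> carrier_vec n" if "i < k" for i using vs(1)[OF that] Ksub by auto
    have orth: "scalar_prod v y = 0" if "v \<in> left_kernel n B" "y \<in> mat_image B" for v y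
      using that annihilator_mat_image[OF B] by (auto simp: annihilator_def)
    have image: "mat_image B = annihilator n (left_kernel n B)"
    proof (rule card_subset_eq)
      show "finite (annihilator n (left_kernel n B))"
        by (rule finite_subset[OF _ finite_carrier_vec[of n]]) (auto simp: annihilator_def)
      show "mat_image B \<subseteq> annihilator n (left_kernel n B)"
      proof
        fix y assume y: "y \<in> mat_image B"
        then have "scalar_prod y v = 0" if "v \<in> left_kernel n B" for v
          using orth[OF that y] that Isub Ksub by (subst comm_scalar_prod[of _ n]) auto
        then show "y \<in> annihilator n (left_kernel n B)" using y Isub by (auto simp: annihilator_def)
      qed
      have "card (left_kernel n B) * card (annihilator n (left_kernel n B)) = card (left_kernel n B) * card (mat_image B)"
        using card_annihilator[OF K] card_I by (simp add: mult.commute)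
      then show "card (mat_image B) = card (annihilator n (left_kernel n B))" using pos by simp
    qed
    define \<phi> where "\<phi> y = Matrix.vec k (\<lambda>i. scalar_prod (vs i) y)" for y
    have add: "\<phi> (v + w) = \<phi> v + \<phi> w" if "v \<in> carrier_vec n" "w \<in> carrier_vec n" for v w
      using that vsc by (intro eq_vecI) (auto simp: \<phi>_def scalar_prod_add_distrib[of _ n])
    have smult: "\<phi> (r \<cdot>\<^sub>v v) = r \<cdot>\<^sub>v \<phi> v" if "v \<in> carrier_vec n" for r v
      using that vsc by (intro eq_vecI) (auto simp: \<phi>_def)
    have ker: "\<phi> v = \<phi> w \<longleftrightarrow> cls v = cls w" if v: "v \<in> carrier_vec n" and w: "w \<in> carrier_vec n" for v w
    proof -
      have sub: "scalar_prod u (v - w) = 0 \<longleftrightarrow> scalar_prod u v = scalar_prod u w" if "u \<in> carrier_vec n" for u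
        using that v w by (simp add: scalar_prod_minus_distrib[of _ n])
      have "\<phi> v = \<phi> w \<longleftrightarrow> (\<forall>i<k. scalar_prod (vs i) (v - w) = 0)"
        using sub vsc by (auto simp: \<phi>_def vec_eq_iff)
      also have "\<dots> \<longleftrightarrow> (\<forall>u\<in>left_kernel n B. scalar_prod u (v - w) = 0)"
        using vs(1) vs(2)[of "v - w"] minus_carrier_vec[OF v w] by blast
      also have "\<dots> \<longleftrightarrow> (\<forall>u\<in>left_kernel n B. scalar_prod (v - w) u = 0)"
        using v w Ksub by (intro ball_cong refl) (subst comm_scalar_prod[of _ n], auto)
      also have "\<dots> \<longleftrightarrow> v - w \<in> mat_image B"
        unfolding image annihilator_def using v w by auto
      also have "\<dots> \<longleftrightarrow> cls v = cls w" using cok(4)[OF v w] by simp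
      finally show ?thesis .
    qed
    define f where "f X = \<phi> (SOME v. v \<in> carrier_vec n \<and> cls v = X)" for X
    have f: "f (cls v) = \<phi> v" if v: "v \<in> carrier_vec n" for v
    proof -
      have "(SOME u. u \<in> carrier_vec n \<and> cls u = cls v) \<in> carrier_vec n \<and>
            cls (SOME u. u \<in> carrier_vec n \<and> cls u = cls v) = cls v"
        by (rule someI[of _ v]) (use v in simp)
      then show ?thesis unfolding f_def using ker v by blast
    qed
    have "f \<in> module_hom class_ring (cokernel B) (module_vec TYPE('a) k)"
      unfolding module_hom_def
      by (auto simp: cok(1,2,3) f add smult module_vec_simps) (auto simp: \<phi>_def)
    moreover have "bij_betw f (carrier (cokernel B)) (carrier (module_vec TYPE('a) k))"
      unfolding bij_betw_def
    proof
      show inj: "inj_on f (carrier (cokernel B))"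
        unfolding cok(1) by (auto simp: inj_on_def f ker)
      show "f ` carrier (cokernel B) = carrier (module_vec TYPE('a) k)"
      proof (rule card_subset_eq)
        show "finite (carrier (module_vec TYPE('a) k))" by (simp add: module_vec_simps)
        show "f ` carrier (cokernel B) \<subseteq> carrier (module_vec TYPE('a) k)"
          unfolding cok(1) by (auto simp: f module_vec_simps) (auto simp: \<phi>_def)
        show "card (f ` carrier (cokernel B)) = card (carrier (module_vec TYPE('a) k))"
          unfolding card_image[OF inj] by (simp add: card_cok card module_vec_simps card_carrier_vec)
      qed
    qed
    ultimately show "module_isomorphic class_ring (cokernel B) (module_vec TYPE('a) k)"
      unfolding module_isomorphic_def by blast
  qed
qed

section \<open>The law of the left kernel\<close>

lemma bij_betw_columns:
  "bij_betw (\<lambda>f. Matrix.mat n n (\<lambda>(i, j). vec_index (f j) i))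
     (PiE {..<n} (\<lambda>_. carrier_vec n :: 'a vec set)) (carrier_mat n n :: 'a mat set)"
proof (rule bij_betw_byWitness[where f' = "\<lambda>B. restrict (col B) {..<n}"])
  show "\<forall>f\<in>PiE {..<n} (\<lambda>_. carrier_vec n :: 'a vec set).
     restrict (col (Matrix.mat n n (\<lambda>(i, j). vec_index (f j) i))) {..<n} = f"
  proof (intro ballI ext)
    fix f j assume f: "f \<in> PiE {..<n} (\<lambda>_. carrier_vec n :: 'a vec set)"
    show "restrict (col (Matrix.mat n n (\<lambda>(i, j). vec_index (f j) i))) {..<n} j = f j"
    proof (cases "j < n")
      case True
      then have "f j \<in> carrier_vec n" using f by auto
      then show ?thesis using True by (auto intro!: eq_vecI)
    next
      case False
      then show ?thesis using f by (auto simp: PiE_def extensional_def)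
    qed
  qed
next
  show "\<forall>B\<in>(carrier_mat n n :: 'a mat set).
     Matrix.mat n n (\<lambda>(i, j). vec_index (restrict (col B) {..<n} j) i) = B"
  proof
    fix B :: "'a mat" assume "B \<in> carrier_mat n n"
    then show "Matrix.mat n n (\<lambda>(i, j). vec_index (restrict (col B) {..<n} j) i) = B"
      by (intro eq_matI) auto
  qed
  show "(\<lambda>f. Matrix.mat n n (\<lambda>(i, j). vec_index (f j) i)) ` PiE {..<n} (\<lambda>_. carrier_vec n :: 'a vec set)
      \<subseteq> carrier_mat n n"
    by (intro image_subsetI) simp
  show "(\<lambda>B. restrict (col B) {..<n}) ` (carrier_mat n n :: 'a mat set) \<subseteq> PiE {..<n} (\<lambda>_. carrier_vec n :: 'a vec set)"
    by (intro image_subsetI) auto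
qed

text \<open>
An event about the left kernel of the random matrix is a finite union of events \<open>A = B\<close>, whose
probabilities factor over the entries by independence.
\<close>

lemma measure_eq_expose:
  fixes A :: "'w \<Rightarrow> 'a :: {field, finite} mat"
  assumes M: "prob_space M" and n: "1 \<le> n"
    and A: "A \<in> measurable M (count_space (carrier_mat n n))"
    and indep: "prob_space.indep_vars M (\<lambda>_. count_space UNIV) (\<lambda>ij \<omega>. A \<omega> $$ ij) ({..<n} \<times> {..<n})"
    and G: "\<And>B. B \<in> carrier_mat n n \<Longrightarrow> G B \<longleftrightarrow> card (left_kernel n B) = r"
  defines "q \<equiv> \<lambda>j i u. measure M {\<omega> \<in> space M. A \<omega> $$ (i, j) = u}"
  shows "measure M {\<omega> \<in> space M. G (A \<omega>)} =
    expose n (\<lambda>j. col_weight n (q j)) n (\<lambda>K. if card K = r then 1 else 0) (carrier_vec n)"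
proof -
  interpret prob_space M by (rule M)
  let ?M = "carrier_mat n n :: 'a mat set"
  let ?mat = "\<lambda>f :: nat \<Rightarrow> 'a vec. Matrix.mat n n (\<lambda>(i, j). vec_index (f j) i)"
  let ?F = "PiE {..<n} (\<lambda>_. carrier_vec n :: 'a vec set)"
  have finM: "finite ?M"
    using bij_betw_finite[OF bij_betw_columns[of n, where 'a = 'a]] by (simp add: finite_PiE)
  have AM: "A \<omega> \<in> ?M" if "\<omega> \<in> space M" for \<omega>
    using measurable_space[OF A that] by simp
  have ev: "{\<omega> \<in> space M. A \<omega> = B} \<in> sets M" if "B \<in> ?M" for B
  proof -
    have "A -` {B} \<inter> space M \<in> sets M" using that by (intro measurable_sets[OF A]) auto
    moreover have "A -` {B} \<inter> space M = {\<omega> \<in> space M. A \<omega> = B}" by auto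
    ultimately show ?thesis by simp
  qed
  have point: "prob {\<omega> \<in> space M. A \<omega> = ?mat f} = (\<Prod>j<n. col_weight n (q j) (f j))" if f: "f \<in> ?F" for f
  proof -
    let ?I = "{..<n} \<times> {..<n}"
    have "{\<omega> \<in> space M. A \<omega> = ?mat f} =
        (\<Inter>ij\<in>?I. (\<lambda>\<omega>. A \<omega> $$ ij) -` {vec_index (f (snd ij)) (fst ij)} \<inter> space M)" (is "?L = ?R")
    proof
      show "?L \<subseteq> ?R" by auto
      show "?R \<subseteq> ?L"
      proof
        fix \<omega> assume \<omega>: "\<omega> \<in> ?R"
        have "(0, 0) \<in> ?I" using n by auto
        then have sp: "\<omega> \<in> space M" using \<omega> by blast
        have "A \<omega> = ?mat f"
        proof (rule eq_matI)
          fix i j assume "i < dim_row (?mat f)" "j < dim_col (?mat f)"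
          then have ij: "(i, j) \<in> ?I" "i < n" "j < n" by auto
          have "A \<omega> $$ (i, j) = vec_index (f j) i" using INT_D[OF \<omega> ij(1)] by simp
          then show "A \<omega> $$ (i, j) = ?mat f $$ (i, j)" using ij by simp
        qed (use AM[OF sp] in auto)
        then show "\<omega> \<in> ?L" using sp by simp
      qed
    qed
    also have "prob \<dots> = (\<Prod>ij\<in>?I. prob ((\<lambda>\<omega>. A \<omega> $$ ij) -` {vec_index (f (snd ij)) (fst ij)} \<inter> space M))"
      using n by (intro indep_varsD[OF indep]) (auto simp: lessThan_empty_iff)
    also have "\<dots> = (\<Prod>(i, j)\<in>?I. q j i (vec_index (f j) i))"
    proof (intro prod.cong refl)
      fix ij assume "ij \<in> ?I"
      have "(\<lambda>\<omega>. A \<omega> $$ ij) -` {vec_index (f (snd ij)) (fst ij)} \<inter> space M =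
          {\<omega> \<in> space M. A \<omega> $$ (fst ij, snd ij) = vec_index (f (snd ij)) (fst ij)}"
        by auto
      then show "prob ((\<lambda>\<omega>. A \<omega> $$ ij) -` {vec_index (f (snd ij)) (fst ij)} \<inter> space M) =
          (case ij of (i, j) \<Rightarrow> q j i (vec_index (f j) i))"
        by (simp only: q_def split_beta)
    qed
    also have "\<dots> = (\<Prod>i<n. \<Prod>j<n. q j i (vec_index (f j) i))"
      by (simp add: prod.cartesian_product)
    also have "\<dots> = (\<Prod>j<n. col_weight n (q j) (f j))"
      unfolding col_weight_def by (rule prod.swap)
    finally show ?thesis .
  qed
  have kernel: "left_kernel n (?mat f) = {v \<in> carrier_vec n. \<forall>j<n. scalar_prod v (f j) = 0}" if f: "f \<in> ?F" for f
  proof -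
    have "col (?mat f) j = f j" if "j < n" for j
    proof -
      have "f j \<in> carrier_vec n" using f that by auto
      then show ?thesis using that by (auto intro!: eq_vecI)
    qed
    then show ?thesis by (auto simp: left_kernel_def)
  qed
  have "{\<omega> \<in> space M. G (A \<omega>)} = (\<Union>B\<in>{B \<in> ?M. G B}. {\<omega> \<in> space M. A \<omega> = B})"
    using AM by auto
  also have "prob \<dots> = (\<Sum>B\<in>{B \<in> ?M. G B}. prob {\<omega> \<in> space M. A \<omega> = B})"
    using finM ev by (intro finite_measure_finite_Union) (auto simp: disjoint_family_on_def)
  also have "\<dots> = (\<Sum>B\<in>?M. if G B then prob {\<omega> \<in> space M. A \<omega> = B} else 0)"
    using finM by (rule sum.inter_filter)
  also have "\<dots> = (\<Sum>f\<in>?F. if G (?mat f) then prob {\<omega> \<in> space M. A \<omega> = ?mat f} else 0)"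
    by (rule sum.reindex_bij_betw[OF bij_betw_columns, symmetric])
  also have "\<dots> = (\<Sum>f\<in>?F. (\<Prod>j<n. col_weight n (q j) (f j)) *
        (if card {v \<in> carrier_vec n. \<forall>j<n. scalar_prod v (f j) = 0} = r then 1 else 0))"
  proof (intro sum.cong refl)
    fix f assume f: "f \<in> ?F"
    show "(if G (?mat f) then prob {\<omega> \<in> space M. A \<omega> = ?mat f} else 0) =
      (\<Prod>j<n. col_weight n (q j) (f j)) *
        (if card {v \<in> carrier_vec n. \<forall>j<n. scalar_prod v (f j) = 0} = r then 1 else 0)"
      using G[of "?mat f"] point[OF f] kernel[OF f] by simp
  qed
  also have "\<dots> = expose n (\<lambda>j. col_weight n (q j)) n (\<lambda>K. if card K = r then 1 else 0) (carrier_vec n)"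
    by (rule expose_eq_sum_PiE[symmetric])
  finally show ?thesis .
qed

section \<open>The limit\<close>

text \<open>
The double limit in the form in which it arises: \<open>n \<rightarrow> \<infinity>\<close> for each fixed \<open>s\<close>, with an error that
vanishes only as \<open>s \<rightarrow> \<infinity>\<close>.
\<close>

lemma tendsto_by_approximation:
  fixes E :: "nat \<Rightarrow> real"
  assumes approx: "\<And>s. eventually (\<lambda>n. \<bar>E n - Q s\<bar> \<le> R s n) sequentially"
    and R: "\<And>s. R s \<longlonglongrightarrow> r s" and r: "r \<longlonglongrightarrow> 0" and Q: "Q \<longlonglongrightarrow> L"
  shows "E \<longlonglongrightarrow> L"
proof (rule tendstoI)
  fix \<delta> :: real assume \<delta>: "0 < \<delta>"
  have "eventually (\<lambda>s. r s < \<delta> / 2) sequentially"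
    using order_tendstoD(2)[OF r, of "\<delta> / 2"] \<delta> by simp
  moreover have "eventually (\<lambda>s. dist (Q s) L < \<delta> / 2) sequentially"
    using tendstoD[OF Q, of "\<delta> / 2"] \<delta> by simp
  ultimately have "eventually (\<lambda>s. r s < \<delta> / 2 \<and> dist (Q s) L < \<delta> / 2) sequentially"
    by (rule eventually_conj)
  then obtain s where s: "r s < \<delta> / 2" "dist (Q s) L < \<delta> / 2"
    using eventually_happens'[OF sequentially_bot] by blast
  have "eventually (\<lambda>n. R s n < \<delta> / 2) sequentially" by (rule order_tendstoD(2)[OF R s(1)])
  with approx[of s] show "eventually (\<lambda>n. dist (E n) L < \<delta>) sequentially"
  proof eventually_elim
    case (elim n)
    then show ?case using s(2) unfolding dist_real_def by linarith
  qed
qed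

lemma entry_dist_of_balanced:
  fixes x :: "'w \<Rightarrow> 'a :: finite"
  assumes "prob_space M" "balanced M \<alpha> x"
  shows "entry_dist \<alpha> (\<lambda>u. measure M {\<omega> \<in> space M. x \<omega> = u})"
proof -
  interpret prob_space M by fact
  have x: "x \<in> measurable M (count_space UNIV)" and le: "\<And>u. prob {\<omega> \<in> space M. x \<omega> = u} \<le> 1 - \<alpha>"
    using assms(2) by (auto simp: balanced_def)
  have ev: "{\<omega> \<in> space M. x \<omega> = u} \<in> sets M" for u
  proof -
    have "x -` {u} \<inter> space M \<in> sets M" by (intro measurable_sets[OF x]) auto
    moreover have "x -` {u} \<inter> space M = {\<omega> \<in> space M. x \<omega> = u}" by auto
    ultimately show ?thesis by simp
  qed
  have "(\<Sum>u\<in>UNIV. prob {\<omega> \<in> space M. x \<omega> = u}) = prob (\<Union>u. {\<omega> \<in> space M. x \<omega> = u})"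
    using ev by (intro finite_measure_finite_Union[symmetric]) (auto simp: disjoint_family_on_def)
  also have "(\<Union>u. {\<omega> \<in> space M. x \<omega> = u}) = space M" by auto
  finally show ?thesis using le by (simp add: entry_dist_def prob_space)
qed

lemma balanced_columns_exist:
  fixes e :: "'a :: {field, finite} \<Rightarrow> complex" and q :: "nat \<Rightarrow> nat \<Rightarrow> 'a \<Rightarrow> real"
  assumes e: "additive_character e"
    and q: "\<And>i j. i < n \<Longrightarrow> j < n \<Longrightarrow> entry_dist \<alpha> (q j i)" and \<alpha>: "0 < \<alpha>" "\<alpha> \<le> 1 / 2"
  shows "\<exists>Y. balanced_columns e n (2 * \<alpha> * (1 - \<alpha>)) q Y"
proof -
  interpret additive_character e by (rule e)
  have "\<forall>j i. \<exists>Y. i < n \<longrightarrow> j < n \<longrightarrow> decay_profile (2 * \<alpha> * (1 - \<alpha>)) (q j i) Y"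
    using decay_profile_exists[OF q \<alpha>] by blast
  then obtain Y where Y: "\<And>j i. i < n \<Longrightarrow> j < n \<Longrightarrow> decay_profile (2 * \<alpha> * (1 - \<alpha>)) (q j i) (Y j i)"
    by metis
  have "balanced_columns e n (2 * \<alpha> * (1 - \<alpha>)) q Y"
  proof unfold_locales
    show "0 < 2 * \<alpha> * (1 - \<alpha>)" using \<alpha> by simp
    show "prob_weight n (col_weight n (q j))" if "j < n" for j
      using q that by (intro prob_weight_col_weight) auto
  qed (rule Y)
  then show ?thesis by blast
qed

theorem expose_tendsto:
  fixes e :: "'a :: {field, finite} \<Rightarrow> complex" and q :: "nat \<Rightarrow> nat \<Rightarrow> nat \<Rightarrow> 'a \<Rightarrow> real"
  assumes e: "additive_character e" and c: "c > 1"
    and q: "eventually (\<lambda>n. \<forall>i<n. \<forall>j<n. entry_dist (c * ln (real n) / real n) (q n j i)) sequentially"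
  defines "Q \<equiv> 1 / real CARD('a)"
  shows "(\<lambda>n. expose n (\<lambda>j. col_weight n (q n j)) n (\<lambda>K. if card K = CARD('a) ^ k then 1 else 0) (carrier_vec n))
    \<longlonglongrightarrow> Q ^ (k ^ 2) * ((\<Prod>j. 1 - Q ^ (j + 1)) / q_factorial Q k ^ 2)"
proof -
  interpret additive_character e by (rule e)
  define p where "p = real CARD('a)"
  have p: "p > 1" using one_less_card_field[where 'a = 'a] by (simp add: p_def)
  have Q: "0 < Q" "Q < 1" using p by (auto simp: Q_def p_def)
  define E where "E n = expose n (\<lambda>j. col_weight n (q n j)) n (\<lambda>K. if card K = CARD('a) ^ k then 1 else 0) (carrier_vec n)" for n
  have "\<forall>s. \<exists>R. R \<longlonglongrightarrow> 1 / (p ^ s * (p - 1)) \<and> eventually (\<lambda>n. \<bar>E n - corank_chain Q k s s\<bar> \<le> R n) sequentially"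
  proof
    fix s
    obtain \<epsilon> \<zeta> x where \<epsilon>: "0 < \<epsilon>" "\<epsilon> < 1" and x: "0 < x" "x \<le> 1" and lims:
      "(\<lambda>n. (exp (real n * (p * exp (- ((1 - \<epsilon>) * noncollision_rate c n / 2 * real (n - s))))) - 1) +
         exp (real n * (\<zeta> * ln (1 / x) + p * x)) * ((1 + exp (- (2 * \<epsilon>))) / 2) ^ (n - s) +
         real n * p * (p ^ n * exp (- (real n * \<epsilon>\<^sup>2 / 4))) *
             ((1 + p * exp (- (char_gap * noncollision_rate c n * (\<zeta> * real n) / 2))) / p) ^ (n - s)) \<longlonglongrightarrow> 0"
      "(\<lambda>n. p ^ n * ((1 + p * exp (- ((1 - \<epsilon>) * real n * noncollision_rate c n / 2))) / p) ^ (n - s)) \<longlonglongrightarrow> p ^ s"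
      "(\<lambda>n. exp (- ((1 - \<epsilon>) * real n * noncollision_rate c n / 2))) \<longlonglongrightarrow> 0"
      using error_terms_vanish[OF p c char_gap_pos, of s] by blast
    define a where "a n = (exp (real n * (p * exp (- ((1 - \<epsilon>) * noncollision_rate c n / 2 * real (n - s))))) - 1) +
         exp (real n * (\<zeta> * ln (1 / x) + p * x)) * ((1 + exp (- (2 * \<epsilon>))) / 2) ^ (n - s) +
         real n * p * (p ^ n * exp (- (real n * \<epsilon>\<^sup>2 / 4))) *
             ((1 + p * exp (- (char_gap * noncollision_rate c n * (\<zeta> * real n) / 2))) / p) ^ (n - s)" for n
    define t where "t n = p ^ n * ((1 + p * exp (- ((1 - \<epsilon>) * real n * noncollision_rate c n / 2))) / p) ^ (n - s)" for n
    define \<theta> where "\<theta> n = exp (- ((1 - \<epsilon>) * real n * noncollision_rate c n / 2))" for n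
    have lims: "a \<longlonglongrightarrow> 0" "t \<longlonglongrightarrow> p ^ s" "\<theta> \<longlonglongrightarrow> 0"
      using lims unfolding a_def t_def \<theta>_def by auto
    define R where "R n = a n + (1 + a n + t n - p ^ s) / (p ^ s * (p - 1)) + s * \<theta> n" for n
    have "(\<lambda>n. s * \<theta> n) \<longlonglongrightarrow> 0" using tendsto_mult_left[OF lims(3), of "real s"] by simp
    then have "R \<longlonglongrightarrow> 0 + (1 + 0 + p ^ s - p ^ s) / (p ^ s * (p - 1)) + 0"
      unfolding R_def using p by (intro tendsto_intros lims) auto
    then have "R \<longlonglongrightarrow> 1 / (p ^ s * (p - 1))" by simp
    moreover have "eventually (\<lambda>n. \<bar>E n - corank_chain Q k s s\<bar> \<le> R n) sequentially"
    proof -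
      have "(\<lambda>n. c * ln (real n) / real n) \<longlonglongrightarrow> 0" by real_asymp
      then have "eventually (\<lambda>n. c * ln (real n) / real n < 1 / 2) sequentially"
        by (rule order_tendstoD(2)) simp
      then show ?thesis using q eventually_ge_at_top[of s] eventually_gt_at_top[of 1]
      proof eventually_elim
        case (elim n)
        define \<alpha> where "\<alpha> = c * ln (real n) / real n"
        have \<alpha>: "0 < \<alpha>" "\<alpha> \<le> 1 / 2" using elim c by (auto simp: \<alpha>_def)
        have "\<exists>Y. balanced_columns e n (2 * \<alpha> * (1 - \<alpha>)) (q n) Y"
          by (rule balanced_columns_exist[OF e _ \<alpha>]) (use elim(2) in \<open>auto simp: \<alpha>_def\<close>)
        then obtain Y where Y: "balanced_columns e n (noncollision_rate c n) (q n) Y"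
          by (auto simp: noncollision_rate_def \<alpha>_def)
        show ?case
          using balanced_columns.corank_near_chain[OF Y elim(3) \<epsilon> x, of k \<zeta>]
          unfolding balanced_columns.atypical_bound_def[OF Y] balanced_columns.typical_bound_def[OF Y]
          by (simp only: E_def R_def a_def t_def \<theta>_def p_def Q_def)
      qed
    qed
    ultimately show "\<exists>R. R \<longlonglongrightarrow> 1 / (p ^ s * (p - 1)) \<and>
        eventually (\<lambda>n. \<bar>E n - corank_chain Q k s s\<bar> \<le> R n) sequentially" by blast
  qed
  then obtain R where R: "\<And>s. R s \<longlonglongrightarrow> 1 / (p ^ s * (p - 1))"
    "\<And>s. eventually (\<lambda>n. \<bar>E n - corank_chain Q k s s\<bar> \<le> R s n) sequentially" by metis
  have "(\<lambda>s. 1 / (p ^ s * (p - 1))) \<longlonglongrightarrow> 0" using p by real_asymp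
  from tendsto_by_approximation[OF R(2) R(1) this corank_chain_tendsto[OF Q]]
  show ?thesis by (simp add: E_def)
qed

theorem theorem1p3:
  fixes p k :: nat
    and c :: real
    and M :: "nat \<Rightarrow> 'w measure"
    and A :: "nat \<Rightarrow> 'w \<Rightarrow> 'a :: {field, finite} mat"
  assumes "prime p"
    and "CARD('a) = p"
    and "c > 1"
    and "\<And>n. n \<ge> 1 \<Longrightarrow> prob_space (M n)"
    and "\<And>n. n \<ge> 1 \<Longrightarrow> A n \<in> measurable (M n) (count_space (carrier_mat n n))"
    and "\<forall>\<^sub>F n in sequentially. balanced_mat (M n) n (c * ln (real n) / real n) (A n)"
  defines "L \<equiv> 1 / real p ^ (k ^ 2) *
      ((\<Prod>j. 1 - 1 / real p ^ (j + 1)) / (\<Prod>j=1..k. (1 - 1 / real p ^ j) ^ 2))"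
  shows "((\<lambda>n. measure (M n) {\<omega> \<in> space (M n).
            module_isomorphic class_ring (cokernel (A n \<omega>)) (module_vec TYPE('a) k)})
           \<longlonglongrightarrow> L) \<and>
         ((\<lambda>n. measure (M n) {\<omega> \<in> space (M n).
            int (vec_space.rank n (A n \<omega>)) = int n - int k}) \<longlonglongrightarrow> L)"
proof -
  obtain e :: "'a \<Rightarrow> complex" where e: "additive_character e"
    using additive_character_exists assms(1,2) by blast
  define q where "q n j i u = measure (M n) {\<omega> \<in> space (M n). A n \<omega> $$ (i, j) = u}" for n j i u
  define E where "E n = expose n (\<lambda>j. col_weight n (q n j)) n
      (\<lambda>K. if card K = CARD('a) ^ k then 1 else 0) (carrier_vec n)" for n
  have L: "L = (1 / real CARD('a)) ^ (k ^ 2) *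
      ((\<Prod>j. 1 - (1 / real CARD('a)) ^ (j + 1)) / q_factorial (1 / real CARD('a)) k ^ 2)"
    unfolding L_def q_factorial_def assms(2) by (simp add: power_one_over prod_power_distrib)
  have "eventually (\<lambda>n. \<forall>i<n. \<forall>j<n. entry_dist (c * ln (real n) / real n) (q n j i)) sequentially"
    using assms(6)
  proof eventually_elim
    case (elim n)
    show ?case
    proof (intro allI impI)
      fix i j assume "i < n" "j < n"
      then show "entry_dist (c * ln (real n) / real n) (q n j i)"
        unfolding q_def using elim assms(4)[of n]
        by (intro entry_dist_of_balanced) (auto simp: balanced_mat_def)
    qed
  qed
  then have E: "E \<longlonglongrightarrow> L"
    unfolding L E_def by (rule expose_tendsto[OF e \<open>c > 1\<close>])
  have law: "eventually (\<lambda>n. measure (M n) {\<omega> \<in> space (M n). G n (A n \<omega>)} = E n) sequentially"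
    if G: "\<And>n B. B \<in> carrier_mat n n \<Longrightarrow> G n B \<longleftrightarrow> card (left_kernel n B) = CARD('a) ^ k"
    for G :: "nat \<Rightarrow> 'a mat \<Rightarrow> bool"
    using assms(6) eventually_ge_at_top[of 1]
  proof eventually_elim
    case (elim n)
    have "prob_space.indep_vars (M n) (\<lambda>_. count_space UNIV) (\<lambda>ij \<omega>. A n \<omega> $$ ij) ({..<n} \<times> {..<n})"
      using elim by (simp add: balanced_mat_def)
    from measure_eq_expose[OF assms(4)[OF elim(2)] elim(2) assms(5)[OF elim(2)] this G]
    show ?case by (simp add: E_def q_def[abs_def])
  qed
  show ?thesis
  proof
    show "(\<lambda>n. measure (M n) {\<omega> \<in> space (M n).
            module_isomorphic class_ring (cokernel (A n \<omega>)) (module_vec TYPE('a) k)}) \<longlonglongrightarrow> L"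
      using E law[of "\<lambda>_ B. module_isomorphic class_ring (cokernel B) (module_vec TYPE('a) k)"]
        cokernel_iso_iff_card_left_kernel[OF e] by (simp add: tendsto_cong)
    show "(\<lambda>n. measure (M n) {\<omega> \<in> space (M n).
            int (vec_space.rank n (A n \<omega>)) = int n - int k}) \<longlonglongrightarrow> L"
      using E law[of "\<lambda>n B. int (vec_space.rank n B) = int n - int k"]
        rank_iff_card_left_kernel[OF e] by (simp add: tendsto_cong)
  qed
qed

end
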